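(* Let $\mathbb{T}$ be a complete Elgot monad on a distributive category $\mathbf{C}$, let $\Sigma$ be a strong functor, assume that for every object $X$ the functor $T(X+\Sigma(-))$ has a final coalgebra $\mathrm{out}_X:T_\Sigma X\to T(X+\Sigma T_\Sigma X)$, and let $\mathbb{T}_\Sigma$ be the coinductive generalized resumption monad (strong monad structure $\eta^{\nu},(-)^{\ddagger},\tau^{\nu}$ as in the context). Then: (1) There is a unique iteration operator $(-)^{\dagger}$ making $\mathbb{T}_\Sigma$ a complete Elgot monad that extends the iteration of $\mathbb{T}$ in the following sense: for $f:X\to T_\Sigma(Y+X)$ and $g:X\to T(Y+X)$, if $\mathrm{out}\circ f=T\mathrm{inl}\circ g$ then $\mathrm{out}\circ f^{\dagger}=T\mathrm{inl}\circ g^{\dagger}$. (2) For any guarded $f:X\to T_\Sigma(Y+X)$, $f^{\dagger}$ is the unique morphism $h:X\to T_\Sigma Y$ satisfying $[\eta^{\nu},h]^{\ddagger}\circ f=h$.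
   Context: $\mathbf{C}$ is distributive (finite products and coproducts, $[\mathrm{id}\times\mathrm{inl},\mathrm{id}\times\mathrm{inr}]:X\times Y+X\times Z\to X\times(Y+Z)$ invertible with inverse $\mathrm{dist}$). A strong monad is a Kleisli triple $(T,\eta,(-)^{*})$ with strength $\tau$ satisfying the usual laws. A complete Elgot monad is a strong monad with an operator assigning to every $f:X\to T(Y+X)$ a morphism $f^{\dagger}:X\to TY$ such that: (unfolding) $[\eta,f^{\dagger}]^{*}\circ f=f^{\dagger}$; (naturality) $g^{*}\circ f^{\dagger}=([T\mathrm{inl}\circ g,\eta\circ\mathrm{inr}]^{*}\circ f)^{\dagger}$ for $g:Y\to TZ$; (dinaturality) $([\eta\circ\mathrm{inl},h]^{*}\circ g)^{\dagger}=[\eta,([\eta\circ\mathrm{inl},g]^{*}\circ h)^{\dagger}]^{*}\circ g$ for $g:X\to T(Y+Z)$, $h:Z\to T(Y+X)$; (codiagonal) $(T[\mathrm{id},\mathrm{inr}]\circ g)^{\dagger}=(g^{\dagger})^{\dagger}$ for $g:X\to T((Y+X)+X)$; (uniformity) if $f\circ h=T(\mathrm{id}+h)\circ g$ for $g:Z\to T(Y+Z)$, $h:Z\to X$ then $f^{\dagger}\circ h=g^{\dagger}$; (strength) $\tau\circ(\mathrm{id}\times f^{\dagger})=(T\mathrm{dist}\circ\tau\circ(\mathrm{id}\times f))^{\dagger}$. $\Sigma$ has strength $\rho:X\times\Sigma Y\to\Sigma(X\times Y)$. The monad $\mathbb{T}_\Sigma$ on $T_\Sigma X$: unit $\eta^{\nu}$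 with $\mathrm{out}\circ\eta^{\nu}=\eta\circ\mathrm{inl}$; for $f:X\to T_\Sigma Y$, $f^{\ddagger}$ is the unique morphism with $\mathrm{out}\circ f^{\ddagger}=[\mathrm{out}\circ f,\eta\circ\mathrm{inr}\circ\Sigma f^{\ddagger}]^{*}\circ\mathrm{out}$; strength $\tau^{\nu}$ is the unique morphism with $\mathrm{out}\circ\tau^{\nu}=T(\mathrm{id}+\Sigma\tau^{\nu})\circ T((\mathrm{id}+\rho)\circ\mathrm{dist})\circ\tau\circ(\mathrm{id}\times\mathrm{out})$. A morphism $f:X\to T_\Sigma(Y+Z)$ is guarded if there is $u:X\to T(Y+\Sigma T_\Sigma(Y+Z))$ with $\mathrm{out}\circ f=T(\mathrm{inl}+\mathrm{id})\circ u$. *)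

theory Defs
  imports Main
begin

section \<open>Categories with chosen finite products and coproducts\<close>

record ('o, 'm) cat =
  Ob  :: "'o set"
  Mor :: "'m set"
  Dom :: "'m \<Rightarrow> 'o"
  Cod :: "'m \<Rightarrow> 'o"
  Id  :: "'o \<Rightarrow> 'm"
  Comp :: "'m \<Rightarrow> 'm \<Rightarrow> 'm" (infixr "\<cdot>\<index>" 70)

definition hom :: "('o, 'm, 'z) cat_scheme \<Rightarrow> 'o \<Rightarrow> 'o \<Rightarrow> 'm set" where
  "hom C X Y = {f \<in> Mor C. Dom C f = X \<and> Cod C f = Y}"

locale category =
  fixes C :: "('o, 'm, 'z) cat_scheme" (structure)
  assumes Dom_Ob: "f \<in> Mor C \<Longrightarrow> Dom C f \<in> Ob C"
    and Cod_Ob: "f \<in> Mor C \<Longrightarrow> Cod C f \<in> Ob C"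
    and Id_hom: "X \<in> Ob C \<Longrightarrow> Id C X \<in> hom C X X"
    and Comp_hom: "\<lbrakk>f \<in> hom C X Y; g \<in> hom C Y Z\<rbrakk> \<Longrightarrow> g \<cdot> f \<in> hom C X Z"
    and Comp_Id_left: "f \<in> hom C X Y \<Longrightarrow> Id C Y \<cdot> f = f"
    and Comp_Id_right: "f \<in> hom C X Y \<Longrightarrow> f \<cdot> Id C X = f"
    and Comp_assoc:
      "\<lbrakk>f \<in> hom C W X; g \<in> hom C X Y; h \<in> hom C Y Z\<rbrakk> \<Longrightarrow> (h \<cdot> g) \<cdot> f = h \<cdot> (g \<cdot> f)"

record ('o, 'm) bicat = "('o, 'm) cat" +
  One  :: "'o"
  Prod :: "'o \<Rightarrow> 'o \<Rightarrow> 'o" (infixr "\<otimes>\<index>" 75)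
  Fst  :: "'o \<Rightarrow> 'o \<Rightarrow> 'm"
  Snd  :: "'o \<Rightarrow> 'o \<Rightarrow> 'm"
  Zero :: "'o"
  Sum  :: "'o \<Rightarrow> 'o \<Rightarrow> 'o" (infixr "\<oplus>\<index>" 73)
  Inl  :: "'o \<Rightarrow> 'o \<Rightarrow> 'm"
  Inr  :: "'o \<Rightarrow> 'o \<Rightarrow> 'm"

locale bicartesian_category = category C for C :: "('o, 'm, 'z) bicat_scheme" (structure) +
  assumes One_Ob: "One C \<in> Ob C"
    and One_terminal: "X \<in> Ob C \<Longrightarrow> \<exists>!h. h \<in> hom C X (One C)"
    and Prod_Ob: "\<lbrakk>X \<in> Ob C; Y \<in> Ob C\<rbrakk> \<Longrightarrow> X \<otimes> Y \<in> Ob C"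
    and Fst_hom: "\<lbrakk>X \<in> Ob C; Y \<in> Ob C\<rbrakk> \<Longrightarrow> Fst C X Y \<in> hom C (X \<otimes> Y) X"
    and Snd_hom: "\<lbrakk>X \<in> Ob C; Y \<in> Ob C\<rbrakk> \<Longrightarrow> Snd C X Y \<in> hom C (X \<otimes> Y) Y"
    and Prod_universal: "\<lbrakk>f \<in> hom C W X; g \<in> hom C W Y\<rbrakk> \<Longrightarrow>
      \<exists>!h. h \<in> hom C W (X \<otimes> Y) \<and> Fst C X Y \<cdot> h = f \<and> Snd C X Y \<cdot> h = g"
    and Zero_Ob: "Zero C \<in> Ob C"
    and Zero_initial: "X \<in> Ob C \<Longrightarrow> \<exists>!h. h \<in> hom C (Zero C) X"
    and Sum_Ob: "\<lbrakk>X \<in> Ob C; Y \<in> Ob C\<rbrakk> \<Longrightarrow> X \<oplus> Y \<in> Ob C"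
    and Inl_hom: "\<lbrakk>X \<in> Ob C; Y \<in> Ob C\<rbrakk> \<Longrightarrow> Inl C X Y \<in> hom C X (X \<oplus> Y)"
    and Inr_hom: "\<lbrakk>X \<in> Ob C; Y \<in> Ob C\<rbrakk> \<Longrightarrow> Inr C X Y \<in> hom C Y (X \<oplus> Y)"
    and Sum_universal: "\<lbrakk>f \<in> hom C X Z; g \<in> hom C Y Z\<rbrakk> \<Longrightarrow>
      \<exists>!h. h \<in> hom C (X \<oplus> Y) Z \<and> h \<cdot> Inl C X Y = f \<and> h \<cdot> Inr C X Y = g"

definition pair :: "('o, 'm, 'z) bicat_scheme \<Rightarrow> 'm \<Rightarrow> 'm \<Rightarrow> 'm" ("\<langle>_,/ _\<rangle>\<index>") where
  "\<langle>f, g\<rangle>\<^bsub>C\<^esub> =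
    (THE h. h \<in> hom C (Dom C f) (Cod C f \<otimes>\<^bsub>C\<^esub> Cod C g) \<and>
       Fst C (Cod C f) (Cod C g) \<cdot>\<^bsub>C\<^esub> h = f \<and> Snd C (Cod C f) (Cod C g) \<cdot>\<^bsub>C\<^esub> h = g)"

text \<open>The copairing \<open>[f, g]\<close> is written \<open>f \<nabla> g\<close>, since square brackets denote lists.\<close>

definition copair :: "('o, 'm, 'z) bicat_scheme \<Rightarrow> 'm \<Rightarrow> 'm \<Rightarrow> 'm" (infixr "\<nabla>\<index>" 71) where
  "f \<nabla>\<^bsub>C\<^esub> g =
    (THE h. h \<in> hom C (Dom C f \<oplus>\<^bsub>C\<^esub> Dom C g) (Cod C f) \<and>
       h \<cdot>\<^bsub>C\<^esub> Inl C (Dom C f) (Dom C g) = f \<and> h \<cdot>\<^bsub>C\<^esub> Inr C (Dom C f) (Dom C g) = g)"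

definition prod_map :: "('o, 'm, 'z) bicat_scheme \<Rightarrow> 'm \<Rightarrow> 'm \<Rightarrow> 'm" (infixr "\<boxtimes>\<index>" 75) where
  "f \<boxtimes>\<^bsub>C\<^esub> g =
    \<langle>f \<cdot>\<^bsub>C\<^esub> Fst C (Dom C f) (Dom C g), g \<cdot>\<^bsub>C\<^esub> Snd C (Dom C f) (Dom C g)\<rangle>\<^bsub>C\<^esub>"

definition sum_map :: "('o, 'm, 'z) bicat_scheme \<Rightarrow> 'm \<Rightarrow> 'm \<Rightarrow> 'm" (infixr "\<boxplus>\<index>" 73) where
  "f \<boxplus>\<^bsub>C\<^esub> g =
    (Inl C (Cod C f) (Cod C g) \<cdot>\<^bsub>C\<^esub> f) \<nabla>\<^bsub>C\<^esub> (Inr C (Cod C f) (Cod C g) \<cdot>\<^bsub>C\<^esub> g)"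

definition prod_assoc :: "('o, 'm, 'z) bicat_scheme \<Rightarrow> 'o \<Rightarrow> 'o \<Rightarrow> 'o \<Rightarrow> 'm" where
  "prod_assoc C X Y Z =
    \<langle>Fst C X Y \<cdot>\<^bsub>C\<^esub> Fst C (X \<otimes>\<^bsub>C\<^esub> Y) Z,
      \<langle>Snd C X Y \<cdot>\<^bsub>C\<^esub> Fst C (X \<otimes>\<^bsub>C\<^esub> Y) Z, Snd C (X \<otimes>\<^bsub>C\<^esub> Y) Z\<rangle>\<^bsub>C\<^esub>\<rangle>\<^bsub>C\<^esub>"

definition inverse_pair :: "('o, 'm, 'z) cat_scheme \<Rightarrow> 'o \<Rightarrow> 'o \<Rightarrow> 'm \<Rightarrow> 'm \<Rightarrow> bool" where
  "inverse_pair C X Y f g \<longleftrightarrow> f \<in> hom C X Y \<and> g \<in> hom C Y X \<and>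
     g \<cdot>\<^bsub>C\<^esub> f = Id C X \<and> f \<cdot>\<^bsub>C\<^esub> g = Id C Y"

definition codist :: "('o, 'm, 'z) bicat_scheme \<Rightarrow> 'o \<Rightarrow> 'o \<Rightarrow> 'o \<Rightarrow> 'm" where
  "codist C X Y Z = (Id C X \<boxtimes>\<^bsub>C\<^esub> Inl C Y Z) \<nabla>\<^bsub>C\<^esub> (Id C X \<boxtimes>\<^bsub>C\<^esub> Inr C Y Z)"

definition dist :: "('o, 'm, 'z) bicat_scheme \<Rightarrow> 'o \<Rightarrow> 'o \<Rightarrow> 'o \<Rightarrow> 'm" where
  "dist C X Y Z =
    (THE d. inverse_pair C ((X \<otimes>\<^bsub>C\<^esub> Y) \<oplus>\<^bsub>C\<^esub> (X \<otimes>\<^bsub>C\<^esub> Z)) (X \<otimes>\<^bsub>C\<^esub> (Y \<oplus>\<^bsub>C\<^esub> Z)) (codist C X Y Z) d)"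

locale distributive_category = bicartesian_category +
  assumes codist_invertible: "\<lbrakk>X \<in> Ob C; Y \<in> Ob C; Z \<in> Ob C\<rbrakk> \<Longrightarrow>
    \<exists>d. inverse_pair C ((X \<otimes> Y) \<oplus> (X \<otimes> Z)) (X \<otimes> (Y \<oplus> Z)) (codist C X Y Z) d"


section \<open>Strong functors and strong monads\<close>

record ('o, 'm) functor_data =
  FOb  :: "'o \<Rightarrow> 'o"
  FMap :: "'m \<Rightarrow> 'm"
  FStr :: "'o \<Rightarrow> 'o \<Rightarrow> 'm"

locale strong_functor = distributive_category C
  for C :: "('o, 'm, 'z) bicat_scheme" (structure) +
  fixes S :: "('o, 'm) functor_data"
  assumes FOb_Ob: "X \<in> Ob C \<Longrightarrow> FOb S X \<in> Ob C"
    and FMap_hom: "f \<in> hom C X Y \<Longrightarrow> FMap S f \<in> hom C (FOb S X) (FOb S Y)"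
    and FMap_Id: "X \<in> Ob C \<Longrightarrow> FMap S (Id C X) = Id C (FOb S X)"
    and FMap_Comp: "\<lbrakk>f \<in> hom C X Y; g \<in> hom C Y Z\<rbrakk> \<Longrightarrow> FMap S (g \<cdot> f) = FMap S g \<cdot> FMap S f"
    and FStr_hom:
      "\<lbrakk>X \<in> Ob C; Y \<in> Ob C\<rbrakk> \<Longrightarrow> FStr S X Y \<in> hom C (X \<otimes> FOb S Y) (FOb S (X \<otimes> Y))"
    and FStr_natural: "\<lbrakk>f \<in> hom C X X'; g \<in> hom C Y Y'\<rbrakk> \<Longrightarrow>
      FMap S (f \<boxtimes> g) \<cdot> FStr S X Y = FStr S X' Y' \<cdot> (f \<boxtimes> FMap S g)"
    and FStr_unit: "X \<in> Ob C \<Longrightarrow>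
      FMap S (Snd C (One C) X) \<cdot> FStr S (One C) X = Snd C (One C) (FOb S X)"
    and FStr_assoc: "\<lbrakk>X \<in> Ob C; Y \<in> Ob C; Z \<in> Ob C\<rbrakk> \<Longrightarrow>
      FMap S (prod_assoc C X Y Z) \<cdot> FStr S (X \<otimes> Y) Z =
      FStr S X (Y \<otimes> Z) \<cdot> (Id C X \<boxtimes> FStr S Y Z) \<cdot> prod_assoc C X Y (FOb S Z)"

text \<open>
  For \<open>f : X \<rightarrow> T Y\<close> the Kleisli extension \<open>f\<^sup>* : T X \<rightarrow> T Y\<close> is \<open>Ext T Y f\<close>. The object \<open>Y\<close>
  has to be passed explicitly: the object map need not be injective, so \<open>f\<close> determines
  \<open>T Y\<close> but not \<open>Y\<close>.
\<close>

record ('o, 'm) monad_data =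
  TOb :: "'o \<Rightarrow> 'o"
  Eta :: "'o \<Rightarrow> 'm"
  Ext :: "'o \<Rightarrow> 'm \<Rightarrow> 'm"
  Str :: "'o \<Rightarrow> 'o \<Rightarrow> 'm"

definition TMap :: "('o, 'm, 'z) bicat_scheme \<Rightarrow> ('o, 'm) monad_data \<Rightarrow> 'm \<Rightarrow> 'm" where
  "TMap C T f = Ext T (Cod C f) (Eta T (Cod C f) \<cdot>\<^bsub>C\<^esub> f)"

locale strong_monad = distributive_category C
  for C :: "('o, 'm, 'z) bicat_scheme" (structure) +
  fixes T :: "('o, 'm) monad_data"
  assumes TOb_Ob: "X \<in> Ob C \<Longrightarrow> TOb T X \<in> Ob C"
    and Eta_hom: "X \<in> Ob C \<Longrightarrow> Eta T X \<in> hom C X (TOb T X)"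
    and Ext_hom: "\<lbrakk>X \<in> Ob C; Y \<in> Ob C; f \<in> hom C X (TOb T Y)\<rbrakk> \<Longrightarrow>
      Ext T Y f \<in> hom C (TOb T X) (TOb T Y)"
    and Ext_Eta: "X \<in> Ob C \<Longrightarrow> Ext T X (Eta T X) = Id C (TOb T X)"
    and Ext_Comp_Eta: "\<lbrakk>X \<in> Ob C; Y \<in> Ob C; f \<in> hom C X (TOb T Y)\<rbrakk> \<Longrightarrow>
      Ext T Y f \<cdot> Eta T X = f"
    and Ext_Ext: "\<lbrakk>X \<in> Ob C; Y \<in> Ob C; Z \<in> Ob C;
        g \<in> hom C X (TOb T Y); f \<in> hom C Y (TOb T Z)\<rbrakk> \<Longrightarrow>
      Ext T Z (Ext T Z f \<cdot> g) = Ext T Z f \<cdot> Ext T Y g"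
    and Str_hom: "\<lbrakk>X \<in> Ob C; Y \<in> Ob C\<rbrakk> \<Longrightarrow> Str T X Y \<in> hom C (X \<otimes> TOb T Y) (TOb T (X \<otimes> Y))"
    and Str_natural: "\<lbrakk>f \<in> hom C X X'; g \<in> hom C Y Y'\<rbrakk> \<Longrightarrow>
      TMap C T (f \<boxtimes> g) \<cdot> Str T X Y = Str T X' Y' \<cdot> (f \<boxtimes> TMap C T g)"
    and Str_unit: "X \<in> Ob C \<Longrightarrow>
      TMap C T (Snd C (One C) X) \<cdot> Str T (One C) X = Snd C (One C) (TOb T X)"
    and Str_assoc: "\<lbrakk>X \<in> Ob C; Y \<in> Ob C; Z \<in> Ob C\<rbrakk> \<Longrightarrow>
      TMap C T (prod_assoc C X Y Z) \<cdot> Str T (X \<otimes> Y) Z =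
      Str T X (Y \<otimes> Z) \<cdot> (Id C X \<boxtimes> Str T Y Z) \<cdot> prod_assoc C X Y (TOb T Z)"
    and Str_Eta: "\<lbrakk>X \<in> Ob C; Y \<in> Ob C\<rbrakk> \<Longrightarrow>
      Str T X Y \<cdot> (Id C X \<boxtimes> Eta T Y) = Eta T (X \<otimes> Y)"
    and Str_Ext: "\<lbrakk>X \<in> Ob C; Y \<in> Ob C; Z \<in> Ob C; f \<in> hom C Y (TOb T Z)\<rbrakk> \<Longrightarrow>
      Ext T (X \<otimes> Z) (Str T X Z \<cdot> (Id C X \<boxtimes> f)) \<cdot> Str T X Y =
      Str T X Z \<cdot> (Id C X \<boxtimes> Ext T Z f)"


section \<open>Complete Elgot monads\<close>

text \<open>
  For \<open>f : X \<rightarrow> T (Y + X)\<close> the iterate \<open>f\<^sup>\<dagger> : X \<rightarrow> T Y\<close> is \<open>it Y f\<close>; as for \<open>Ext\<close>, the object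
  \<open>Y\<close> is not determined by \<open>f\<close>.
\<close>

locale complete_elgot_monad = strong_monad C T
  for C :: "('o, 'm, 'z) bicat_scheme" (structure) and T :: "('o, 'm) monad_data" +
  fixes it :: "'o \<Rightarrow> 'm \<Rightarrow> 'm"
  assumes it_hom: "\<lbrakk>X \<in> Ob C; Y \<in> Ob C; f \<in> hom C X (TOb T (Y \<oplus> X))\<rbrakk> \<Longrightarrow>
      it Y f \<in> hom C X (TOb T Y)"
    and it_unfolding: "\<lbrakk>X \<in> Ob C; Y \<in> Ob C; f \<in> hom C X (TOb T (Y \<oplus> X))\<rbrakk> \<Longrightarrow>
      Ext T Y (Eta T Y \<nabla> it Y f) \<cdot> f = it Y f"
    and it_naturality: "\<lbrakk>X \<in> Ob C; Y \<in> Ob C; Z \<in> Ob C;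
        f \<in> hom C X (TOb T (Y \<oplus> X)); g \<in> hom C Y (TOb T Z)\<rbrakk> \<Longrightarrow>
      Ext T Z g \<cdot> it Y f =
      it Z (Ext T (Z \<oplus> X) ((TMap C T (Inl C Z X) \<cdot> g) \<nabla> (Eta T (Z \<oplus> X) \<cdot> Inr C Z X)) \<cdot> f)"
    and it_dinaturality: "\<lbrakk>X \<in> Ob C; Y \<in> Ob C; Z \<in> Ob C;
        g \<in> hom C X (TOb T (Y \<oplus> Z)); h \<in> hom C Z (TOb T (Y \<oplus> X))\<rbrakk> \<Longrightarrow>
      it Y (Ext T (Y \<oplus> X) ((Eta T (Y \<oplus> X) \<cdot> Inl C Y X) \<nabla> h) \<cdot> g) =
      Ext T Y (Eta T Y \<nabla> it Y (Ext T (Y \<oplus> Z) ((Eta T (Y \<oplus> Z) \<cdot> Inl C Y Z) \<nabla> g) \<cdot> h)) \<cdot> g"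
    and it_codiagonal: "\<lbrakk>X \<in> Ob C; Y \<in> Ob C; g \<in> hom C X (TOb T ((Y \<oplus> X) \<oplus> X))\<rbrakk> \<Longrightarrow>
      it Y (TMap C T (Id C (Y \<oplus> X) \<nabla> Inr C Y X) \<cdot> g) = it Y (it (Y \<oplus> X) g)"
    and it_uniformity: "\<lbrakk>X \<in> Ob C; Y \<in> Ob C; Z \<in> Ob C; f \<in> hom C X (TOb T (Y \<oplus> X));
        g \<in> hom C Z (TOb T (Y \<oplus> Z)); h \<in> hom C Z X;
        f \<cdot> h = TMap C T (Id C Y \<boxplus> h) \<cdot> g\<rbrakk> \<Longrightarrow>
      it Y f \<cdot> h = it Y g"
    and it_strength: "\<lbrakk>X \<in> Ob C; Y \<in> Ob C; Z \<in> Ob C; f \<in> hom C X (TOb T (Y \<oplus> X))\<rbrakk> \<Longrightarrow>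
      Str T Z Y \<cdot> (Id C Z \<boxtimes> it Y f) =
      it (Z \<otimes> Y) (TMap C T (dist C Z Y X) \<cdot> Str T Z (Y \<oplus> X) \<cdot> (Id C Z \<boxtimes> f))"


section \<open>The coinductive generalized resumption monad\<close>

definition final_coalgebra ::
    "('o, 'm, 'z) cat_scheme \<Rightarrow> ('o \<Rightarrow> 'o) \<Rightarrow> ('m \<Rightarrow> 'm) \<Rightarrow> 'o \<Rightarrow> 'm \<Rightarrow> bool" where
  "final_coalgebra C F Fm A a \<longleftrightarrow> A \<in> Ob C \<and> a \<in> hom C A (F A) \<and>
     (\<forall>B\<in>Ob C. \<forall>b\<in>hom C B (F B). \<exists>!h. h \<in> hom C B A \<and> a \<cdot>\<^bsub>C\<^esub> h = Fm h \<cdot>\<^bsub>C\<^esub> b)"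

text \<open>Object and morphism part of the functor \<open>T (X + \<Sigma> -)\<close>.\<close>

definition resOb :: "('o, 'm, 'z) bicat_scheme \<Rightarrow> ('o, 'm) monad_data \<Rightarrow>
    ('o, 'm) functor_data \<Rightarrow> 'o \<Rightarrow> 'o \<Rightarrow> 'o" where
  "resOb C T S X Z = TOb T (X \<oplus>\<^bsub>C\<^esub> FOb S Z)"

definition resMap :: "('o, 'm, 'z) bicat_scheme \<Rightarrow> ('o, 'm) monad_data \<Rightarrow>
    ('o, 'm) functor_data \<Rightarrow> 'o \<Rightarrow> 'm \<Rightarrow> 'm" where
  "resMap C T S X h = TMap C T (Id C X \<boxplus>\<^bsub>C\<^esub> FMap S h)"

text \<open>
  In the following, \<open>N X\<close> is the object \<open>T\<^sub>\<Sigma> X\<close> and \<open>out X : T\<^sub>\<Sigma> X \<rightarrow> T (X + \<Sigma> T\<^sub>\<Sigma> X)\<close>.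
  That the definite descriptions below denote is not assumed anywhere; it is a consequence of
  the finality of \<open>out\<close>.
\<close>

definition resEta :: "('o, 'm, 'z) bicat_scheme \<Rightarrow> ('o, 'm) monad_data \<Rightarrow>
    ('o, 'm) functor_data \<Rightarrow> ('o \<Rightarrow> 'o) \<Rightarrow> ('o \<Rightarrow> 'm) \<Rightarrow> 'o \<Rightarrow> 'm" where
  "resEta C T S N out X =
    (THE h. h \<in> hom C X (N X) \<and>
       out X \<cdot>\<^bsub>C\<^esub> h = Eta T (X \<oplus>\<^bsub>C\<^esub> FOb S (N X)) \<cdot>\<^bsub>C\<^esub> Inl C X (FOb S (N X)))"

definition resExt :: "('o, 'm, 'z) bicat_scheme \<Rightarrow> ('o, 'm) monad_data \<Rightarrow>
    ('o, 'm) functor_data \<Rightarrow> ('o \<Rightarrow> 'o) \<Rightarrow> ('o \<Rightarrow> 'm) \<Rightarrow> 'o \<Rightarrow> 'm \<Rightarrow> 'm" where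
  "resExt C T S N out Y f =
    (THE h. h \<in> hom C (N (Dom C f)) (N Y) \<and>
       out Y \<cdot>\<^bsub>C\<^esub> h =
       Ext T (Y \<oplus>\<^bsub>C\<^esub> FOb S (N Y))
         ((out Y \<cdot>\<^bsub>C\<^esub> f) \<nabla>\<^bsub>C\<^esub>
          (Eta T (Y \<oplus>\<^bsub>C\<^esub> FOb S (N Y)) \<cdot>\<^bsub>C\<^esub> Inr C Y (FOb S (N Y)) \<cdot>\<^bsub>C\<^esub> FMap S h))
       \<cdot>\<^bsub>C\<^esub> out (Dom C f))"

definition resStr :: "('o, 'm, 'z) bicat_scheme \<Rightarrow> ('o, 'm) monad_data \<Rightarrow>
    ('o, 'm) functor_data \<Rightarrow> ('o \<Rightarrow> 'o) \<Rightarrow> ('o \<Rightarrow> 'm) \<Rightarrow> 'o \<Rightarrow> 'o \<Rightarrow> 'm" where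
  "resStr C T S N out X Y =
    (THE h. h \<in> hom C (X \<otimes>\<^bsub>C\<^esub> N Y) (N (X \<otimes>\<^bsub>C\<^esub> Y)) \<and>
       out (X \<otimes>\<^bsub>C\<^esub> Y) \<cdot>\<^bsub>C\<^esub> h =
       TMap C T (Id C (X \<otimes>\<^bsub>C\<^esub> Y) \<boxplus>\<^bsub>C\<^esub> FMap S h)
       \<cdot>\<^bsub>C\<^esub> TMap C T ((Id C (X \<otimes>\<^bsub>C\<^esub> Y) \<boxplus>\<^bsub>C\<^esub> FStr S X (N Y)) \<cdot>\<^bsub>C\<^esub> dist C X Y (FOb S (N Y)))
       \<cdot>\<^bsub>C\<^esub> Str T X (Y \<oplus>\<^bsub>C\<^esub> FOb S (N Y))
       \<cdot>\<^bsub>C\<^esub> (Id C X \<boxtimes>\<^bsub>C\<^esub> out Y))"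

definition resumption_monad :: "('o, 'm, 'z) bicat_scheme \<Rightarrow> ('o, 'm) monad_data \<Rightarrow>
    ('o, 'm) functor_data \<Rightarrow> ('o \<Rightarrow> 'o) \<Rightarrow> ('o \<Rightarrow> 'm) \<Rightarrow> ('o, 'm) monad_data" where
  "resumption_monad C T S N out =
    \<lparr>TOb = N, Eta = resEta C T S N out, Ext = resExt C T S N out, Str = resStr C T S N out\<rparr>"

text \<open>
  \<open>itN\<close> extends \<open>it\<close> along the monad inclusion that sends \<open>g : X \<rightarrow> T Y\<close> to the
  \<open>f : X \<rightarrow> T\<^sub>\<Sigma> Y\<close> with \<open>out \<circ> f = T inl \<circ> g\<close>.
\<close>

definition extends_iteration :: "('o, 'm, 'z) bicat_scheme \<Rightarrow> ('o, 'm) monad_data \<Rightarrow>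
    ('o \<Rightarrow> 'm \<Rightarrow> 'm) \<Rightarrow> ('o, 'm) functor_data \<Rightarrow> ('o \<Rightarrow> 'o) \<Rightarrow> ('o \<Rightarrow> 'm) \<Rightarrow>
    ('o \<Rightarrow> 'm \<Rightarrow> 'm) \<Rightarrow> bool" where
  "extends_iteration C T it S N out itN \<longleftrightarrow>
    (\<forall>X\<in>Ob C. \<forall>Y\<in>Ob C. \<forall>f\<in>hom C X (N (Y \<oplus>\<^bsub>C\<^esub> X)). \<forall>g\<in>hom C X (TOb T (Y \<oplus>\<^bsub>C\<^esub> X)).
       out (Y \<oplus>\<^bsub>C\<^esub> X) \<cdot>\<^bsub>C\<^esub> f =
         TMap C T (Inl C (Y \<oplus>\<^bsub>C\<^esub> X) (FOb S (N (Y \<oplus>\<^bsub>C\<^esub> X)))) \<cdot>\<^bsub>C\<^esub> g \<longrightarrow>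
       out Y \<cdot>\<^bsub>C\<^esub> itN Y f = TMap C T (Inl C Y (FOb S (N Y))) \<cdot>\<^bsub>C\<^esub> it Y g)"

definition guarded :: "('o, 'm, 'z) bicat_scheme \<Rightarrow> ('o, 'm) monad_data \<Rightarrow>
    ('o, 'm) functor_data \<Rightarrow> ('o \<Rightarrow> 'o) \<Rightarrow> ('o \<Rightarrow> 'm) \<Rightarrow> 'o \<Rightarrow> 'o \<Rightarrow> 'o \<Rightarrow> 'm \<Rightarrow> bool" where
  "guarded C T S N out X Y Z f \<longleftrightarrow> f \<in> hom C X (N (Y \<oplus>\<^bsub>C\<^esub> Z)) \<and>
    (\<exists>u\<in>hom C X (TOb T (Y \<oplus>\<^bsub>C\<^esub> FOb S (N (Y \<oplus>\<^bsub>C\<^esub> Z)))).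
       out (Y \<oplus>\<^bsub>C\<^esub> Z) \<cdot>\<^bsub>C\<^esub> f =
       TMap C T (Inl C Y Z \<boxplus>\<^bsub>C\<^esub> Id C (FOb S (N (Y \<oplus>\<^bsub>C\<^esub> Z)))) \<cdot>\<^bsub>C\<^esub> u)"

end

theory Submission
  imports Defs
begin

text \<open>
  For \<open>f : X \<rightarrow> T\<^sub>\<Sigma> (Y + X)\<close>, first iterate in \<open>T\<close> the recursive calls of \<open>out \<circ> f\<close> that are not
  under \<open>\<Sigma>\<close>; this gives \<open>w : X \<rightarrow> T (Y + \<Sigma> T\<^sub>\<Sigma> (Y + X))\<close>, and by finality there is exactly one
  \<open>h : X \<rightarrow> T\<^sub>\<Sigma> Y\<close> with \<open>out \<circ> h = T (id + \<Sigma> [\<eta>\<^sup>\<nu>, h]\<^sup>\<ddagger>) \<circ> w\<close>. Take \<open>f\<^sup>\<dagger> = h\<close>. Each axiom for this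
  operator is the same axiom for \<open>T\<close>, applied to \<open>w\<close>, followed by uniqueness of \<open>h\<close>; only
  dinaturality is instead deduced from unfolding, codiagonal and uniformity. For guarded \<open>f\<close> the
  first step is vacuous, so that \<open>h\<close> is the unique fixpoint. Conversely, naturality and codiagonal
  force any iteration that extends the one of \<open>T\<close> to factor through a guarded map with the same \<open>w\<close>.
\<close>

section \<open>Arrows with recorded source and target\<close>

text \<open>In the equation that defines \<open>h\<close>, the map under \<Sigma> is
  \<open>[\<eta>\<^sup>\<nu>, h]\<^sup>\<ddagger>\<close> and not \<open>h\<close>, so it is not
  coiteration for \<open>h\<close> and finality does not apply to it as it stands. The unknown is
  therefore changed to \<open>k = [\<eta>\<^sup>\<nu>, h]\<^sup>\<ddagger>\<close>, from
  \<open>T\<^sub>\<Sigma> (Y + X)\<close> to \<open>T\<^sub>\<Sigma> Y\<close>. This is a coalgebra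
  morphism whose source structure depends on \<open>w\<close> only, and \<open>h\<close> is its
  restriction along \<open>\<eta>\<^sup>\<nu> \<circ> inr\<close>. Naturality, codiagonal,
  uniformity and strength then share a shape: the axiom for \<open>T\<close> relates both sides to
  one common map out of \<open>T\<close>, and what is left is an equation between the maps applied
  under \<Sigma>, which is Kleisli calculus in \<open>T\<^sub>\<Sigma>\<close>. For the converse, an
  arbitrary iteration is known only on maps that make no \<Sigma> step. The \<Sigma> layers are
  therefore turned into output values, the loop is run, and a Kleisli composite puts the layers
  back.\<close>

text \<open>
  In a category given by partial operations, the source of a composite is only known once the
  composite is known to be defined, which makes rewriting with typing side conditions exponential.
  Here source and target are stored, so their equations are unconditional, and undefined
  composites are represented by \<open>None\<close>, so associativity is unconditional as well.
\<close>

datatype ('o, 'm) arrow = Arrow (src: 'o) (raw: "'m option") (trg: 'o)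

definition val :: "('o, 'm) arrow \<Rightarrow> 'm" where
  "val a = the (raw a)"

definition arrow_if :: "'o \<Rightarrow> 'o \<Rightarrow> bool \<Rightarrow> 'm \<Rightarrow> ('o, 'm) arrow" where
  "arrow_if X Y P m = Arrow X (if P then Some m else None) Y"

lemma src_arrow_if [simp]: "src (arrow_if X Y P m) = X"
  and trg_arrow_if [simp]: "trg (arrow_if X Y P m) = Y"
  by (simp_all add: arrow_if_def)

lemma val_arrow_if: "P \<Longrightarrow> val (arrow_if X Y P m) = m"
  by (simp add: arrow_if_def val_def)

text \<open>The morphisms have to agree only where the arrows are defined. Unconditional laws below
  are reduced to the typed case by this rule.\<close>

lemma arrow_if_cong:
  assumes "X = X'" "Y = Y'" "P \<longleftrightarrow> P'" "P \<Longrightarrow> m = m'"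
  shows "arrow_if X Y P m = arrow_if X' Y' P' m'"
  using assms by (simp add: arrow_if_def)

context category
begin

definition valid :: "('o, 'm) arrow \<Rightarrow> bool" where
  "valid a \<longleftrightarrow> raw a \<noteq> None \<and> val a \<in> hom C (src a) (trg a)"

lemma valid_val_hom: "valid a \<Longrightarrow> val a \<in> hom C (src a) (trg a)"
  by (simp add: valid_def)

lemma Dom_val [simp]: "valid a \<Longrightarrow> Dom C (val a) = src a"
  and Cod_val [simp]: "valid a \<Longrightarrow> Cod C (val a) = trg a"
  and val_Mor [simp]: "valid a \<Longrightarrow> val a \<in> Mor C"
  by (simp_all add: valid_def hom_def)

lemma src_Ob [simp]: "valid a \<Longrightarrow> src a \<in> Ob C"
  and trg_Ob [simp]: "valid a \<Longrightarrow> trg a \<in> Ob C"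
  by (metis Dom_Ob Dom_val val_Mor) (metis Cod_Ob Cod_val val_Mor)

text \<open>A construction that is well typed on its domain \<open>P\<close> is valid exactly there.
  Most validity rules below are instances.\<close>

lemma valid_arrow_if: "(P \<Longrightarrow> m \<in> hom C X Y) \<Longrightarrow> valid (arrow_if X Y P m) \<longleftrightarrow> P"
  by (simp add: valid_def arrow_if_def val_def)

lemma arrow_eqI:
  assumes "valid a" "valid b" "src a = src b" "trg a = trg b" "val a = val b"
  shows "a = b"
  using assms by (cases a; cases b) (auto simp: valid_def val_def)

lemma arrow_eq_iff:
  "\<lbrakk>valid a; valid b; src a = src b; trg a = trg b\<rbrakk> \<Longrightarrow> a = b \<longleftrightarrow> val a = val b"
  using arrow_eqI by blast

definition lift :: "'m \<Rightarrow> ('o, 'm) arrow" where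
  "lift f = Arrow (Dom C f) (Some f) (Cod C f)"

lemma src_lift [simp]: "src (lift f) = Dom C f"
  and trg_lift [simp]: "trg (lift f) = Cod C f"
  and val_lift [simp]: "val (lift f) = f"
  and valid_lift [simp]: "valid (lift f) \<longleftrightarrow> f \<in> Mor C"
  by (simp_all add: lift_def val_def valid_def hom_def)

lemma lift_val [simp]: "valid a \<Longrightarrow> lift (val a) = a"
  by (rule arrow_eqI) simp_all

text \<open>The resumption structure is given by definite descriptions over raw morphisms, while
  unique existence is proved for arrows; this rule carries the one to the other.\<close>

lemma lift_The:
  assumes ex1: "\<exists>!h. valid h \<and> src h = X \<and> trg h = Y \<and> P h"
    and PQ: "\<And>h. h \<in> hom C X Y \<Longrightarrow> Q h \<longleftrightarrow> P (lift h)"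
  shows "(THE h. h \<in> hom C X Y \<and> Q h) \<in> hom C X Y" "P (lift (THE h. h \<in> hom C X Y \<and> Q h))"
proof -
  obtain h where h: "valid h" "src h = X" "trg h = Y" "P h"
    using ex1 by blast
  have "(THE h. h \<in> hom C X Y \<and> Q h) = val h"
  proof (rule the_equality)
    show "val h \<in> hom C X Y \<and> Q (val h)"
      using h PQ [of "val h"] valid_val_hom [of h] by simp
    show "g = val h" if "g \<in> hom C X Y \<and> Q g" for g
    proof -
      have "lift g = h"
        using ex1 h that PQ [of g] by (metis (mono_tags, lifting) hom_def mem_Collect_eq
            src_lift trg_lift valid_lift)
      then show ?thesis
        by auto
    qed
  qed
  then show "(THE h. h \<in> hom C X Y \<and> Q h) \<in> hom C X Y" "P (lift (THE h. h \<in> hom C X Y \<and> Q h))"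
    using h valid_val_hom [of h] by simp_all
qed

definition ident :: "'o \<Rightarrow> ('o, 'm) arrow" where
  "ident X = arrow_if X X (X \<in> Ob C) (Id C X)"

definition comp :: "('o, 'm) arrow \<Rightarrow> ('o, 'm) arrow \<Rightarrow> ('o, 'm) arrow" (infixr "\<bullet>" 70) where
  "g \<bullet> f = arrow_if (src f) (trg g) (valid g \<and> valid f \<and> src g = trg f) (val g \<cdot> val f)"

lemma src_ident [simp]: "src (ident X) = X"
  and trg_ident [simp]: "trg (ident X) = X"
  and valid_ident [simp]: "valid (ident X) \<longleftrightarrow> X \<in> Ob C"
  and val_ident: "X \<in> Ob C \<Longrightarrow> val (ident X) = Id C X"
  by (simp_all add: ident_def valid_arrow_if Id_hom val_arrow_if)

lemma src_comp [simp]: "src (g \<bullet> f) = src f"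
  and trg_comp [simp]: "trg (g \<bullet> f) = trg g"
  by (simp_all add: comp_def)

lemma valid_comp [simp]: "valid (g \<bullet> f) \<longleftrightarrow> valid g \<and> valid f \<and> src g = trg f"
  unfolding comp_def by (rule valid_arrow_if) (metis Comp_hom valid_val_hom)

lemma val_comp: "\<lbrakk>valid g; valid f; src g = trg f\<rbrakk> \<Longrightarrow> val (g \<bullet> f) = val g \<cdot> val f"
  by (simp add: comp_def val_arrow_if)

lemma comp_assoc: "(h \<bullet> g) \<bullet> f = h \<bullet> g \<bullet> f"
proof -
  have "val (h \<bullet> g) \<cdot> val f = val h \<cdot> val (g \<bullet> f)"
    if "valid h" "valid g" "valid f" "src h = trg g" "src g = trg f"
    using that by (simp add: val_comp) (metis Comp_assoc valid_val_hom)
  then show ?thesis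
    unfolding comp_def [of "h \<bullet> g" f] comp_def [of h "g \<bullet> f"]
    by (intro arrow_if_cong) auto
qed

text \<open>Composites are kept nested to the right, where \<open>a \<bullet> b\<close> is in
  general not a subterm. Applied by \<open>THEN\<close>, this gives the form of an equation that
  rewrites inside a longer composite.\<close>

lemma comp_reassoc: "a \<bullet> b = c \<Longrightarrow> a \<bullet> b \<bullet> x = c \<bullet> x"
  by (metis comp_assoc)

lemma ident_comp [simp]: "\<lbrakk>valid f; trg f = X\<rbrakk> \<Longrightarrow> ident X \<bullet> f = f"
  by (rule arrow_eqI) (auto simp: val_comp val_ident Comp_Id_left [OF valid_val_hom])

lemma comp_ident [simp]: "\<lbrakk>valid f; src f = X\<rbrakk> \<Longrightarrow> f \<bullet> ident X = f"
  by (rule arrow_eqI) (auto simp: val_comp val_ident Comp_Id_right [OF valid_val_hom])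

end

section \<open>Products, coproducts and distributivity\<close>

context bicartesian_category
begin

section \<open>Universal properties of the raw operations\<close>

lemma copair_universal:
  assumes "f \<in> hom C X Z" "g \<in> hom C Y Z"
  shows "f \<nabla> g \<in> hom C (X \<oplus> Y) Z" "(f \<nabla> g) \<cdot> Inl C X Y = f" "(f \<nabla> g) \<cdot> Inr C X Y = g"
    "\<And>h. \<lbrakk>h \<in> hom C (X \<oplus> Y) Z; h \<cdot> Inl C X Y = f; h \<cdot> Inr C X Y = g\<rbrakk> \<Longrightarrow> h = f \<nabla> g"
proof -
  have D: "Dom C f = X" "Dom C g = Y" "Cod C f = Z"
    using assms by (simp_all add: hom_def)
  note ex1 = Sum_universal [OF assms]
  show "f \<nabla> g \<in> hom C (X \<oplus> Y) Z" "(f \<nabla> g) \<cdot> Inl C X Y = f" "(f \<nabla> g) \<cdot> Inr C X Y = g"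
    using theI' [OF ex1] by (simp_all add: copair_def D)
  show "h = f \<nabla> g" if "h \<in> hom C (X \<oplus> Y) Z" "h \<cdot> Inl C X Y = f" "h \<cdot> Inr C X Y = g" for h
    using the1_equality [OF ex1] that by (simp add: copair_def D)
qed

lemma pair_universal:
  assumes "f \<in> hom C W X" "g \<in> hom C W Y"
  shows "\<langle>f, g\<rangle> \<in> hom C W (X \<otimes> Y)" "Fst C X Y \<cdot> \<langle>f, g\<rangle> = f" "Snd C X Y \<cdot> \<langle>f, g\<rangle> = g"
    "\<And>h. \<lbrakk>h \<in> hom C W (X \<otimes> Y); Fst C X Y \<cdot> h = f; Snd C X Y \<cdot> h = g\<rbrakk> \<Longrightarrow> h = \<langle>f, g\<rangle>"
proof -
  have D: "Dom C f = W" "Cod C f = X" "Cod C g = Y"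
    using assms by (simp_all add: hom_def)
  note ex1 = Prod_universal [OF assms]
  show "\<langle>f, g\<rangle> \<in> hom C W (X \<otimes> Y)" "Fst C X Y \<cdot> \<langle>f, g\<rangle> = f" "Snd C X Y \<cdot> \<langle>f, g\<rangle> = g"
    using theI' [OF ex1] by (simp_all add: pair_def D)
  show "h = \<langle>f, g\<rangle>" if "h \<in> hom C W (X \<otimes> Y)" "Fst C X Y \<cdot> h = f" "Snd C X Y \<cdot> h = g" for h
    using the1_equality [OF ex1] that by (simp add: pair_def D)
qed

section \<open>The structure maps as arrows\<close>

definition inl :: "'o \<Rightarrow> 'o \<Rightarrow> ('o, 'm) arrow" where
  "inl X Y = arrow_if X (X \<oplus> Y) (X \<in> Ob C \<and> Y \<in> Ob C) (Inl C X Y)"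

definition inr :: "'o \<Rightarrow> 'o \<Rightarrow> ('o, 'm) arrow" where
  "inr X Y = arrow_if Y (X \<oplus> Y) (X \<in> Ob C \<and> Y \<in> Ob C) (Inr C X Y)"

definition cotuple :: "('o, 'm) arrow \<Rightarrow> ('o, 'm) arrow \<Rightarrow> ('o, 'm) arrow" (infixr "\<amalg>" 71) where
  "f \<amalg> g =
    arrow_if (src f \<oplus> src g) (trg f) (valid f \<and> valid g \<and> trg f = trg g) (val f \<nabla> val g)"

definition coproduct_map :: "('o, 'm) arrow \<Rightarrow> ('o, 'm) arrow \<Rightarrow> ('o, 'm) arrow" (infixr "\<uplus>" 73) where
  "f \<uplus> g = (inl (trg f) (trg g) \<bullet> f) \<amalg> (inr (trg f) (trg g) \<bullet> g)"

definition proj1 :: "'o \<Rightarrow> 'o \<Rightarrow> ('o, 'm) arrow" where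
  "proj1 X Y = arrow_if (X \<otimes> Y) X (X \<in> Ob C \<and> Y \<in> Ob C) (Fst C X Y)"

definition proj2 :: "'o \<Rightarrow> 'o \<Rightarrow> ('o, 'm) arrow" where
  "proj2 X Y = arrow_if (X \<otimes> Y) Y (X \<in> Ob C \<and> Y \<in> Ob C) (Snd C X Y)"

definition tuple :: "('o, 'm) arrow \<Rightarrow> ('o, 'm) arrow \<Rightarrow> ('o, 'm) arrow" where
  "tuple f g =
    arrow_if (src f) (trg f \<otimes> trg g) (valid f \<and> valid g \<and> src f = src g) \<langle>val f, val g\<rangle>"

definition product_map :: "('o, 'm) arrow \<Rightarrow> ('o, 'm) arrow \<Rightarrow> ('o, 'm) arrow" (infixr "\<odot>" 75) where
  "f \<odot> g = tuple (f \<bullet> proj1 (src f) (src g)) (g \<bullet> proj2 (src f) (src g))"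

definition assocr :: "'o \<Rightarrow> 'o \<Rightarrow> 'o \<Rightarrow> ('o, 'm) arrow" where
  "assocr X Y Z =
    tuple (proj1 X Y \<bullet> proj1 (X \<otimes> Y) Z) (tuple (proj2 X Y \<bullet> proj1 (X \<otimes> Y) Z) (proj2 (X \<otimes> Y) Z))"

declare Sum_Ob [simp] Prod_Ob [simp] One_Ob [simp]

lemma src_inl [simp]: "src (inl X Y) = X"
  and trg_inl [simp]: "trg (inl X Y) = X \<oplus> Y"
  and valid_inl [simp]: "valid (inl X Y) \<longleftrightarrow> X \<in> Ob C \<and> Y \<in> Ob C"
  and val_inl: "\<lbrakk>X \<in> Ob C; Y \<in> Ob C\<rbrakk> \<Longrightarrow> val (inl X Y) = Inl C X Y"
  by (simp_all add: inl_def valid_arrow_if Inl_hom val_arrow_if)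

lemma src_inr [simp]: "src (inr X Y) = Y"
  and trg_inr [simp]: "trg (inr X Y) = X \<oplus> Y"
  and valid_inr [simp]: "valid (inr X Y) \<longleftrightarrow> X \<in> Ob C \<and> Y \<in> Ob C"
  and val_inr: "\<lbrakk>X \<in> Ob C; Y \<in> Ob C\<rbrakk> \<Longrightarrow> val (inr X Y) = Inr C X Y"
  by (simp_all add: inr_def valid_arrow_if Inr_hom val_arrow_if)

lemma src_proj1 [simp]: "src (proj1 X Y) = X \<otimes> Y"
  and trg_proj1 [simp]: "trg (proj1 X Y) = X"
  and valid_proj1 [simp]: "valid (proj1 X Y) \<longleftrightarrow> X \<in> Ob C \<and> Y \<in> Ob C"
  and val_proj1: "\<lbrakk>X \<in> Ob C; Y \<in> Ob C\<rbrakk> \<Longrightarrow> val (proj1 X Y) = Fst C X Y"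
  by (simp_all add: proj1_def valid_arrow_if Fst_hom val_arrow_if)

lemma src_proj2 [simp]: "src (proj2 X Y) = X \<otimes> Y"
  and trg_proj2 [simp]: "trg (proj2 X Y) = Y"
  and valid_proj2 [simp]: "valid (proj2 X Y) \<longleftrightarrow> X \<in> Ob C \<and> Y \<in> Ob C"
  and val_proj2: "\<lbrakk>X \<in> Ob C; Y \<in> Ob C\<rbrakk> \<Longrightarrow> val (proj2 X Y) = Snd C X Y"
  by (simp_all add: proj2_def valid_arrow_if Snd_hom val_arrow_if)

lemma src_cotuple [simp]: "src (f \<amalg> g) = src f \<oplus> src g"
  and trg_cotuple [simp]: "trg (f \<amalg> g) = trg f"
  by (simp_all add: cotuple_def)

lemma valid_cotuple [simp]: "valid (f \<amalg> g) \<longleftrightarrow> valid f \<and> valid g \<and> trg f = trg g"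
  unfolding cotuple_def by (rule valid_arrow_if) (metis copair_universal(1) valid_val_hom)

lemma val_cotuple: "\<lbrakk>valid f; valid g; trg f = trg g\<rbrakk> \<Longrightarrow> val (f \<amalg> g) = val f \<nabla> val g"
  by (simp add: cotuple_def val_arrow_if)

lemma src_tuple [simp]: "src (tuple f g) = src f"
  and trg_tuple [simp]: "trg (tuple f g) = trg f \<otimes> trg g"
  by (simp_all add: tuple_def)

lemma valid_tuple [simp]: "valid (tuple f g) \<longleftrightarrow> valid f \<and> valid g \<and> src f = src g"
  unfolding tuple_def by (rule valid_arrow_if) (metis pair_universal(1) valid_val_hom)

lemma val_tuple: "\<lbrakk>valid f; valid g; src f = src g\<rbrakk> \<Longrightarrow> val (tuple f g) = \<langle>val f, val g\<rangle>"
  by (simp add: tuple_def val_arrow_if)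

lemma src_coproduct_map [simp]: "src (f \<uplus> g) = src f \<oplus> src g"
  and trg_coproduct_map [simp]: "trg (f \<uplus> g) = trg f \<oplus> trg g"
  and valid_coproduct_map [simp]: "valid (f \<uplus> g) \<longleftrightarrow> valid f \<and> valid g"
  by (auto simp: coproduct_map_def)

lemma val_coproduct_map: "\<lbrakk>valid f; valid g\<rbrakk> \<Longrightarrow> val (f \<uplus> g) = val f \<boxplus> val g"
  by (simp add: coproduct_map_def sum_map_def val_cotuple val_comp val_inl val_inr)

lemma src_product_map [simp]: "src (f \<odot> g) = src f \<otimes> src g"
  and trg_product_map [simp]: "trg (f \<odot> g) = trg f \<otimes> trg g"
  and valid_product_map [simp]: "valid (f \<odot> g) \<longleftrightarrow> valid f \<and> valid g"
  by (auto simp: product_map_def)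

lemma val_product_map: "\<lbrakk>valid f; valid g\<rbrakk> \<Longrightarrow> val (f \<odot> g) = val f \<boxtimes> val g"
  by (simp add: product_map_def prod_map_def val_tuple val_comp val_proj1 val_proj2)

lemma src_assocr [simp]: "src (assocr X Y Z) = (X \<otimes> Y) \<otimes> Z"
  and trg_assocr [simp]: "trg (assocr X Y Z) = X \<otimes> Y \<otimes> Z"
  and valid_assocr [simp]: "\<lbrakk>X \<in> Ob C; Y \<in> Ob C; Z \<in> Ob C\<rbrakk> \<Longrightarrow> valid (assocr X Y Z)"
  and val_assocr: "\<lbrakk>X \<in> Ob C; Y \<in> Ob C; Z \<in> Ob C\<rbrakk> \<Longrightarrow> val (assocr X Y Z) = prod_assoc C X Y Z"
  by (simp_all add: assocr_def prod_assoc_def val_tuple val_comp val_proj1 val_proj2)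

lemmas val_simps = val_ident val_comp val_inl val_inr val_cotuple val_coproduct_map
  val_proj1 val_proj2 val_product_map val_assocr

section \<open>Laws of coproducts\<close>

lemma cotuple_inl:
  assumes "valid f" "valid g" "trg f = trg g" "src f = A" "src g = B"
  shows "(f \<amalg> g) \<bullet> inl A B = f"
proof (rule arrow_eqI)
  have "val g \<in> hom C B (trg f)"
    using assms valid_val_hom [of g] by simp
  then show "val ((f \<amalg> g) \<bullet> inl A B) = val f"
    using assms copair_universal(2) [of "val f" A "trg f" "val g" B] valid_val_hom [of f]
    by (auto simp: val_simps)
qed (use assms in auto)

lemma cotuple_inr:
  assumes "valid f" "valid g" "trg f = trg g" "src f = A" "src g = B"
  shows "(f \<amalg> g) \<bullet> inr A B = g"
proof (rule arrow_eqI)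
  have "val g \<in> hom C B (trg f)"
    using assms valid_val_hom [of g] by simp
  then show "val ((f \<amalg> g) \<bullet> inr A B) = val g"
    using assms copair_universal(3) [of "val f" A "trg f" "val g" B] valid_val_hom [of f]
    by (auto simp: val_simps)
qed (use assms in auto)

lemma cotuple_unique:
  assumes "valid h" "src h = A \<oplus> B" "A \<in> Ob C" "B \<in> Ob C"
  shows "h = (h \<bullet> inl A B) \<amalg> (h \<bullet> inr A B)"
proof (rule arrow_eqI)
  have "val (h \<bullet> inl A B) \<in> hom C A (trg h)" "val (h \<bullet> inr A B) \<in> hom C B (trg h)"
    "val h \<in> hom C (A \<oplus> B) (trg h)"
    using assms valid_val_hom [of "h \<bullet> inl A B"] valid_val_hom [of "h \<bullet> inr A B"]
      valid_val_hom [of h] by auto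
  then have "val h = val (h \<bullet> inl A B) \<nabla> val (h \<bullet> inr A B)"
    by (rule copair_universal(4)) (use assms in \<open>simp_all add: val_simps\<close>)
  also have "\<dots> = val ((h \<bullet> inl A B) \<amalg> (h \<bullet> inr A B))"
    using assms by (simp add: val_cotuple)
  finally show "val h = val ((h \<bullet> inl A B) \<amalg> (h \<bullet> inr A B))" .
qed (use assms in auto)

lemma cotuple_eqI:
  assumes "h \<bullet> inl A B = k \<bullet> inl A B" "h \<bullet> inr A B = k \<bullet> inr A B"
    "valid h" "valid k" "src h = A \<oplus> B" "src k = A \<oplus> B" "A \<in> Ob C" "B \<in> Ob C"
  shows "h = k"
proof -
  have "h = (h \<bullet> inl A B) \<amalg> (h \<bullet> inr A B)"
    using assms by (intro cotuple_unique)
  also have "\<dots> = (k \<bullet> inl A B) \<amalg> (k \<bullet> inr A B)"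
    by (simp only: assms(1,2))
  also have "\<dots> = k"
    using assms by (intro cotuple_unique [symmetric])
  finally show ?thesis .
qed

lemma cotuple_inl_inr: "\<lbrakk>A \<in> Ob C; B \<in> Ob C\<rbrakk> \<Longrightarrow> inl A B \<amalg> inr A B = ident (A \<oplus> B)"
  using cotuple_unique [of "ident (A \<oplus> B)" A B] by simp

text \<open>Both sides have the same endpoints and are defined under the same conditions, hence the
  law is unconditional; the typed case is uniqueness of the copairing.\<close>

lemma comp_cotuple: "h \<bullet> (f \<amalg> g) = (h \<bullet> f) \<amalg> (h \<bullet> g)"
proof -
  have "val h \<cdot> val (f \<amalg> g) = val (h \<bullet> f) \<nabla> val (h \<bullet> g)"
    if "valid h" "valid f" "valid g" "src h = trg f" "trg f = trg g"
  proof -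
    have "h \<bullet> (f \<amalg> g) = (h \<bullet> f) \<amalg> (h \<bullet> g)"
      by (rule cotuple_eqI [of _ "src f" "src g"])
        (use that in \<open>simp_all add: cotuple_inl cotuple_inr comp_assoc\<close>)
    from arg_cong [OF this, of val] show ?thesis
      using that by (simp add: val_simps)
  qed
  then show ?thesis
    unfolding comp_def [of h "f \<amalg> g"] cotuple_def [of "h \<bullet> f" "h \<bullet> g"]
    by (intro arrow_if_cong) auto
qed

lemmas cotuple_inl_assoc = cotuple_inl [THEN comp_reassoc]
  and cotuple_inr_assoc = cotuple_inr [THEN comp_reassoc]

lemma coproduct_map_inl [simp]:
  "\<lbrakk>valid f; valid g; src f = A; src g = B\<rbrakk> \<Longrightarrow> (f \<uplus> g) \<bullet> inl A B = inl (trg f) (trg g) \<bullet> f"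
  by (simp add: coproduct_map_def cotuple_inl)

lemma coproduct_map_inr [simp]:
  "\<lbrakk>valid f; valid g; src f = A; src g = B\<rbrakk> \<Longrightarrow> (f \<uplus> g) \<bullet> inr A B = inr (trg f) (trg g) \<bullet> g"
  by (simp add: coproduct_map_def cotuple_inr)

lemma coproduct_map_comp:
  "\<lbrakk>trg f = src h; trg g = src k; valid h; valid k\<rbrakk> \<Longrightarrow> (h \<uplus> k) \<bullet> (f \<uplus> g) = (h \<bullet> f) \<uplus> (k \<bullet> g)"
  by (simp add: coproduct_map_def comp_cotuple cotuple_inl_assoc cotuple_inr_assoc comp_assoc)

section \<open>Laws of products\<close>

lemma proj1_tuple:
  assumes "valid f" "valid g" "src f = src g" "trg f = A" "trg g = B"
  shows "proj1 A B \<bullet> tuple f g = f"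
proof (rule arrow_eqI)
  have "val g \<in> hom C (src f) B"
    using assms valid_val_hom [of g] by simp
  then show "val (proj1 A B \<bullet> tuple f g) = val f"
    using assms pair_universal(2) [of "val f" "src f" A "val g" B] valid_val_hom [of f]
    by (auto simp: val_simps val_tuple)
qed (use assms in auto)

lemma proj2_tuple:
  assumes "valid f" "valid g" "src f = src g" "trg f = A" "trg g = B"
  shows "proj2 A B \<bullet> tuple f g = g"
proof (rule arrow_eqI)
  have "val g \<in> hom C (src f) B"
    using assms valid_val_hom [of g] by simp
  then show "val (proj2 A B \<bullet> tuple f g) = val g"
    using assms pair_universal(3) [of "val f" "src f" A "val g" B] valid_val_hom [of f]
    by (auto simp: val_simps val_tuple)
qed (use assms in auto)

lemma tuple_unique:
  assumes "valid h" "trg h = A \<otimes> B" "A \<in> Ob C" "B \<in> Ob C"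
  shows "h = tuple (proj1 A B \<bullet> h) (proj2 A B \<bullet> h)"
proof (rule arrow_eqI)
  have "val (proj1 A B \<bullet> h) \<in> hom C (src h) A" "val (proj2 A B \<bullet> h) \<in> hom C (src h) B"
    "val h \<in> hom C (src h) (A \<otimes> B)"
    using assms valid_val_hom [of "proj1 A B \<bullet> h"] valid_val_hom [of "proj2 A B \<bullet> h"]
      valid_val_hom [of h] by auto
  then have "val h = \<langle>val (proj1 A B \<bullet> h), val (proj2 A B \<bullet> h)\<rangle>"
    by (rule pair_universal(4)) (use assms in \<open>simp_all add: val_simps\<close>)
  also have "\<dots> = val (tuple (proj1 A B \<bullet> h) (proj2 A B \<bullet> h))"
    using assms by (simp add: val_tuple)
  finally show "val h = val (tuple (proj1 A B \<bullet> h) (proj2 A B \<bullet> h))" .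
qed (use assms in auto)

lemma tuple_eqI:
  assumes "proj1 A B \<bullet> h = proj1 A B \<bullet> k" "proj2 A B \<bullet> h = proj2 A B \<bullet> k"
    "valid h" "valid k" "trg h = A \<otimes> B" "trg k = A \<otimes> B" "A \<in> Ob C" "B \<in> Ob C"
  shows "h = k"
proof -
  have "h = tuple (proj1 A B \<bullet> h) (proj2 A B \<bullet> h)"
    using assms by (intro tuple_unique)
  also have "\<dots> = tuple (proj1 A B \<bullet> k) (proj2 A B \<bullet> k)"
    by (simp only: assms(1,2))
  also have "\<dots> = k"
    using assms by (intro tuple_unique [symmetric])
  finally show ?thesis .
qed

lemmas proj1_tuple_assoc = proj1_tuple [THEN comp_reassoc]
  and proj2_tuple_assoc = proj2_tuple [THEN comp_reassoc]

lemma tuple_comp: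
  assumes "valid f" "valid g" "valid h" "src f = src g" "trg h = src f"
  shows "tuple f g \<bullet> h = tuple (f \<bullet> h) (g \<bullet> h)"
  by (rule tuple_eqI [of "trg f" "trg g"])
    (use assms in \<open>simp_all add: proj1_tuple_assoc proj2_tuple_assoc proj1_tuple proj2_tuple\<close>)

lemma proj1_product_map:
  "\<lbrakk>valid f; valid g; trg f = A; trg g = B\<rbrakk> \<Longrightarrow>
    proj1 A B \<bullet> (f \<odot> g) = f \<bullet> proj1 (src f) (src g)"
  and proj2_product_map:
  "\<lbrakk>valid f; valid g; trg f = A; trg g = B\<rbrakk> \<Longrightarrow>
    proj2 A B \<bullet> (f \<odot> g) = g \<bullet> proj2 (src f) (src g)"
  by (simp_all add: product_map_def proj1_tuple proj2_tuple)

lemmas proj1_product_map_assoc = proj1_product_map [THEN comp_reassoc]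
  and proj2_product_map_assoc = proj2_product_map [THEN comp_reassoc]

lemma product_map_comp:
  assumes "valid f" "valid g" "valid h" "valid k" "src f = trg h" "src g = trg k"
  shows "(f \<odot> g) \<bullet> (h \<odot> k) = (f \<bullet> h) \<odot> (g \<bullet> k)"
  by (rule tuple_eqI [of "trg f" "trg g"])
    (use assms in \<open>simp_all add: proj1_product_map_assoc proj2_product_map_assoc
      proj1_product_map proj2_product_map comp_assoc\<close>)

lemma product_map_ident [simp]:
  assumes "A \<in> Ob C" "B \<in> Ob C"
  shows "ident A \<odot> ident B = ident (A \<otimes> B)"
  by (rule tuple_eqI [of A B]) (use assms in \<open>simp_all add: proj1_product_map proj2_product_map\<close>)

lemma assocr_natural:
  assumes "valid f" "valid g" "valid h"
  shows "assocr (trg f) (trg g) (trg h) \<bullet> ((f \<odot> g) \<odot> h) =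
    (f \<odot> g \<odot> h) \<bullet> assocr (src f) (src g) (src h)"
  by (rule tuple_eqI [of "trg f" "trg g \<otimes> trg h"],
      rule_tac [2] tuple_eqI [of "trg g" "trg h"])
    (use assms in \<open>simp_all add: assocr_def proj1_product_map_assoc proj2_product_map_assoc
      proj1_product_map proj2_product_map comp_assoc proj1_tuple proj2_tuple
      proj1_tuple_assoc proj2_tuple_assoc tuple_comp\<close>)

end

section \<open>Distributivity\<close>

context distributive_category
begin

definition distr :: "'a \<Rightarrow> 'a \<Rightarrow> 'a \<Rightarrow> ('a, 'b) arrow" where
  "distr X Y Z = arrow_if (X \<otimes> (Y \<oplus> Z)) ((X \<otimes> Y) \<oplus> (X \<otimes> Z))
     (X \<in> Ob C \<and> Y \<in> Ob C \<and> Z \<in> Ob C) (dist C X Y Z)"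

text \<open>Two-sided inverses are unique, so the definite description \<open>dist\<close>
  denotes.\<close>

lemma dist_inverse:
  assumes "X \<in> Ob C" "Y \<in> Ob C" "Z \<in> Ob C"
  shows "inverse_pair C ((X \<otimes> Y) \<oplus> (X \<otimes> Z)) (X \<otimes> (Y \<oplus> Z)) (codist C X Y Z) (dist C X Y Z)"
proof -
  obtain d where
    d: "inverse_pair C ((X \<otimes> Y) \<oplus> (X \<otimes> Z)) (X \<otimes> (Y \<oplus> Z)) (codist C X Y Z) d"
    using codist_invertible assms by blast
  moreover have "d' = d"
    if "inverse_pair C ((X \<otimes> Y) \<oplus> (X \<otimes> Z)) (X \<otimes> (Y \<oplus> Z)) (codist C X Y Z) d'" for d'
    using d that unfolding inverse_pair_def by (metis Comp_Id_left Comp_Id_right Comp_assoc)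
  ultimately show ?thesis
    unfolding dist_def by (rule theI)
qed

lemma src_distr [simp]: "src (distr X Y Z) = X \<otimes> (Y \<oplus> Z)"
  and trg_distr [simp]: "trg (distr X Y Z) = (X \<otimes> Y) \<oplus> (X \<otimes> Z)"
  and valid_distr [simp]: "valid (distr X Y Z) \<longleftrightarrow> X \<in> Ob C \<and> Y \<in> Ob C \<and> Z \<in> Ob C"
  and val_distr: "\<lbrakk>X \<in> Ob C; Y \<in> Ob C; Z \<in> Ob C\<rbrakk> \<Longrightarrow> val (distr X Y Z) = dist C X Y Z"
  using dist_inverse unfolding distr_def inverse_pair_def
  by (simp_all add: val_arrow_if valid_arrow_if)

lemma codistr_distr:
  assumes "X \<in> Ob C" "Y \<in> Ob C" "Z \<in> Ob C"
  shows "((ident X \<odot> inl Y Z) \<amalg> (ident X \<odot> inr Y Z)) \<bullet> distr X Y Z = ident (X \<otimes> (Y \<oplus> Z))"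
    and "distr X Y Z \<bullet> ((ident X \<odot> inl Y Z) \<amalg> (ident X \<odot> inr Y Z)) =
      ident ((X \<otimes> Y) \<oplus> (X \<otimes> Z))"
  using assms dist_inverse [OF assms] unfolding inverse_pair_def
  by (auto intro!: arrow_eqI simp: val_simps val_distr codist_def)

lemma distr_inl:
  assumes "X \<in> Ob C" "Y \<in> Ob C" "Z \<in> Ob C"
  shows "distr X Y Z \<bullet> (ident X \<odot> inl Y Z) = inl (X \<otimes> Y) (X \<otimes> Z)"
  using codistr_distr(2) [OF assms, THEN comp_reassoc, of "inl (X \<otimes> Y) (X \<otimes> Z)"] assms
  by (simp add: cotuple_inl)

lemma distr_inr:
  assumes "X \<in> Ob C" "Y \<in> Ob C" "Z \<in> Ob C"
  shows "distr X Y Z \<bullet> (ident X \<odot> inr Y Z) = inr (X \<otimes> Y) (X \<otimes> Z)"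
  using codistr_distr(2) [OF assms, THEN comp_reassoc, of "inr (X \<otimes> Y) (X \<otimes> Z)"] assms
  by (simp add: cotuple_inr)

text \<open>Precomposition with an invertible map loses nothing, so maps out of
  \<open>X \<otimes> (Y \<oplus> Z)\<close> may be compared on the two summands.\<close>

lemma distr_eqI:
  assumes "h \<bullet> (ident X \<odot> inl Y Z) = k \<bullet> (ident X \<odot> inl Y Z)"
    "h \<bullet> (ident X \<odot> inr Y Z) = k \<bullet> (ident X \<odot> inr Y Z)"
    "valid h" "valid k" "src h = X \<otimes> (Y \<oplus> Z)" "src k = X \<otimes> (Y \<oplus> Z)"
    "X \<in> Ob C" "Y \<in> Ob C" "Z \<in> Ob C"
  shows "h = k"
proof -
  have "h \<bullet> ((ident X \<odot> inl Y Z) \<amalg> (ident X \<odot> inr Y Z)) =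
    k \<bullet> ((ident X \<odot> inl Y Z) \<amalg> (ident X \<odot> inr Y Z))"
    by (simp add: assms comp_cotuple)
  then show ?thesis
    using assms by (metis codistr_distr(1) comp_assoc comp_ident)
qed

lemma distr_natural:
  assumes "valid f" "valid g" "valid h"
  shows "distr (trg f) (trg g) (trg h) \<bullet> (f \<odot> (g \<uplus> h)) =
    ((f \<odot> g) \<uplus> (f \<odot> h)) \<bullet> distr (src f) (src g) (src h)"
proof (rule distr_eqI [of _ "src f" "src g" "src h"])
  have "distr (trg f) (trg g) (trg h) \<bullet> (f \<odot> (inl (trg g) (trg h) \<bullet> g)) =
      inl (trg f \<otimes> trg g) (trg f \<otimes> trg h) \<bullet> (f \<odot> g)"
    "distr (trg f) (trg g) (trg h) \<bullet> (f \<odot> (inr (trg g) (trg h) \<bullet> h)) =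
      inr (trg f \<otimes> trg g) (trg f \<otimes> trg h) \<bullet> (f \<odot> h)"
    using assms distr_inl [of "trg f" "trg g" "trg h", THEN comp_reassoc, of "f \<odot> g"]
      distr_inr [of "trg f" "trg g" "trg h", THEN comp_reassoc, of "f \<odot> h"]
    by (simp_all add: product_map_comp)
  then show "(distr (trg f) (trg g) (trg h) \<bullet> (f \<odot> (g \<uplus> h))) \<bullet> (ident (src f) \<odot> inl (src g) (src h)) =
    (((f \<odot> g) \<uplus> (f \<odot> h)) \<bullet> distr (src f) (src g) (src h)) \<bullet> (ident (src f) \<odot> inl (src g) (src h))"
    "(distr (trg f) (trg g) (trg h) \<bullet> (f \<odot> (g \<uplus> h))) \<bullet> (ident (src f) \<odot> inr (src g) (src h)) =
    (((f \<odot> g) \<uplus> (f \<odot> h)) \<bullet> distr (src f) (src g) (src h)) \<bullet> (ident (src f) \<odot> inr (src g) (src h))"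
    using assms by (simp_all add: comp_assoc product_map_comp distr_inl distr_inr)
qed (use assms in auto)

lemma product_map_cotuple:
  assumes "valid f" "valid g" "trg f = trg g" "X \<in> Ob C"
  shows "ident X \<odot> (f \<amalg> g) = ((ident X \<odot> f) \<amalg> (ident X \<odot> g)) \<bullet> distr X (src f) (src g)"
  by (rule distr_eqI [of _ X "src f" "src g"])
    (use assms in \<open>simp_all add: product_map_comp comp_assoc distr_inl distr_inr cotuple_inl cotuple_inr\<close>)

end

section \<open>Functors, monads and iteration on arrows\<close>

context bicartesian_category
begin

definition smap :: "('o, 'm) functor_data \<Rightarrow> ('o, 'm) arrow \<Rightarrow> ('o, 'm) arrow" where
  "smap S f = arrow_if (FOb S (src f)) (FOb S (trg f)) (valid f) (FMap S (val f))"

definition sstr :: "('o, 'm) functor_data \<Rightarrow> 'o \<Rightarrow> 'o \<Rightarrow> ('o, 'm) arrow" where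
  "sstr S X Y = arrow_if (X \<otimes> FOb S Y) (FOb S (X \<otimes> Y)) (X \<in> Ob C \<and> Y \<in> Ob C) (FStr S X Y)"

definition eta :: "('o, 'm) monad_data \<Rightarrow> 'o \<Rightarrow> ('o, 'm) arrow" where
  "eta T X = arrow_if X (TOb T X) (X \<in> Ob C) (Eta T X)"

definition ext :: "('o, 'm) monad_data \<Rightarrow> 'o \<Rightarrow> ('o, 'm) arrow \<Rightarrow> ('o, 'm) arrow" where
  "ext T Y f =
    arrow_if (TOb T (src f)) (TOb T Y) (valid f \<and> Y \<in> Ob C \<and> trg f = TOb T Y) (Ext T Y (val f))"

definition tmap :: "('o, 'm) monad_data \<Rightarrow> ('o, 'm) arrow \<Rightarrow> ('o, 'm) arrow" where
  "tmap T f = ext T (trg f) (eta T (trg f) \<bullet> f)"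

definition str :: "('o, 'm) monad_data \<Rightarrow> 'o \<Rightarrow> 'o \<Rightarrow> ('o, 'm) arrow" where
  "str T X Y = arrow_if (X \<otimes> TOb T Y) (TOb T (X \<otimes> Y)) (X \<in> Ob C \<and> Y \<in> Ob C) (Str T X Y)"

definition iter ::
    "('o, 'm) monad_data \<Rightarrow> ('o \<Rightarrow> 'm \<Rightarrow> 'm) \<Rightarrow> 'o \<Rightarrow> ('o, 'm) arrow \<Rightarrow> ('o, 'm) arrow" where
  "iter T it Y f = arrow_if (src f) (TOb T Y)
     (valid f \<and> Y \<in> Ob C \<and> trg f = TOb T (Y \<oplus> src f)) (it Y (val f))"

lemma src_eta [simp]: "src (eta T X) = X"
  and trg_eta [simp]: "trg (eta T X) = TOb T X"
  and src_ext [simp]: "src (ext T Y f) = TOb T (src f)"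
  and trg_ext [simp]: "trg (ext T Y f) = TOb T Y"
  and src_str [simp]: "src (str T X Y) = X \<otimes> TOb T Y"
  and trg_str [simp]: "trg (str T X Y) = TOb T (X \<otimes> Y)"
  and src_iter [simp]: "src (iter T it Y f) = src f"
  and trg_iter [simp]: "trg (iter T it Y f) = TOb T Y"
  and src_smap [simp]: "src (smap S f) = FOb S (src f)"
  and trg_smap [simp]: "trg (smap S f) = FOb S (trg f)"
  and src_sstr [simp]: "src (sstr S X Y) = X \<otimes> FOb S Y"
  and trg_sstr [simp]: "trg (sstr S X Y) = FOb S (X \<otimes> Y)"
  by (simp_all add: eta_def ext_def str_def iter_def smap_def sstr_def)

lemma src_tmap [simp]: "src (tmap T f) = TOb T (src f)"
  and trg_tmap [simp]: "trg (tmap T f) = TOb T (trg f)"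
  by (simp_all add: tmap_def)

text \<open>These undo a splitting over the two injections; the second form applies after another
  map \<open>x\<close> has been pushed inside by \<open>comp_cotuple\<close>.\<close>

lemma cotuple_comp_inl_inr:
  "\<lbrakk>valid h; src h = A \<oplus> B; A \<in> Ob C; B \<in> Ob C\<rbrakk> \<Longrightarrow> (h \<bullet> inl A B) \<amalg> (h \<bullet> inr A B) = h"
  "\<lbrakk>valid h; src h = A \<oplus> B; A \<in> Ob C; B \<in> Ob C\<rbrakk> \<Longrightarrow>
    (x \<bullet> h \<bullet> inl A B) \<amalg> (x \<bullet> h \<bullet> inr A B) = x \<bullet> h"
  using cotuple_unique comp_cotuple by metis+

end

context strong_functor
begin

declare FOb_Ob [simp]

lemma valid_smap [simp]: "valid (smap S f) \<longleftrightarrow> valid f"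
  and val_smap: "valid f \<Longrightarrow> val (smap S f) = FMap S (val f)"
  and valid_sstr [simp]: "valid (sstr S X Y) \<longleftrightarrow> X \<in> Ob C \<and> Y \<in> Ob C"
  and val_sstr: "\<lbrakk>X \<in> Ob C; Y \<in> Ob C\<rbrakk> \<Longrightarrow> val (sstr S X Y) = FStr S X Y"
  by (simp_all add: smap_def sstr_def valid_arrow_if val_arrow_if FMap_hom [OF valid_val_hom] FStr_hom)

lemma smap_ident [simp]: "X \<in> Ob C \<Longrightarrow> smap S (ident X) = ident (FOb S X)"
  by (rule arrow_eqI) (simp_all add: val_simps val_smap FMap_Id)

lemma smap_comp:
  assumes "trg f = src g"
  shows "smap S g \<bullet> smap S f = smap S (g \<bullet> f)"
proof -
  have "val (smap S g) \<cdot> val (smap S f) = FMap S (val (g \<bullet> f))" if "valid g" "valid f"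
    using FMap_Comp [of "val f" "src f" "trg f" "val g" "trg g"] that assms
      valid_val_hom [of f] valid_val_hom [of g] by (simp add: val_smap val_comp)
  then show ?thesis
    unfolding comp_def [of "smap S g"] smap_def [of _ "g \<bullet> f"]
    using assms by (intro arrow_if_cong) auto
qed

lemmas smap_comp_assoc = smap_comp [THEN comp_reassoc]

lemma sstr_natural:
  "\<lbrakk>valid f; valid g\<rbrakk> \<Longrightarrow>
    smap S (f \<odot> g) \<bullet> sstr S (src f) (src g) = sstr S (trg f) (trg g) \<bullet> (f \<odot> smap S g)"
  by (rule arrow_eqI)
    (simp_all add: val_simps val_smap val_sstr FStr_natural [OF valid_val_hom valid_val_hom])

lemma sstr_unit: "X \<in> Ob C \<Longrightarrow> smap S (proj2 (One C) X) \<bullet> sstr S (One C) X = proj2 (One C) (FOb S X)"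
  by (rule arrow_eqI) (simp_all add: val_simps val_smap val_sstr FStr_unit)

lemma sstr_assoc: "\<lbrakk>X \<in> Ob C; Y \<in> Ob C; Z \<in> Ob C\<rbrakk> \<Longrightarrow>
    smap S (assocr X Y Z) \<bullet> sstr S (X \<otimes> Y) Z =
    sstr S X (Y \<otimes> Z) \<bullet> (ident X \<odot> sstr S Y Z) \<bullet> assocr X Y (FOb S Z)"
  by (rule arrow_eqI) (simp_all add: val_simps val_smap val_sstr FStr_assoc)

end

text \<open>Typing alone suffices for the validity rules. Separated from the laws, these rules are
  available for the resumption monad while its laws are being proved.\<close>

locale monad_signature = distributive_category C
  for C :: "('o, 'm, 'z) bicat_scheme" (structure) +
  fixes T :: "('o, 'm) monad_data"
  assumes TOb_in_Ob [simp]: "X \<in> Ob C \<Longrightarrow> TOb T X \<in> Ob C"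
    and Eta_in_hom: "X \<in> Ob C \<Longrightarrow> Eta T X \<in> hom C X (TOb T X)"
    and Ext_in_hom: "\<lbrakk>X \<in> Ob C; Y \<in> Ob C; f \<in> hom C X (TOb T Y)\<rbrakk> \<Longrightarrow>
      Ext T Y f \<in> hom C (TOb T X) (TOb T Y)"
    and Str_in_hom:
      "\<lbrakk>X \<in> Ob C; Y \<in> Ob C\<rbrakk> \<Longrightarrow> Str T X Y \<in> hom C (X \<otimes> TOb T Y) (TOb T (X \<otimes> Y))"
begin

lemma valid_eta [simp]: "valid (eta T X) \<longleftrightarrow> X \<in> Ob C"
  and val_eta: "X \<in> Ob C \<Longrightarrow> val (eta T X) = Eta T X"
  and valid_str [simp]: "valid (str T X Y) \<longleftrightarrow> X \<in> Ob C \<and> Y \<in> Ob C"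
  and val_str: "\<lbrakk>X \<in> Ob C; Y \<in> Ob C\<rbrakk> \<Longrightarrow> val (str T X Y) = Str T X Y"
  by (simp_all add: eta_def str_def valid_arrow_if val_arrow_if Eta_in_hom Str_in_hom)

lemma valid_ext [simp]: "valid (ext T Y f) \<longleftrightarrow> valid f \<and> Y \<in> Ob C \<and> trg f = TOb T Y"
  unfolding ext_def by (rule valid_arrow_if) (metis Ext_in_hom src_Ob valid_val_hom)

lemma val_ext: "\<lbrakk>valid f; Y \<in> Ob C; trg f = TOb T Y\<rbrakk> \<Longrightarrow> val (ext T Y f) = Ext T Y (val f)"
  by (simp add: ext_def val_arrow_if)

lemma valid_tmap [simp]: "valid (tmap T f) \<longleftrightarrow> valid f"
  by (auto simp: tmap_def)

lemma val_tmap: "valid f \<Longrightarrow> val (tmap T f) = TMap C T (val f)"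
  by (simp add: tmap_def TMap_def val_ext val_comp val_eta)

lemmas val_monad_simps = val_simps val_distr val_eta val_ext val_str val_tmap

text \<open>Every typed morphism is the value of its \<open>lift\<close>, so laws on valid arrows
  give the laws on raw morphisms.\<close>

lemma strong_monadI:
  assumes "\<And>X. X \<in> Ob C \<Longrightarrow> ext T X (eta T X) = ident (TOb T X)"
    and "\<And>Y f. \<lbrakk>valid f; Y \<in> Ob C; trg f = TOb T Y\<rbrakk> \<Longrightarrow> ext T Y f \<bullet> eta T (src f) = f"
    and "\<And>Y Z f g. \<lbrakk>valid f; valid g; Y \<in> Ob C; Z \<in> Ob C; trg g = TOb T Y; src f = Y; trg f = TOb T Z\<rbrakk> \<Longrightarrow>
      ext T Z (ext T Z f \<bullet> g) = ext T Z f \<bullet> ext T Y g"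
    and "\<And>f g. \<lbrakk>valid f; valid g\<rbrakk> \<Longrightarrow>
      tmap T (f \<odot> g) \<bullet> str T (src f) (src g) = str T (trg f) (trg g) \<bullet> (f \<odot> tmap T g)"
    and "\<And>X. X \<in> Ob C \<Longrightarrow> tmap T (proj2 (One C) X) \<bullet> str T (One C) X = proj2 (One C) (TOb T X)"
    and "\<And>X Y Z. \<lbrakk>X \<in> Ob C; Y \<in> Ob C; Z \<in> Ob C\<rbrakk> \<Longrightarrow>
      tmap T (assocr X Y Z) \<bullet> str T (X \<otimes> Y) Z =
      str T X (Y \<otimes> Z) \<bullet> (ident X \<odot> str T Y Z) \<bullet> assocr X Y (TOb T Z)"
    and "\<And>X Y. \<lbrakk>X \<in> Ob C; Y \<in> Ob C\<rbrakk> \<Longrightarrow> str T X Y \<bullet> (ident X \<odot> eta T Y) = eta T (X \<otimes> Y)"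
    and "\<And>X Z f. \<lbrakk>valid f; X \<in> Ob C; Z \<in> Ob C; trg f = TOb T Z\<rbrakk> \<Longrightarrow>
      ext T (X \<otimes> Z) (str T X Z \<bullet> (ident X \<odot> f)) \<bullet> str T X (src f) = str T X Z \<bullet> (ident X \<odot> ext T Z f)"
  shows "strong_monad C T"
proof (unfold_locales, goal_cases)
  case (4 X)
  then show ?case
    using assms(1) [of X, THEN arg_cong [where f = val]] by (simp add: val_monad_simps)
next
  case (5 X Y f)
  then show ?case
    using assms(2) [of "lift f" Y, THEN arg_cong [where f = val]]
    by (simp add: val_monad_simps hom_def)
next
  case (6 X Y Z g f)
  then show ?case
    using assms(3) [of "lift f" "lift g" Y Z, THEN arg_cong [where f = val]]
    by (simp add: val_monad_simps hom_def)
next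
  case (8 f X X' g Y Y')
  then show ?case
    using assms(4) [of "lift f" "lift g", THEN arg_cong [where f = val]]
      Dom_Ob [of f] Dom_Ob [of g] Cod_Ob [of f] Cod_Ob [of g]
    by (simp add: val_monad_simps hom_def)
next
  case (9 X)
  then show ?case
    using assms(5) [of X, THEN arg_cong [where f = val]] by (simp add: val_monad_simps)
next
  case (10 X Y Z)
  then show ?case
    using assms(6) [of X Y Z, THEN arg_cong [where f = val]] by (simp add: val_monad_simps)
next
  case (11 X Y)
  then show ?case
    using assms(7) [of X Y, THEN arg_cong [where f = val]] by (simp add: val_monad_simps)
next
  case (12 X Y Z f)
  then show ?case
    using assms(8) [of "lift f" X Z, THEN arg_cong [where f = val]]
    by (simp add: val_monad_simps hom_def)
qed (simp_all add: Eta_in_hom Ext_in_hom Str_in_hom)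

end

text \<open>The counterpart for iteration: typing without axioms, to be instantiated with
  \<open>itN\<close> before its axioms are known.\<close>

locale iteration_signature = monad_signature C T
  for C :: "('o, 'm, 'z) bicat_scheme" (structure) and T :: "('o, 'm) monad_data" +
  fixes it :: "'o \<Rightarrow> 'm \<Rightarrow> 'm"
  assumes it_in_hom: "\<lbrakk>X \<in> Ob C; Y \<in> Ob C; f \<in> hom C X (TOb T (Y \<oplus> X))\<rbrakk> \<Longrightarrow>
      it Y f \<in> hom C X (TOb T Y)"
begin

lemma valid_iter [simp]:
  "valid (iter T it Y f) \<longleftrightarrow> valid f \<and> Y \<in> Ob C \<and> trg f = TOb T (Y \<oplus> src f)"
  unfolding iter_def by (rule valid_arrow_if) (metis it_in_hom src_Ob valid_val_hom)

lemma val_iter: "\<lbrakk>valid f; Y \<in> Ob C; trg f = TOb T (Y \<oplus> src f)\<rbrakk> \<Longrightarrow> val (iter T it Y f) = it Y (val f)"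
  by (simp add: iter_def val_arrow_if)

lemmas val_iteration_simps = val_monad_simps val_iter

lemma complete_elgot_monadI:
  assumes "strong_monad C T"
    and "\<And>Y f. \<lbrakk>valid f; Y \<in> Ob C; trg f = TOb T (Y \<oplus> src f)\<rbrakk> \<Longrightarrow>
      ext T Y (eta T Y \<amalg> iter T it Y f) \<bullet> f = iter T it Y f"
    and "\<And>Y Z f g. \<lbrakk>valid f; valid g; Y \<in> Ob C; Z \<in> Ob C; trg f = TOb T (Y \<oplus> src f);
        src g = Y; trg g = TOb T Z\<rbrakk> \<Longrightarrow>
      ext T Z g \<bullet> iter T it Y f = iter T it Z (ext T (Z \<oplus> src f)
        ((tmap T (inl Z (src f)) \<bullet> g) \<amalg> (eta T (Z \<oplus> src f) \<bullet> inr Z (src f))) \<bullet> f)"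
    and "\<And>Y g h. \<lbrakk>valid g; valid h; Y \<in> Ob C; trg g = TOb T (Y \<oplus> src h); trg h = TOb T (Y \<oplus> src g)\<rbrakk> \<Longrightarrow>
      iter T it Y (ext T (Y \<oplus> src g) ((eta T (Y \<oplus> src g) \<bullet> inl Y (src g)) \<amalg> h) \<bullet> g) =
      ext T Y (eta T Y \<amalg> iter T it Y
        (ext T (Y \<oplus> src h) ((eta T (Y \<oplus> src h) \<bullet> inl Y (src h)) \<amalg> g) \<bullet> h)) \<bullet> g"
    and "\<And>Y g. \<lbrakk>valid g; Y \<in> Ob C; trg g = TOb T ((Y \<oplus> src g) \<oplus> src g)\<rbrakk> \<Longrightarrow>
      iter T it Y (tmap T (ident (Y \<oplus> src g) \<amalg> inr Y (src g)) \<bullet> g) =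
      iter T it Y (iter T it (Y \<oplus> src g) g)"
    and "\<And>Y f g h. \<lbrakk>valid f; valid g; valid h; Y \<in> Ob C; trg f = TOb T (Y \<oplus> src f);
        trg g = TOb T (Y \<oplus> src g); src h = src g; trg h = src f;
        f \<bullet> h = tmap T (ident Y \<uplus> h) \<bullet> g\<rbrakk> \<Longrightarrow>
      iter T it Y f \<bullet> h = iter T it Y g"
    and "\<And>Y Z f. \<lbrakk>valid f; Y \<in> Ob C; Z \<in> Ob C; trg f = TOb T (Y \<oplus> src f)\<rbrakk> \<Longrightarrow>
      str T Z Y \<bullet> (ident Z \<odot> iter T it Y f) =
      iter T it (Z \<otimes> Y) (tmap T (distr Z Y (src f)) \<bullet> str T Z (Y \<oplus> src f) \<bullet> (ident Z \<odot> f))"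
  shows "complete_elgot_monad C T it"
proof -
  interpret strong_monad C T
    by fact
  show ?thesis
  proof (unfold_locales, goal_cases)
    case (1 X Y f)
    then show ?case
      by (rule it_in_hom)
  next
    case (2 X Y f)
    then show ?case
      using assms(2) [of "lift f" Y, THEN arg_cong [where f = val]]
      by (simp add: val_iteration_simps hom_def)
  next
    case (3 X Y Z f g)
    then show ?case
      using assms(3) [of "lift f" "lift g" Y Z, THEN arg_cong [where f = val]]
      by (simp add: val_iteration_simps hom_def)
  next
    case (4 X Y Z g h)
    then show ?case
      using assms(4) [of "lift g" "lift h" Y, THEN arg_cong [where f = val]]
      by (simp add: val_iteration_simps hom_def)
  next
    case (5 X Y g)
    then show ?case
      using assms(5) [of "lift g" Y, THEN arg_cong [where f = val]]
      by (simp add: val_iteration_simps hom_def)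
  next
    case (6 X Y Z f g h)
    \<comment> \<open>Uniformity has an equation among its hypotheses, which must itself be carried
      over to arrows.\<close>
    have "lift f \<bullet> lift h = tmap T (ident Y \<uplus> lift h) \<bullet> lift g"
      using 6 by (intro arrow_eqI) (simp_all add: val_iteration_simps hom_def)
    with 6 show ?case
      using assms(6) [of "lift f" "lift g" "lift h" Y, THEN arg_cong [where f = val]]
      by (simp add: val_iteration_simps hom_def)
  next
    case (7 X Y Z f)
    then show ?case
      using assms(7) [of "lift f" Y Z, THEN arg_cong [where f = val]]
      by (simp add: val_iteration_simps hom_def)
  qed
qed

end

section \<open>The laws of strong monads and of iteration on arrows\<close>

sublocale strong_monad \<subseteq> monad_signature C T
  by unfold_locales (simp_all add: TOb_Ob Eta_hom Ext_hom Str_hom)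

context strong_monad
begin

lemma ext_eta [simp]: "X \<in> Ob C \<Longrightarrow> ext T X (eta T X) = ident (TOb T X)"
  by (rule arrow_eqI) (simp_all add: val_monad_simps Ext_Eta)

lemma ext_comp_eta:
  assumes "valid f" "src f = X" "Y \<in> Ob C" "trg f = TOb T Y"
  shows "ext T Y f \<bullet> eta T X = f"
  by (rule arrow_eqI)
    (use assms valid_val_hom [of f] Ext_Comp_Eta [of X Y "val f"] in \<open>auto simp: val_monad_simps\<close>)

text \<open>The condition compares objects and not their images: \<open>TOb T\<close> need not be
  injective, so a defined composite does not force \<open>src f = Y\<close>.\<close>

lemma ext_ext:
  assumes "src f = Y"
  shows "ext T Z f \<bullet> ext T Y g = ext T Z (ext T Z f \<bullet> g)"
proof -
  have "val (ext T Z f) \<cdot> val (ext T Y g) = Ext T Z (val (ext T Z f \<bullet> g))"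
    if "valid f" "valid g" "Y \<in> Ob C" "Z \<in> Ob C" "trg f = TOb T Z" "trg g = TOb T Y"
    using Ext_Ext [of "src g" Y Z "val g" "val f"] that assms valid_val_hom [of f] valid_val_hom [of g]
    by (auto simp: val_monad_simps)
  then show ?thesis
    unfolding comp_def [of "ext T Z f" "ext T Y g"] ext_def [of _ _ "ext T Z f \<bullet> g"]
    using assms by (intro arrow_if_cong) auto
qed

lemmas ext_comp_eta_assoc = ext_comp_eta [THEN comp_reassoc]
  and ext_ext_assoc = ext_ext [THEN comp_reassoc]

text \<open>A rewriting system for Kleisli composites: \<open>tmap\<close> is unfolded, nested
  extensions are merged, and copairings are evaluated on injections.\<close>

lemmas kleisli_simps = comp_assoc comp_cotuple comp_cotuple [THEN comp_reassoc]
  cotuple_inl cotuple_inr cotuple_inl_assoc cotuple_inr_assoc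
  coproduct_map_def tmap_def [of T] ext_comp_eta ext_ext ext_comp_eta_assoc ext_ext_assoc cotuple_inl_inr
  cotuple_comp_inl_inr

lemma tmap_comp: "\<lbrakk>valid f; valid g; src g = trg f\<rbrakk> \<Longrightarrow> tmap T g \<bullet> tmap T f = tmap T (g \<bullet> f)"
  by (simp add: kleisli_simps)

lemma tmap_ident [simp]: "X \<in> Ob C \<Longrightarrow> tmap T (ident X) = ident (TOb T X)"
  by (simp add: kleisli_simps)

lemma str_natural:
  "\<lbrakk>valid f; valid g\<rbrakk> \<Longrightarrow>
    tmap T (f \<odot> g) \<bullet> str T (src f) (src g) = str T (trg f) (trg g) \<bullet> (f \<odot> tmap T g)"
  by (rule arrow_eqI) (simp_all add: val_monad_simps Str_natural [OF valid_val_hom valid_val_hom])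

lemma str_unit: "X \<in> Ob C \<Longrightarrow> tmap T (proj2 (One C) X) \<bullet> str T (One C) X = proj2 (One C) (TOb T X)"
  by (rule arrow_eqI) (simp_all add: val_monad_simps Str_unit)

lemma str_assoc: "\<lbrakk>X \<in> Ob C; Y \<in> Ob C; Z \<in> Ob C\<rbrakk> \<Longrightarrow>
    tmap T (assocr X Y Z) \<bullet> str T (X \<otimes> Y) Z =
    str T X (Y \<otimes> Z) \<bullet> (ident X \<odot> str T Y Z) \<bullet> assocr X Y (TOb T Z)"
  by (rule arrow_eqI) (simp_all add: val_monad_simps Str_assoc)

lemma str_eta: "\<lbrakk>X \<in> Ob C; Y \<in> Ob C\<rbrakk> \<Longrightarrow> str T X Y \<bullet> (ident X \<odot> eta T Y) = eta T (X \<otimes> Y)"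
  by (rule arrow_eqI) (simp_all add: val_monad_simps Str_Eta)

lemma str_ext:
  assumes "valid f" "X \<in> Ob C" "Z \<in> Ob C" "trg f = TOb T Z"
  shows "str T X Z \<bullet> (ident X \<odot> ext T Z f) =
    ext T (X \<otimes> Z) (str T X Z \<bullet> (ident X \<odot> f)) \<bullet> str T X (src f)"
  by (rule arrow_eqI)
    (use assms valid_val_hom [of f] Str_Ext [of X "src f" Z "val f"] in \<open>simp_all add: val_monad_simps\<close>)

end

sublocale complete_elgot_monad \<subseteq> iteration_signature C T it
  by unfold_locales (rule it_hom)

context complete_elgot_monad
begin

lemma iter_unfolding:
  assumes "valid f" "Y \<in> Ob C" "trg f = TOb T (Y \<oplus> src f)"
  shows "ext T Y (eta T Y \<amalg> iter T it Y f) \<bullet> f = iter T it Y f"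
  using assms it_unfolding [of "src f" Y "val f"] valid_val_hom [of f]
  by (intro arrow_eqI) (auto simp: val_iteration_simps)

lemma iter_naturality:
  assumes "valid f" "valid g" "Y \<in> Ob C" "Z \<in> Ob C" "trg f = TOb T (Y \<oplus> src f)"
    "src g = Y" "trg g = TOb T Z"
  shows "ext T Z g \<bullet> iter T it Y f = iter T it Z (ext T (Z \<oplus> src f)
    ((tmap T (inl Z (src f)) \<bullet> g) \<amalg> (eta T (Z \<oplus> src f) \<bullet> inr Z (src f))) \<bullet> f)"
  using assms it_naturality [of "src f" Y Z "val f" "val g"] valid_val_hom [of f] valid_val_hom [of g]
  by (intro arrow_eqI) (auto simp: val_iteration_simps)

lemma iter_codiagonal:
  assumes "valid g" "Y \<in> Ob C" "trg g = TOb T ((Y \<oplus> src g) \<oplus> src g)"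
  shows "iter T it Y (iter T it (Y \<oplus> src g) g) =
    iter T it Y (tmap T (ident (Y \<oplus> src g) \<amalg> inr Y (src g)) \<bullet> g)"
  using assms it_codiagonal [of "src g" Y "val g"] valid_val_hom [of g]
  by (intro arrow_eqI) (auto simp: val_iteration_simps)

lemma iter_uniformity:
  assumes "f \<bullet> h = tmap T (ident Y \<uplus> h) \<bullet> g"
    "valid f" "valid g" "valid h" "Y \<in> Ob C" "trg f = TOb T (Y \<oplus> src f)"
    "trg g = TOb T (Y \<oplus> src g)" "src h = src g" "trg h = src f"
  shows "iter T it Y f \<bullet> h = iter T it Y g"
proof -
  have "val f \<cdot> val h = TMap C T (Id C Y \<boxplus> val h) \<cdot> val g"
    using assms(2-) arg_cong [OF assms(1), of val] by (simp add: val_iteration_simps)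
  then show ?thesis
    using assms it_uniformity [of "src f" Y "src g" "val f" "val g" "val h"]
      valid_val_hom [of f] valid_val_hom [of g] valid_val_hom [of h]
    by (intro arrow_eqI) (auto simp: val_iteration_simps)
qed

lemma iter_strength:
  assumes "valid f" "Y \<in> Ob C" "Z \<in> Ob C" "trg f = TOb T (Y \<oplus> src f)"
  shows "str T Z Y \<bullet> (ident Z \<odot> iter T it Y f) =
    iter T it (Z \<otimes> Y) (tmap T (distr Z Y (src f)) \<bullet> str T Z (Y \<oplus> src f) \<bullet> (ident Z \<odot> f))"
  using assms it_strength [of "src f" Y Z "val f"] valid_val_hom [of f]
  by (intro arrow_eqI) (auto simp: val_iteration_simps)

end

section \<open>Corecursion and the resumption monad\<close>

locale resumption = complete_elgot_monad C T it + strong_functor C S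
  for C :: "('o, 'm, 'z) bicat_scheme" (structure) and T :: "('o, 'm) monad_data"
    and it :: "'o \<Rightarrow> 'm \<Rightarrow> 'm" and S :: "('o, 'm) functor_data" +
  fixes N :: "'o \<Rightarrow> 'o" and out :: "'o \<Rightarrow> 'm"
  assumes final: "X \<in> Ob C \<Longrightarrow>
    final_coalgebra C (resOb C T S X) (resMap C T S X) (N X) (out X)"
begin

abbreviation SN :: "'o \<Rightarrow> 'o" where
  "SN X \<equiv> FOb S (N X)"

abbreviation R :: "('o, 'm) monad_data" where
  "R \<equiv> resumption_monad C T S N out"

definition dest :: "'o \<Rightarrow> ('o, 'm) arrow" where
  "dest X = arrow_if (N X) (TOb T (X \<oplus> SN X)) (X \<in> Ob C) (out X)"

lemma N_Ob [simp]: "X \<in> Ob C \<Longrightarrow> N X \<in> Ob C"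
  using final [of X] by (simp add: final_coalgebra_def)

lemma src_dest [simp]: "src (dest X) = N X"
  and trg_dest [simp]: "trg (dest X) = TOb T (X \<oplus> SN X)"
  and valid_dest [simp]: "valid (dest X) \<longleftrightarrow> X \<in> Ob C"
  and val_dest: "X \<in> Ob C \<Longrightarrow> val (dest X) = out X"
  using final [of X]
  by (simp_all add: dest_def valid_arrow_if val_arrow_if final_coalgebra_def resOb_def)

lemmas val_res_simps = val_monad_simps val_smap val_sstr val_dest

lemma dest_final:
  assumes "valid b" "trg b = TOb T (X \<oplus> FOb S (src b))" "X \<in> Ob C"
  shows "\<exists>!h. valid h \<and> src h = src b \<and> trg h = N X \<and> dest X \<bullet> h = tmap T (ident X \<uplus> smap S h) \<bullet> b"
proof -
  have val_eq: "dest X \<bullet> h = tmap T (ident X \<uplus> smap S h) \<bullet> b \<longleftrightarrow>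
      out X \<cdot> val h = resMap C T S X (val h) \<cdot> val b"
    if "valid h" "src h = src b" "trg h = N X" for h
    using that assms by (subst arrow_eq_iff) (auto simp: val_res_simps resMap_def)
  have "\<exists>!h. h \<in> hom C (src b) (N X) \<and> out X \<cdot> h = resMap C T S X h \<cdot> val b"
    using final [of X] assms valid_val_hom [of b]
    by (auto simp: final_coalgebra_def resOb_def)
  then obtain g where g: "g \<in> hom C (src b) (N X)" "out X \<cdot> g = resMap C T S X g \<cdot> val b"
    and uniq: "\<And>h. \<lbrakk>h \<in> hom C (src b) (N X); out X \<cdot> h = resMap C T S X h \<cdot> val b\<rbrakk> \<Longrightarrow> h = g"
    by blast
  show ?thesis
  proof (rule ex1I [of _ "lift g"])
    show "valid (lift g) \<and> src (lift g) = src b \<and> trg (lift g) = N X \<and>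
      dest X \<bullet> lift g = tmap T (ident X \<uplus> smap S (lift g)) \<bullet> b"
      using g val_eq [of "lift g"] by (simp add: hom_def)
    show "h = lift g" if h: "valid h \<and> src h = src b \<and> trg h = N X \<and>
      dest X \<bullet> h = tmap T (ident X \<uplus> smap S h) \<bullet> b" for h
    proof -
      have "val h = g"
        using h val_eq [of h] by (intro uniq) (auto dest: valid_val_hom)
      then show ?thesis
        using h by auto
    qed
  qed
qed

lemma dest_final_unique:
  assumes "dest X \<bullet> h = tmap T (ident X \<uplus> smap S h) \<bullet> b"
    "dest X \<bullet> k = tmap T (ident X \<uplus> smap S k) \<bullet> b"
    "valid h" "valid k" "src h = src b" "src k = src b" "trg h = N X" "trg k = N X"
    "valid b" "trg b = TOb T (X \<oplus> FOb S (src b))" "X \<in> Ob C"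
  shows "h = k"
  using dest_final [of b X] assms by blast

lemmas res_simps = kleisli_simps smap_comp smap_comp_assoc

text \<open>
  Primitive corecursion: \<open>h\<close> may return to \<open>N Y\<close> through \<open>p\<close>. It is plain coiteration on
  \<open>src b \<oplus> N Y\<close>, with \<open>dest Y\<close> as the structure on the second summand.
\<close>

lemma corec_ex1:
  assumes "valid b" "trg b = TOb T (A \<oplus> FOb S (src b))" "valid p" "src p = A"
    "trg p = TOb T (Y \<oplus> SN Y)" "A \<in> Ob C" "Y \<in> Ob C"
  shows "\<exists>!h. valid h \<and> src h = src b \<and> trg h = N Y \<and> dest Y \<bullet> h =
    ext T (Y \<oplus> SN Y) (p \<amalg> (eta T (Y \<oplus> SN Y) \<bullet> inr Y (SN Y) \<bullet> smap S h)) \<bullet> b"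
proof -
  define B where "B = src b"
  define W where "W = Y \<oplus> FOb S (B \<oplus> N Y)"
  define c where "c =
    (ext T W ((tmap T (ident Y \<uplus> smap S (inr B (N Y))) \<bullet> p) \<amalg>
      (eta T W \<bullet> inr Y (FOb S (B \<oplus> N Y)) \<bullet> smap S (inl B (N Y)))) \<bullet> b) \<amalg>
    (tmap T (ident Y \<uplus> smap S (inr B (N Y))) \<bullet> dest Y)"
  have B: "B \<in> Ob C" "src b = B"
    using assms by (simp_all add: B_def)
  have c: "valid c" "src c = B \<oplus> N Y" "trg c = TOb T W"
    using assms B by (auto simp: c_def W_def)
  obtain k where k: "valid k" "src k = B \<oplus> N Y" "trg k = N Y"
      "dest Y \<bullet> k = tmap T (ident Y \<uplus> smap S k) \<bullet> c"
    using dest_final [of c Y] c assms(7) unfolding W_def by metis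
  \<comment> \<open>On \<open>N Y\<close> the map \<open>k\<close> is a coalgebra endomorphism of
    the final coalgebra, as is the identity.\<close>
  have "k \<bullet> inr B (N Y) = ident (N Y)"
    by (rule dest_final_unique [of Y _ "dest Y"])
      (use assms B k(1-3) in \<open>simp_all add: k(4) [THEN comp_reassoc] c_def W_def res_simps\<close>)
  note k_inr = this this [THEN comp_reassoc]
  show ?thesis
  proof (rule ex1I [of _ "k \<bullet> inl B (N Y)"], goal_cases)
    case 1
    show ?case
      using assms B k(1-3)
      by (simp add: k(4) [THEN comp_reassoc] c_def W_def res_simps k_inr)
  next
    case (2 h)
    \<comment> \<open>Extended by the identity on \<open>N Y\<close>, any solution becomes a
      coalgebra morphism from \<open>c\<close>.\<close>
    have "h \<amalg> ident (N Y) = k"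
      by (rule dest_final_unique [of Y _ c])
        (use assms B 2 k in \<open>simp_all add: c_def W_def res_simps\<close>)
    then show ?case
      using 2 B assms by (auto simp: cotuple_inl)
  qed
qed

lemma corec_eqI:
  assumes "dest Y \<bullet> h = ext T (Y \<oplus> SN Y) (p \<amalg> (eta T (Y \<oplus> SN Y) \<bullet> inr Y (SN Y) \<bullet> smap S h)) \<bullet> b"
    "dest Y \<bullet> k = ext T (Y \<oplus> SN Y) (p \<amalg> (eta T (Y \<oplus> SN Y) \<bullet> inr Y (SN Y) \<bullet> smap S k)) \<bullet> b"
    "valid h" "valid k" "src h = src b" "src k = src b" "trg h = N Y" "trg k = N Y"
    "valid b" "trg b = TOb T (A \<oplus> FOb S (src b))" "valid p" "src p = A"
    "trg p = TOb T (Y \<oplus> SN Y)" "A \<in> Ob C" "Y \<in> Ob C"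
  shows "h = k"
  using corec_ex1 [of b A p Y] assms by blast

text \<open>Lambek's lemma: \<open>dest Y\<close> is invertible. It is corecursion with a step that
  returns at once through \<open>w\<close>, so that no recursive call is left and the equation
  collapses to \<open>dest Y \<bullet> h = w\<close>.\<close>

lemma dest_ex1:
  assumes "valid w" "trg w = TOb T (Y \<oplus> SN Y)" "Y \<in> Ob C"
  shows "\<exists>!h. valid h \<and> src h = src w \<and> trg h = N Y \<and> dest Y \<bullet> h = w"
  using corec_ex1 [of "eta T (src w \<oplus> FOb S (src w)) \<bullet> inl (src w) (FOb S (src w))" "src w" w Y] assms
  by (simp add: comp_assoc ext_comp_eta_assoc cotuple_inl cong: conj_cong)

lemma dest_mono:
  assumes "dest Y \<bullet> h = dest Y \<bullet> k" "valid h" "valid k" "trg h = N Y" "trg k = N Y"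
    "src h = src k" "Y \<in> Ob C"
  shows "h = k"
proof -
  have "\<exists>!h'. valid h' \<and> src h' = src h \<and> trg h' = N Y \<and> dest Y \<bullet> h' = dest Y \<bullet> h"
    using dest_ex1 [of "dest Y \<bullet> h" Y] assms(2,4,7) by simp
  then show ?thesis
    using assms by (elim ex1E) (metis (no_types))
qed

section \<open>Existence of the unit, the extension and the strength\<close>

lemma resumption_monad_TOb [simp]: "TOb R = N"
  by (simp add: resumption_monad_def)

lemma resEta_spec:
  assumes "X \<in> Ob C"
  shows "Eta R X \<in> hom C X (N X)"
    and "dest X \<bullet> lift (Eta R X) = eta T (X \<oplus> SN X) \<bullet> inl X (SN X)"
proof -
  define w where "w = eta T (X \<oplus> SN X) \<bullet> inl X (SN X)"
  have w: "valid w" "trg w = TOb T (X \<oplus> SN X)" "src w = X"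
    using assms by (simp_all add: w_def)
  have "out X \<cdot> h = Eta T (X \<oplus> SN X) \<cdot> Inl C X (SN X) \<longleftrightarrow> dest X \<bullet> lift h = w"
    if "h \<in> hom C X (N X)" for h
    using that assms unfolding w_def by (subst arrow_eq_iff) (auto simp: val_res_simps hom_def)
  from lift_The [OF dest_ex1 [OF w(1,2) assms, unfolded w(3)], of "\<lambda>h. out X \<cdot> h = _", OF this]
  show "Eta R X \<in> hom C X (N X)" "dest X \<bullet> lift (Eta R X) = eta T (X \<oplus> SN X) \<bullet> inl X (SN X)"
    by (simp_all add: resumption_monad_def resEta_def w_def)
qed

text \<open>The description denotes because it is primitive corecursion: it unfolds by
  \<open>dest (src f)\<close> and returns through \<open>dest Y \<bullet> f\<close>.\<close>

lemma resExt_spec: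
  assumes "valid f" "trg f = N Y" "Y \<in> Ob C"
  shows "Ext R Y (val f) \<in> hom C (N (src f)) (N Y)"
    and "dest Y \<bullet> lift (Ext R Y (val f)) = ext T (Y \<oplus> SN Y) ((dest Y \<bullet> f) \<amalg>
      (eta T (Y \<oplus> SN Y) \<bullet> inr Y (SN Y) \<bullet> smap S (lift (Ext R Y (val f))))) \<bullet> dest (src f)"
proof -
  define Q where "Q h \<longleftrightarrow> out Y \<cdot> h = Ext T (Y \<oplus> SN Y)
      ((out Y \<cdot> val f) \<nabla> (Eta T (Y \<oplus> SN Y) \<cdot> Inr C Y (SN Y) \<cdot> FMap S h)) \<cdot> out (src f)" for h
  define P where "P h \<longleftrightarrow> dest Y \<bullet> h = ext T (Y \<oplus> SN Y) ((dest Y \<bullet> f) \<amalg>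
      (eta T (Y \<oplus> SN Y) \<bullet> inr Y (SN Y) \<bullet> smap S h)) \<bullet> dest (src f)" for h
  have ex1: "\<exists>!h. valid h \<and> src h = N (src f) \<and> trg h = N Y \<and> P h"
    using corec_ex1 [of "dest (src f)" "src f" "dest Y \<bullet> f" Y] assms unfolding P_def by simp
  have PQ: "Q h \<longleftrightarrow> P (lift h)" if "h \<in> hom C (N (src f)) (N Y)" for h
    using that assms unfolding Q_def P_def
    by (subst arrow_eq_iff) (auto simp: val_res_simps hom_def)
  note lift_The [where P = P and Q = Q, OF ex1 PQ]
  moreover have "Ext R Y (val f) = (THE h. h \<in> hom C (N (src f)) (N Y) \<and> Q h)"
    using assms by (simp add: resumption_monad_def resExt_def Q_def)
  ultimately show "Ext R Y (val f) \<in> hom C (N (src f)) (N Y)"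
    and "dest Y \<bullet> lift (Ext R Y (val f)) = ext T (Y \<oplus> SN Y) ((dest Y \<bullet> f) \<amalg>
      (eta T (Y \<oplus> SN Y) \<bullet> inr Y (SN Y) \<bullet> smap S (lift (Ext R Y (val f))))) \<bullet> dest (src f)"
    unfolding P_def by simp_all
qed

text \<open>The coalgebra on \<open>X \<otimes> src b\<close> that coiteration turns into the
  strength. It takes any \<open>b\<close> instead of \<open>dest\<close> because the associativity
  law applies it twice.\<close>

definition str_step :: "'o \<Rightarrow> 'o \<Rightarrow> ('o, 'm) arrow \<Rightarrow> ('o, 'm) arrow" where
  "str_step X A b = tmap T ((ident (X \<otimes> A) \<uplus> sstr S X (src b)) \<bullet> distr X A (FOb S (src b))) \<bullet>
    str T X (A \<oplus> FOb S (src b)) \<bullet> (ident X \<odot> b)"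

lemma src_str_step [simp]: "src (str_step X A b) = X \<otimes> src b"
  and trg_str_step [simp]: "trg (str_step X A b) = TOb T ((X \<otimes> A) \<oplus> FOb S (X \<otimes> src b))"
  and valid_str_step [simp]:
    "\<lbrakk>X \<in> Ob C; A \<in> Ob C; valid b; trg b = TOb T (A \<oplus> FOb S (src b))\<rbrakk> \<Longrightarrow> valid (str_step X A b)"
  by (simp_all add: str_step_def)

lemma resStr_spec:
  assumes "X \<in> Ob C" "Y \<in> Ob C"
  shows "Str R X Y \<in> hom C (X \<otimes> N Y) (N (X \<otimes> Y))"
    and "dest (X \<otimes> Y) \<bullet> lift (Str R X Y) =
      tmap T (ident (X \<otimes> Y) \<uplus> smap S (lift (Str R X Y))) \<bullet> str_step X Y (dest Y)"
proof -
  define Q where "Q h \<longleftrightarrow> out (X \<otimes> Y) \<cdot> h = TMap C T (Id C (X \<otimes> Y) \<boxplus> FMap S h)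
       \<cdot> TMap C T ((Id C (X \<otimes> Y) \<boxplus> FStr S X (N Y)) \<cdot> dist C X Y (SN Y))
       \<cdot> Str T X (Y \<oplus> SN Y) \<cdot> (Id C X \<boxtimes> out Y)" for h
  define P where "P h \<longleftrightarrow> dest (X \<otimes> Y) \<bullet> h =
      tmap T (ident (X \<otimes> Y) \<uplus> smap S h) \<bullet> str_step X Y (dest Y)" for h
  have ex1: "\<exists>!h. valid h \<and> src h = X \<otimes> N Y \<and> trg h = N (X \<otimes> Y) \<and> P h"
    using dest_final [of "str_step X Y (dest Y)" "X \<otimes> Y"] assms unfolding P_def by simp
  have PQ: "Q h \<longleftrightarrow> P (lift h)" if "h \<in> hom C (X \<otimes> N Y) (N (X \<otimes> Y))" for h
    using that assms unfolding Q_def P_def str_step_def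
    by (subst arrow_eq_iff) (auto simp: val_res_simps hom_def)
  note lift_The [where P = P and Q = Q, OF ex1 PQ]
  moreover have "Str R X Y = (THE h. h \<in> hom C (X \<otimes> N Y) (N (X \<otimes> Y)) \<and> Q h)"
    by (simp add: resumption_monad_def resStr_def Q_def)
  ultimately show "Str R X Y \<in> hom C (X \<otimes> N Y) (N (X \<otimes> Y))"
    and "dest (X \<otimes> Y) \<bullet> lift (Str R X Y) =
      tmap T (ident (X \<otimes> Y) \<uplus> smap S (lift (Str R X Y))) \<bullet> str_step X Y (dest Y)"
    unfolding P_def by simp_all
qed

end

sublocale resumption \<subseteq> R: monad_signature C R
proof
  show "Ext R Y f \<in> hom C (TOb R X) (TOb R Y)"
    if "X \<in> Ob C" "Y \<in> Ob C" "f \<in> hom C X (TOb R Y)" for X Y f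
    using resExt_spec(1) [of "lift f" Y] that by (simp add: hom_def)
qed (simp_all add: resEta_spec(1) resStr_spec(1))

context resumption
begin

lemma dest_eta: "X \<in> Ob C \<Longrightarrow> dest X \<bullet> eta R X = eta T (X \<oplus> SN X) \<bullet> inl X (SN X)"
  using resEta_spec(2) [of X] by (metis R.val_eta R.valid_eta lift_val)

lemma dest_ext:
  assumes "valid f" "trg f = N Y" "Y \<in> Ob C"
  shows "dest Y \<bullet> ext R Y f = ext T (Y \<oplus> SN Y) ((dest Y \<bullet> f) \<amalg>
      (eta T (Y \<oplus> SN Y) \<bullet> inr Y (SN Y) \<bullet> smap S (ext R Y f))) \<bullet> dest (src f)"
proof -
  have "lift (Ext R Y (val f)) = ext R Y f"
    using assms by (subst lift_val [symmetric]) (simp_all add: R.val_ext)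
  then show ?thesis
    using resExt_spec(2) [OF assms] by simp
qed

lemma dest_str:
  assumes "X \<in> Ob C" "Y \<in> Ob C"
  shows "dest (X \<otimes> Y) \<bullet> str R X Y = tmap T (ident (X \<otimes> Y) \<uplus> smap S (str R X Y)) \<bullet> str_step X Y (dest Y)"
proof -
  have "lift (Str R X Y) = str R X Y"
    using assms by (subst lift_val [symmetric]) (simp_all add: R.val_str)
  then show ?thesis
    using resStr_spec(2) [OF assms] by simp
qed

lemmas dest_simps = dest_eta dest_eta [THEN comp_reassoc] dest_ext dest_ext [THEN comp_reassoc]
  dest_str dest_str [THEN comp_reassoc]

section \<open>The Kleisli laws of the resumption monad\<close>

lemma R_ext_eta: "X \<in> Ob C \<Longrightarrow> ext R X (eta R X) = ident (N X)"
  by (rule corec_eqI [of X _ "eta T (X \<oplus> SN X) \<bullet> inl X (SN X)" "dest X"])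
    (simp_all add: dest_simps res_simps)

lemma R_ext_comp_eta:
  "\<lbrakk>valid f; src f = X; Y \<in> Ob C; trg f = N Y\<rbrakk> \<Longrightarrow> ext R Y f \<bullet> eta R X = f"
  by (rule dest_mono [of Y]) (auto simp add: dest_simps res_simps)

text \<open>Both sides unfold by \<open>dest (src g)\<close> and continue at a returned value with
  \<open>dest Z \<bullet> ext R Z f \<bullet> g\<close>, so they solve the same corecursion.\<close>

lemma R_ext_ext:
  "\<lbrakk>valid f; valid g; Y \<in> Ob C; Z \<in> Ob C; trg g = N Y; src f = Y; trg f = N Z\<rbrakk> \<Longrightarrow>
    ext R Z (ext R Z f \<bullet> g) = ext R Z f \<bullet> ext R Y g"
  by (rule corec_eqI [of Z _ "dest Z \<bullet> ext R Z f \<bullet> g" "dest (src g)" _ "src g"])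
    (simp_all add: dest_simps res_simps)

section \<open>The laws of its strength\<close>

lemma dest_tmap:
  assumes "valid f" "trg f = B"
  shows "dest B \<bullet> tmap R f = tmap T (f \<uplus> smap S (tmap R f)) \<bullet> dest (src f)"
  using assms by (auto simp: tmap_def [of R] dest_simps res_simps)

lemma ident_product_comp:
  "\<lbrakk>X \<in> Ob C; valid g; valid f; src g = trg f\<rbrakk> \<Longrightarrow>
    ident X \<odot> (g \<bullet> f) = (ident X \<odot> g) \<bullet> (ident X \<odot> f)"
  by (simp add: product_map_comp)

text \<open>The hypothesis on \<open>h\<close> says that it is a morphism of coalgebras up to
  \<open>g\<close> on outputs. Such morphisms survive \<open>str_step\<close> since
  \<open>str\<close>, \<open>distr\<close> and \<open>sstr\<close> are natural.\<close>

lemma str_step_natural: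
  assumes "c \<bullet> h = tmap T (g \<uplus> smap S h) \<bullet> b"
    and "valid f" "valid g" "valid h" "valid b" "valid c" "trg b = TOb T (src g \<oplus> FOb S (src b))"
    "src h = src b" "trg h = src c" "trg c = TOb T (trg g \<oplus> FOb S (src c))" "trg f = X"
  shows "str_step X (trg g) c \<bullet> (f \<odot> h) =
    tmap T ((f \<odot> g) \<uplus> smap S (f \<odot> h)) \<bullet> str_step (src f) (src g) b"
proof -
  let ?m = "g \<uplus> smap S h"
  have X: "X \<in> Ob C" "src f \<in> Ob C" "src g \<in> Ob C" "trg g \<in> Ob C" "src b \<in> Ob C" "src c \<in> Ob C"
    using assms by auto
  have 1: "(ident X \<odot> c) \<bullet> (f \<odot> h) = (f \<odot> tmap T ?m) \<bullet> (ident (src f) \<odot> b)"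
    using assms X by (simp add: product_map_comp)
  have 2: "str T X (trg g \<oplus> FOb S (src c)) \<bullet> (f \<odot> tmap T ?m) =
      tmap T (f \<odot> ?m) \<bullet> str T (src f) (src g \<oplus> FOb S (src b))"
    using assms X str_natural [of f ?m] by simp
  have 3: "((ident (X \<otimes> trg g) \<uplus> sstr S X (src c)) \<bullet> distr X (trg g) (FOb S (src c))) \<bullet> (f \<odot> ?m) =
    ((f \<odot> g) \<uplus> smap S (f \<odot> h)) \<bullet> (ident (src f \<otimes> src g) \<uplus> sstr S (src f) (src b)) \<bullet>
      distr (src f) (src g) (FOb S (src b))"
    using assms X distr_natural [of f g "smap S h"] sstr_natural [of f h]
    by (simp add: comp_assoc coproduct_map_comp coproduct_map_comp [THEN comp_reassoc])
  show ?thesis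
    using assms X 1 2 [THEN comp_reassoc] arg_cong [OF 3, of "tmap T"]
    by (simp add: str_step_def comp_assoc tmap_comp tmap_comp [THEN comp_reassoc])
qed

text \<open>Both sides solve the corecursion with step \<open>str_step\<close> over
  \<open>dest (src g)\<close> that applies \<open>f \<odot> g\<close> on return.\<close>

lemma R_str_natural:
  assumes "valid f" "valid g"
  shows "tmap R (f \<odot> g) \<bullet> str R (src f) (src g) = str R (trg f) (trg g) \<bullet> (f \<odot> tmap R g)"
proof -
  let ?W = "(trg f \<otimes> trg g) \<oplus> SN (trg f \<otimes> trg g)"
  have step: "str_step (trg f) (trg g) (dest (trg g)) \<bullet> (f \<odot> tmap R g) =
    tmap T ((f \<odot> g) \<uplus> smap S (f \<odot> tmap R g)) \<bullet> str_step (src f) (src g) (dest (src g))"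
    using assms by (intro str_step_natural dest_tmap) simp_all
  show ?thesis
    by (rule corec_eqI [of "trg f \<otimes> trg g" _
          "eta T ?W \<bullet> inl (trg f \<otimes> trg g) (SN (trg f \<otimes> trg g)) \<bullet> (f \<odot> g)"
          "str_step (src f) (src g) (dest (src g))" _ "src f \<otimes> src g"])
      (use assms step in \<open>simp_all add: dest_simps dest_tmap [THEN comp_reassoc] res_simps\<close>)
qed

lemma R_str_unit:
  assumes "X \<in> Ob C"
  shows "tmap R (proj2 (One C) X) \<bullet> str R (One C) X = proj2 (One C) (N X)"
proof -
  have 1: "(proj2 (One C) X \<uplus> proj2 (One C) (SN X)) \<bullet> distr (One C) X (SN X) = proj2 (One C) (X \<oplus> SN X)"
    by (rule distr_eqI [of _ "One C" X "SN X"])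
      (use assms in \<open>simp_all add: comp_assoc distr_inl distr_inr proj2_product_map\<close>)
  \<comment> \<open>The projection is a morphism from \<open>str_step\<close> to
    \<open>dest\<close>, up to the projection on outputs, so it solves the corecursion that the
    left-hand side solves.\<close>
  have 2: "tmap T (proj2 (One C) X \<uplus> smap S (proj2 (One C) (N X))) \<bullet> str_step (One C) X (dest X) =
      dest X \<bullet> proj2 (One C) (N X)"
  proof -
    have "tmap T (proj2 (One C) X \<uplus> smap S (proj2 (One C) (N X))) \<bullet> str_step (One C) X (dest X) =
       tmap T ((proj2 (One C) X \<uplus> proj2 (One C) (SN X)) \<bullet> distr (One C) X (SN X)) \<bullet>
       str T (One C) (X \<oplus> SN X) \<bullet> (ident (One C) \<odot> dest X)"
      using assms by (simp add: str_step_def tmap_comp [THEN comp_reassoc] comp_assoc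
          coproduct_map_comp [THEN comp_reassoc] sstr_unit)
    also have "\<dots> = proj2 (One C) (TOb T (X \<oplus> SN X)) \<bullet> (ident (One C) \<odot> dest X)"
      using assms 1 str_unit [of "X \<oplus> SN X", THEN comp_reassoc] by simp
    also have "\<dots> = dest X \<bullet> proj2 (One C) (N X)"
      using assms by (simp add: proj2_product_map)
    finally show ?thesis .
  qed
  show ?thesis
    by (rule corec_eqI [of X _ "eta T (X \<oplus> SN X) \<bullet> inl X (SN X) \<bullet> proj2 (One C) X"
          "str_step (One C) X (dest X)" _ "One C \<otimes> X"])
      (use assms 2 [symmetric] in \<open>simp_all add: dest_simps dest_tmap [THEN comp_reassoc] res_simps\<close>)
qed

lemma R_str_eta:
  assumes "X \<in> Ob C" "Y \<in> Ob C"
  shows "str R X Y \<bullet> (ident X \<odot> eta R Y) = eta R (X \<otimes> Y)"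
proof (rule dest_mono [of "X \<otimes> Y"])
  have "str_step X Y (dest Y) \<bullet> (ident X \<odot> eta R Y) =
      tmap T ((ident (X \<otimes> Y) \<uplus> sstr S X (N Y)) \<bullet> distr X Y (SN Y)) \<bullet>
      str T X (Y \<oplus> SN Y) \<bullet> (ident X \<odot> eta T (Y \<oplus> SN Y)) \<bullet> (ident X \<odot> inl Y (SN Y))"
    using assms by (simp add: str_step_def comp_assoc product_map_comp dest_simps)
  also have "\<dots> = eta T ((X \<otimes> Y) \<oplus> FOb S (X \<otimes> N Y)) \<bullet> inl (X \<otimes> Y) (FOb S (X \<otimes> N Y))"
    using assms by (simp add: res_simps str_eta [THEN comp_reassoc] distr_inl)
  finally show "dest (X \<otimes> Y) \<bullet> str R X Y \<bullet> (ident X \<odot> eta R Y) = dest (X \<otimes> Y) \<bullet> eta R (X \<otimes> Y)"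
    using assms by (simp add: dest_simps res_simps)
qed (use assms in auto)

lemma assocr_distr:
  assumes "X \<in> Ob C" "Y \<in> Ob C" "Z \<in> Ob C" "W \<in> Ob C"
  shows "distr X (Y \<otimes> Z) (Y \<otimes> W) \<bullet> (ident X \<odot> distr Y Z W) \<bullet> assocr X Y (Z \<oplus> W) =
    (assocr X Y Z \<uplus> assocr X Y W) \<bullet> distr (X \<otimes> Y) Z W"
proof (rule distr_eqI [of _ "X \<otimes> Y" Z W])
  have "assocr X Y (Z \<oplus> W) \<bullet> (ident (X \<otimes> Y) \<odot> inl Z W) =
      (ident X \<odot> ident Y \<odot> inl Z W) \<bullet> assocr X Y Z"
    "assocr X Y (Z \<oplus> W) \<bullet> (ident (X \<otimes> Y) \<odot> inr Z W) =
      (ident X \<odot> ident Y \<odot> inr Z W) \<bullet> assocr X Y W"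
    using assms assocr_natural [of "ident X" "ident Y" "inl Z W"]
      assocr_natural [of "ident X" "ident Y" "inr Z W"] by simp_all
  then show "(distr X (Y \<otimes> Z) (Y \<otimes> W) \<bullet> (ident X \<odot> distr Y Z W) \<bullet> assocr X Y (Z \<oplus> W)) \<bullet>
      (ident (X \<otimes> Y) \<odot> inl Z W) =
    ((assocr X Y Z \<uplus> assocr X Y W) \<bullet> distr (X \<otimes> Y) Z W) \<bullet> (ident (X \<otimes> Y) \<odot> inl Z W)"
    "(distr X (Y \<otimes> Z) (Y \<otimes> W) \<bullet> (ident X \<odot> distr Y Z W) \<bullet> assocr X Y (Z \<oplus> W)) \<bullet>
      (ident (X \<otimes> Y) \<odot> inr Z W) =
    ((assocr X Y Z \<uplus> assocr X Y W) \<bullet> distr (X \<otimes> Y) Z W) \<bullet> (ident (X \<otimes> Y) \<odot> inr Z W)"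
    using assms by (simp_all add: comp_assoc product_map_comp [THEN comp_reassoc]
        distr_inl distr_inr distr_inl [THEN comp_reassoc] distr_inr [THEN comp_reassoc])
qed (use assms in auto)

text \<open>Associativity of distribution and of the strength of \<Sigma> is collected in
  \<open>core\<close>. The strength of \<open>T\<close> is moved past these by naturality and then
  enters through \<open>str_assoc\<close>.\<close>

lemma str_step_assoc:
  assumes "valid d" "X \<in> Ob C" "Y \<in> Ob C" "Z \<in> Ob C" "trg d = TOb T (Z \<oplus> FOb S (src d))"
  shows "str_step X (Y \<otimes> Z) (str_step Y Z d) \<bullet> assocr X Y (src d) =
    tmap T (assocr X Y Z \<uplus> smap S (assocr X Y (src d))) \<bullet> str_step (X \<otimes> Y) Z d"
proof -
  define B where "B = src d"
  define m where "m = (ident (Y \<otimes> Z) \<uplus> sstr S Y B) \<bullet> distr Y Z (FOb S B)"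
  define n where "n = (ident (X \<otimes> Y \<otimes> Z) \<uplus> sstr S X (Y \<otimes> B)) \<bullet> distr X (Y \<otimes> Z) (FOb S (Y \<otimes> B))"
  have B: "B \<in> Ob C" "src d = B"
    using assms by (auto simp: B_def)
  have m: "valid m" "src m = Y \<otimes> (Z \<oplus> FOb S B)" "trg m = (Y \<otimes> Z) \<oplus> FOb S (Y \<otimes> B)"
    and n: "valid n" "src n = X \<otimes> ((Y \<otimes> Z) \<oplus> FOb S (Y \<otimes> B))"
      "trg n = (X \<otimes> Y \<otimes> Z) \<oplus> FOb S (X \<otimes> Y \<otimes> B)"
    using assms B by (simp_all add: m_def n_def)
  have core: "n \<bullet> (ident X \<odot> m) \<bullet> assocr X Y (Z \<oplus> FOb S B) = (assocr X Y Z \<uplus> smap S (assocr X Y B)) \<bullet>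
      (ident ((X \<otimes> Y) \<otimes> Z) \<uplus> sstr S (X \<otimes> Y) B) \<bullet> distr (X \<otimes> Y) Z (FOb S B)"
  proof -
    have "n \<bullet> (ident X \<odot> m) \<bullet> assocr X Y (Z \<oplus> FOb S B) =
      (ident (X \<otimes> Y \<otimes> Z) \<uplus> sstr S X (Y \<otimes> B)) \<bullet>
      (distr X (Y \<otimes> Z) (FOb S (Y \<otimes> B)) \<bullet> (ident X \<odot> (ident (Y \<otimes> Z) \<uplus> sstr S Y B))) \<bullet>
      (ident X \<odot> distr Y Z (FOb S B)) \<bullet> assocr X Y (Z \<oplus> FOb S B)"
      using assms B by (simp add: m_def n_def comp_assoc ident_product_comp)
    also have "\<dots> = (ident (X \<otimes> Y \<otimes> Z) \<uplus> sstr S X (Y \<otimes> B)) \<bullet>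
      (ident (X \<otimes> Y \<otimes> Z) \<uplus> (ident X \<odot> sstr S Y B)) \<bullet> (distr X (Y \<otimes> Z) (Y \<otimes> FOb S B) \<bullet>
      (ident X \<odot> distr Y Z (FOb S B)) \<bullet> assocr X Y (Z \<oplus> FOb S B))"
      using assms B distr_natural [of "ident X" "ident (Y \<otimes> Z)" "sstr S Y B"] by (simp add: comp_assoc)
    also have "\<dots> = (assocr X Y Z \<uplus> (sstr S X (Y \<otimes> B) \<bullet> (ident X \<odot> sstr S Y B) \<bullet> assocr X Y (FOb S B))) \<bullet>
      distr (X \<otimes> Y) Z (FOb S B)"
      using assms B by (simp add: assocr_distr coproduct_map_comp coproduct_map_comp [THEN comp_reassoc] comp_assoc)
    also have "\<dots> = (assocr X Y Z \<uplus> smap S (assocr X Y B)) \<bullet>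
      (ident ((X \<otimes> Y) \<otimes> Z) \<uplus> sstr S (X \<otimes> Y) B) \<bullet> distr (X \<otimes> Y) Z (FOb S B)"
      using assms B by (simp add: coproduct_map_comp [THEN comp_reassoc] sstr_assoc)
    finally show ?thesis .
  qed
  have "str_step X (Y \<otimes> Z) (str_step Y Z d) \<bullet> assocr X Y B =
      tmap T n \<bullet> str T X ((Y \<otimes> Z) \<oplus> FOb S (Y \<otimes> B)) \<bullet> (ident X \<odot> tmap T m) \<bullet>
      (ident X \<odot> str T Y (Z \<oplus> FOb S B)) \<bullet> (ident X \<odot> ident Y \<odot> d) \<bullet> assocr X Y B"
    using assms B m n by (simp add: str_step_def m_def [symmetric] n_def [symmetric] comp_assoc ident_product_comp)
  also have "\<dots> = tmap T n \<bullet> tmap T (ident X \<odot> m) \<bullet> (str T X (Y \<otimes> (Z \<oplus> FOb S B)) \<bullet>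
      (ident X \<odot> str T Y (Z \<oplus> FOb S B)) \<bullet> assocr X Y (TOb T (Z \<oplus> FOb S B))) \<bullet> (ident (X \<otimes> Y) \<odot> d)"
    using assms B m n str_natural [of "ident X" m, THEN comp_reassoc]
      assocr_natural [of "ident X" "ident Y" d] by (simp add: comp_assoc)
  also have "\<dots> = tmap T (n \<bullet> (ident X \<odot> m) \<bullet> assocr X Y (Z \<oplus> FOb S B)) \<bullet>
      str T (X \<otimes> Y) (Z \<oplus> FOb S B) \<bullet> (ident (X \<otimes> Y) \<odot> d)"
    using assms B m n by (simp add: str_assoc [symmetric] comp_assoc tmap_comp tmap_comp [THEN comp_reassoc])
  also have "\<dots> = tmap T (assocr X Y Z \<uplus> smap S (assocr X Y B)) \<bullet> str_step (X \<otimes> Y) Z d"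
    using assms B by (simp add: core str_step_def tmap_comp [THEN comp_reassoc])
  finally show ?thesis
    by (simp add: B_def)
qed

lemma R_str_assoc:
  assumes "X \<in> Ob C" "Y \<in> Ob C" "Z \<in> Ob C"
  shows "tmap R (assocr X Y Z) \<bullet> str R (X \<otimes> Y) Z =
    str R X (Y \<otimes> Z) \<bullet> (ident X \<odot> str R Y Z) \<bullet> assocr X Y (N Z)"
proof -
  let ?V = "X \<otimes> Y \<otimes> Z"
  have "str_step X (Y \<otimes> Z) (dest (Y \<otimes> Z)) \<bullet> (ident X \<odot> str R Y Z) =
    tmap T (ident ?V \<uplus> smap S (ident X \<odot> str R Y Z)) \<bullet> str_step X (Y \<otimes> Z) (str_step Y Z (dest Z))"
    using assms str_step_natural [OF dest_str, of Y Z "ident X" X] by simp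
  from this [THEN comp_reassoc]
  have step: "str_step X (Y \<otimes> Z) (dest (Y \<otimes> Z)) \<bullet> (ident X \<odot> str R Y Z) \<bullet> assocr X Y (N Z) =
    tmap T (assocr X Y Z \<uplus> smap S ((ident X \<odot> str R Y Z) \<bullet> assocr X Y (N Z))) \<bullet>
      str_step (X \<otimes> Y) Z (dest Z)"
    using assms str_step_assoc [of "dest Z" X Y Z]
    by (simp add: comp_assoc tmap_comp [THEN comp_reassoc] coproduct_map_comp smap_comp)
  show ?thesis
    by (rule corec_eqI [of ?V _ "eta T (?V \<oplus> SN ?V) \<bullet> inl ?V (SN ?V) \<bullet> assocr X Y Z"
          "str_step (X \<otimes> Y) Z (dest Z)" _ "(X \<otimes> Y) \<otimes> Z"])
      (use assms step in \<open>simp_all add: dest_simps dest_tmap [THEN comp_reassoc] res_simps\<close>)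
qed

text \<open>Both sides run \<open>str_step X Y (dest Y)\<close> and continue with \<open>f\<close>
  at returned values. For the right-hand side this is \<open>step\<close>, which takes the strength
  of \<open>T\<close> through the extension that unfolds \<open>ext R Z f\<close>.\<close>

lemma R_str_ext:
  assumes "valid f" "X \<in> Ob C" "Z \<in> Ob C" "trg f = N Z"
  shows "ext R (X \<otimes> Z) (str R X Z \<bullet> (ident X \<odot> f)) \<bullet> str R X (src f) =
    str R X Z \<bullet> (ident X \<odot> ext R Z f)"
proof -
  define Y where "Y = src f"
  define k where "k = ext R Z f"
  define W where "W = (X \<otimes> Z) \<oplus> FOb S (X \<otimes> N Z)"
  define n where "n = (ident (X \<otimes> Z) \<uplus> sstr S X (N Z)) \<bullet> distr X Z (SN Z)"
  \<comment> \<open>The branch of \<open>dest Z \<bullet> k\<close> that goes on under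
    \<Sigma>.\<close>
  define Q where "Q = eta T (Z \<oplus> SN Z) \<bullet> inr Z (SN Z) \<bullet> smap S k"
  have Y: "Y \<in> Ob C" "src f = Y"
    using assms by (auto simp: Y_def)
  have k: "valid k" "src k = N Y" "trg k = N Z"
    and n: "valid n" "src n = X \<otimes> (Z \<oplus> SN Z)" "trg n = W" "W \<in> Ob C"
    and Q: "valid Q" "src Q = SN Y" "trg Q = TOb T (Z \<oplus> SN Z)"
    using assms Y by (auto simp: k_def n_def Q_def W_def)
  have dest_k: "dest Z \<bullet> k = ext T (Z \<oplus> SN Z) ((dest Z \<bullet> f) \<amalg> Q) \<bullet> dest Y"
    using assms Y by (simp add: k_def Q_def dest_simps)
  \<comment> \<open>In this branch the strength of \<open>T\<close> meets a unit and is absorbed,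
    which leaves the strength of \<Sigma>.\<close>
  have "str T X (Z \<oplus> SN Z) \<bullet> (ident X \<odot> Q) =
      (str T X (Z \<oplus> SN Z) \<bullet> (ident X \<odot> eta T (Z \<oplus> SN Z))) \<bullet>
      (ident X \<odot> inr Z (SN Z)) \<bullet> (ident X \<odot> smap S k)"
    using assms Y k by (simp add: Q_def comp_assoc ident_product_comp)
  then have "tmap T n \<bullet> str T X (Z \<oplus> SN Z) \<bullet> (ident X \<odot> Q) =
      eta T W \<bullet> (n \<bullet> (ident X \<odot> inr Z (SN Z))) \<bullet> (ident X \<odot> smap S k)"
    using assms n k by (simp add: str_eta res_simps)
  also have "\<dots> = eta T W \<bullet> inr (X \<otimes> Z) (FOb S (X \<otimes> N Z)) \<bullet> sstr S X (N Z) \<bullet> (ident X \<odot> smap S k)"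
    using assms by (simp add: n_def comp_assoc distr_inr [THEN comp_reassoc] distr_inr
        coproduct_map_inr [THEN comp_reassoc])
  also have "\<dots> = eta T W \<bullet> inr (X \<otimes> Z) (FOb S (X \<otimes> N Z)) \<bullet> smap S (ident X \<odot> k) \<bullet> sstr S X (N Y)"
    using assms k sstr_natural [of "ident X" k] by simp
  finally have Q': "tmap T n \<bullet> str T X (Z \<oplus> SN Z) \<bullet> (ident X \<odot> Q) = \<dots>" .
  have step: "str_step X Z (dest Z) \<bullet> (ident X \<odot> k) =
    ext T W ((str_step X Z (dest Z) \<bullet> (ident X \<odot> f)) \<amalg>
      (eta T W \<bullet> inr (X \<otimes> Z) (FOb S (X \<otimes> N Z)) \<bullet> smap S (ident X \<odot> k))) \<bullet> str_step X Y (dest Y)"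
  proof -
    have "str_step X Z (dest Z) \<bullet> (ident X \<odot> k) =
      tmap T n \<bullet> str T X (Z \<oplus> SN Z) \<bullet>
        (ident X \<odot> ext T (Z \<oplus> SN Z) ((dest Z \<bullet> f) \<amalg> Q)) \<bullet> (ident X \<odot> dest Y)"
      using assms Y k Q dest_k ident_product_comp [of X "dest Z" k]
        ident_product_comp [of X "ext T (Z \<oplus> SN Z) ((dest Z \<bullet> f) \<amalg> Q)" "dest Y"]
      by (simp add: str_step_def n_def comp_assoc)
    also have "\<dots> = tmap T n \<bullet> ext T (X \<otimes> (Z \<oplus> SN Z)) (str T X (Z \<oplus> SN Z) \<bullet>
        (ident X \<odot> ((dest Z \<bullet> f) \<amalg> Q))) \<bullet> str T X (Y \<oplus> SN Y) \<bullet> (ident X \<odot> dest Y)"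
      using assms Y Q by (simp add: str_ext [THEN comp_reassoc] comp_assoc)
    also have "\<dots> = ext T W (((tmap T n \<bullet> str T X (Z \<oplus> SN Z) \<bullet> (ident X \<odot> (dest Z \<bullet> f))) \<amalg>
        (tmap T n \<bullet> str T X (Z \<oplus> SN Z) \<bullet> (ident X \<odot> Q))) \<bullet> distr X Y (SN Y)) \<bullet>
        str T X (Y \<oplus> SN Y) \<bullet> (ident X \<odot> dest Y)"
      using assms Y Q n by (simp add: product_map_cotuple res_simps)
    also have "\<dots> = ext T W ((str_step X Z (dest Z) \<bullet> (ident X \<odot> f)) \<amalg>
      (eta T W \<bullet> inr (X \<otimes> Z) (FOb S (X \<otimes> N Z)) \<bullet> smap S (ident X \<odot> k))) \<bullet> str_step X Y (dest Y)"
      unfolding Q' using assms Y k n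
      by (simp add: str_step_def n_def [symmetric] ident_product_comp comp_assoc)
        (simp add: res_simps W_def)
    finally show ?thesis .
  qed
  have "ext R (X \<otimes> Z) (str R X Z \<bullet> (ident X \<odot> f)) \<bullet> str R X Y = str R X Z \<bullet> (ident X \<odot> k)"
    by (rule corec_eqI [of "X \<otimes> Z" _ "dest (X \<otimes> Z) \<bullet> str R X Z \<bullet> (ident X \<odot> f)"
          "str_step X Y (dest Y)" _ "X \<otimes> Y"])
      (use assms Y k step in \<open>simp_all add: dest_simps res_simps W_def\<close>)
  then show ?thesis
    by (simp add: Y_def k_def)
qed

end

sublocale resumption \<subseteq> R: strong_monad C R
  by (rule R.strong_monadI)
    (simp_all add: R_ext_eta R_ext_comp_eta R_ext_ext R_str_natural R_str_unit R_str_assoc R_str_eta R_str_ext)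

section \<open>Dinaturality from codiagonal and uniformity\<close>

text \<open>The derivation of dinaturality does not look inside resumptions, so it is carried out
  for any operator with these axioms and instantiated with \<open>R\<close> afterwards.\<close>

locale uniform_iteration = strong_monad C T + iteration_signature C T it
  for C :: "('o, 'm, 'z) bicat_scheme" (structure) and T it +
  assumes iter_unfold: "\<lbrakk>valid f; Y \<in> Ob C; trg f = TOb T (Y \<oplus> src f)\<rbrakk> \<Longrightarrow>
      ext T Y (eta T Y \<amalg> iter T it Y f) \<bullet> f = iter T it Y f"
    and iter_codiag: "\<lbrakk>valid g; Y \<in> Ob C; trg g = TOb T ((Y \<oplus> src g) \<oplus> src g)\<rbrakk> \<Longrightarrow>
      iter T it Y (tmap T (ident (Y \<oplus> src g) \<amalg> inr Y (src g)) \<bullet> g) =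
      iter T it Y (iter T it (Y \<oplus> src g) g)"
    and iter_uniform: "\<lbrakk>valid f; valid g; valid h; Y \<in> Ob C; trg f = TOb T (Y \<oplus> src f);
        trg g = TOb T (Y \<oplus> src g); src h = src g; trg h = src f;
        f \<bullet> h = tmap T (ident Y \<uplus> h) \<bullet> g\<rbrakk> \<Longrightarrow>
      iter T it Y f \<bullet> h = iter T it Y g"
begin

text \<open>
  Both sides arise from the iterate of the combined map \<open>m\<close> on \<open>X \<oplus> Z\<close>: by codiagonal, \<open>m\<close> can
  be iterated by first unrolling the calls to \<open>Z\<close> only, which leaves a map on \<open>X\<close>, or vice versa.
\<close>

lemma dinaturality:
  assumes "valid g" "valid h" "Y \<in> Ob C" "trg g = TOb T (Y \<oplus> src h)" "trg h = TOb T (Y \<oplus> src g)"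
  shows "iter T it Y (ext T (Y \<oplus> src g) ((eta T (Y \<oplus> src g) \<bullet> inl Y (src g)) \<amalg> h) \<bullet> g) =
      ext T Y (eta T Y \<amalg> iter T it Y
        (ext T (Y \<oplus> src h) ((eta T (Y \<oplus> src h) \<bullet> inl Y (src h)) \<amalg> g) \<bullet> h)) \<bullet> g"
proof -
  define X Z where "X = src g" and "Z = src h"
  define W where "W = X \<oplus> Z"
  define a b where "a = inl X Z" and "b = inr X Z"
  have XZ: "X \<in> Ob C" "Z \<in> Ob C" "src g = X" "src h = Z" "trg g = TOb T (Y \<oplus> Z)" "trg h = TOb T (Y \<oplus> X)"
    and W: "W \<in> Ob C"
    using assms by (auto simp: X_def Z_def W_def)
  have ab: "valid a" "valid b" "src a = X" "src b = Z" "trg a = W" "trg b = W"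
    using XZ by (simp_all add: a_def b_def W_def)
  note [simp] = assms(1-3) XZ W ab
  define m where "m = (tmap T (ident Y \<uplus> b) \<bullet> g) \<amalg> (tmap T (ident Y \<uplus> a) \<bullet> h)"
  have m: "valid m" "src m = W" "trg m = TOb T (Y \<oplus> W)"
    by (simp_all add: m_def) (simp add: W_def)
  have m_ab: "m \<bullet> a = tmap T (ident Y \<uplus> b) \<bullet> g" "m \<bullet> b = tmap T (ident Y \<uplus> a) \<bullet> h"
    by (simp_all add: m_def a_def b_def cotuple_inl cotuple_inr)
  \<comment> \<open>Codiagonal followed by uniformity along \<open>c\<close>: \<open>e\<close> sends
    the calls to be unrolled to the outer copy of \<open>W\<close>, and \<open>l\<close> is what the
    unrolling leaves on the source of \<open>c\<close>.\<close>
  have split: "iter T it Y m \<bullet> c = iter T it Y l"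
    if e: "valid e" "src e = W" "trg e = TOb T ((Y \<oplus> W) \<oplus> W)"
      and "tmap T (ident (Y \<oplus> W) \<amalg> inr Y W) \<bullet> e = m"
      and "iter T it (Y \<oplus> W) e \<bullet> c = tmap T (ident Y \<uplus> c) \<bullet> l"
      and "valid c" "trg c = W" "valid l" "src l = src c" "trg l = TOb T (Y \<oplus> src l)" for e c l
  proof -
    have "iter T it Y m = iter T it Y (iter T it (Y \<oplus> W) e)"
      using iter_codiag [of e Y] that(1-4) by simp
    also have "\<dots> \<bullet> c = iter T it Y l"
      by (rule iter_uniform) (use that in simp_all)
    finally show ?thesis .
  qed
  have cotuple_a: "(p \<amalg> q) \<bullet> a = p" and cotuple_b: "(p \<amalg> q) \<bullet> b = q"
    if "valid p" "valid q" "src p = X" "src q = Z" "trg p = trg q" for p q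
    using that by (simp_all add: a_def b_def cotuple_inl cotuple_inr)
  have ma: "iter T it Y m \<bullet> a =
    iter T it Y (ext T (Y \<oplus> X) ((eta T (Y \<oplus> X) \<bullet> inl Y X) \<amalg> h) \<bullet> g)"
  proof (rule split)
    \<comment> \<open>Calls of \<open>g\<close> to \<open>Z\<close> go to the outer copy of
      \<open>W\<close>, calls of \<open>h\<close> to \<open>X\<close> go to the inner one. Iterating
      the outer copy thus replaces each call to \<open>Z\<close> by \<open>h\<close>.\<close>
    let ?e = "(tmap T ((inl (Y \<oplus> W) W \<bullet> inl Y W) \<amalg> (inr (Y \<oplus> W) W \<bullet> b)) \<bullet> g) \<amalg>
      (tmap T (inl (Y \<oplus> W) W \<bullet> (ident Y \<uplus> a)) \<bullet> h)"
    show e: "valid ?e" "src ?e = W" "trg ?e = TOb T ((Y \<oplus> W) \<oplus> W)"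
      by (simp_all add: W_def [symmetric])
    show "tmap T (ident (Y \<oplus> W) \<amalg> inr Y W) \<bullet> ?e = m"
      by (simp add: m_def kleisli_simps)
    have unf: "iter T it (Y \<oplus> W) ?e \<bullet> c =
        ext T (Y \<oplus> W) (eta T (Y \<oplus> W) \<amalg> iter T it (Y \<oplus> W) ?e) \<bullet> ?e \<bullet> c" for c
      using iter_unfold [OF e(1), of "Y \<oplus> W"] e by (simp flip: comp_assoc)
    have "iter T it (Y \<oplus> W) ?e \<bullet> b = tmap T (ident Y \<uplus> a) \<bullet> h"
      unfolding unf using e by (simp add: cotuple_b) (simp add: kleisli_simps)
    then show "iter T it (Y \<oplus> W) ?e \<bullet> a =
      tmap T (ident Y \<uplus> a) \<bullet> ext T (Y \<oplus> X) ((eta T (Y \<oplus> X) \<bullet> inl Y X) \<amalg> h) \<bullet> g"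
      unfolding unf [of a] using e by (simp add: cotuple_a) (simp add: kleisli_simps)
  qed simp_all
  have mb: "iter T it Y m \<bullet> b =
    iter T it Y (ext T (Y \<oplus> Z) ((eta T (Y \<oplus> Z) \<bullet> inl Y Z) \<amalg> g) \<bullet> h)"
  proof (rule split)
    \<comment> \<open>The mirror image: the calls to \<open>X\<close> are now unrolled.\<close>
    let ?e = "(tmap T (inl (Y \<oplus> W) W \<bullet> (ident Y \<uplus> b)) \<bullet> g) \<amalg>
      (tmap T ((inl (Y \<oplus> W) W \<bullet> inl Y W) \<amalg> (inr (Y \<oplus> W) W \<bullet> a)) \<bullet> h)"
    show e: "valid ?e" "src ?e = W" "trg ?e = TOb T ((Y \<oplus> W) \<oplus> W)"
      by (simp_all add: W_def [symmetric])
    show "tmap T (ident (Y \<oplus> W) \<amalg> inr Y W) \<bullet> ?e = m"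
      by (simp add: m_def kleisli_simps)
    have unf: "iter T it (Y \<oplus> W) ?e \<bullet> c =
        ext T (Y \<oplus> W) (eta T (Y \<oplus> W) \<amalg> iter T it (Y \<oplus> W) ?e) \<bullet> ?e \<bullet> c" for c
      using iter_unfold [OF e(1), of "Y \<oplus> W"] e by (simp flip: comp_assoc)
    have "iter T it (Y \<oplus> W) ?e \<bullet> a = tmap T (ident Y \<uplus> b) \<bullet> g"
      unfolding unf using e by (simp add: cotuple_a) (simp add: kleisli_simps)
    then show "iter T it (Y \<oplus> W) ?e \<bullet> b =
      tmap T (ident Y \<uplus> b) \<bullet> ext T (Y \<oplus> Z) ((eta T (Y \<oplus> Z) \<bullet> inl Y Z) \<amalg> g) \<bullet> h"
      unfolding unf [of b] using e by (simp add: cotuple_b) (simp add: kleisli_simps)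
  qed simp_all
  \<comment> \<open>One unfolding of \<open>m\<close> at \<open>X\<close> calls only
    \<open>Z\<close>, which links the two restrictions.\<close>
  have "iter T it Y m \<bullet> a = ext T Y (eta T Y \<amalg> iter T it Y m) \<bullet> m \<bullet> a"
    using iter_unfold [of m Y] m by (simp flip: comp_assoc)
  also have "\<dots> = ext T Y (eta T Y \<amalg> (iter T it Y m \<bullet> b)) \<bullet> g"
    using m unfolding m_ab by (simp add: kleisli_simps)
  finally show ?thesis
    unfolding ma mb by simp
qed

end

section \<open>Iteration in the resumption monad\<close>

context complete_elgot_monad
begin

text \<open>Naturality at a map without effects, \<open>eta T (trg g) \<bullet> g\<close>.\<close>

lemma iter_tmap:
  assumes "valid f" "valid g" "Y \<in> Ob C" "trg f = TOb T (Y \<oplus> src f)" "src g = Y"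
  shows "tmap T g \<bullet> iter T it Y f = iter T it (trg g) (tmap T (g \<uplus> ident (src f)) \<bullet> f)"
  using assms iter_naturality [of f "eta T (trg g) \<bullet> g" Y "trg g"]
  by (simp add: tmap_def [of T g]) (simp add: kleisli_simps)

text \<open>A loop body that makes no recursive call is returned by one unfolding.\<close>

lemma iter_tmap_inl:
  assumes "valid u" "Y \<in> Ob C" "trg u = TOb T Y"
  shows "iter T it Y (tmap T (inl Y (src u)) \<bullet> u) = u"
  using assms by (subst iter_unfolding [symmetric]) (simp_all add: kleisli_simps)

end

context resumption
begin

text \<open>Iteration in \<open>T\<close> acts on the last summand. The exchange puts the recursive
  calls \<open>X\<close> there, and the \<Sigma>-terms \<open>D\<close> join the outputs.\<close>

definition rearr :: "'o \<Rightarrow> 'o \<Rightarrow> 'o \<Rightarrow> ('o, 'm) arrow" where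
  "rearr Y X D = ((inl (Y \<oplus> D) X \<bullet> inl Y D) \<amalg> inr (Y \<oplus> D) X) \<amalg> (inl (Y \<oplus> D) X \<bullet> inr Y D)"

lemma src_rearr [simp]: "src (rearr Y X D) = (Y \<oplus> X) \<oplus> D"
  and trg_rearr [simp]: "trg (rearr Y X D) = (Y \<oplus> D) \<oplus> X"
  and valid_rearr [simp]: "\<lbrakk>X \<in> Ob C; Y \<in> Ob C; D \<in> Ob C\<rbrakk> \<Longrightarrow> valid (rearr Y X D)"
  by (simp_all add: rearr_def)

text \<open>
  \<open>peel Y f\<close> iterates away the unguarded recursive calls of \<open>f\<close>; the remaining ones sit under \<open>\<Sigma>\<close>,
  so that \<open>solves Y (peel Y f) h\<close> determines \<open>h\<close>.
\<close>

definition peel :: "'o \<Rightarrow> ('o, 'm) arrow \<Rightarrow> ('o, 'm) arrow" where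
  "peel Y f = iter T it (Y \<oplus> SN (Y \<oplus> src f))
     (tmap T (rearr Y (src f) (SN (Y \<oplus> src f))) \<bullet> dest (Y \<oplus> src f) \<bullet> f)"

definition solves :: "'o \<Rightarrow> ('o, 'm) arrow \<Rightarrow> ('o, 'm) arrow \<Rightarrow> bool" where
  "solves Y w h \<longleftrightarrow> valid h \<and> src h = src w \<and> trg h = N Y \<and>
     dest Y \<bullet> h = tmap T (ident Y \<uplus> smap S (ext R Y (eta R Y \<amalg> h))) \<bullet> w"

text \<open>For ill-typed \<open>f\<close> the description need not denote; the lemmas below speak
  of typed arguments.\<close>

definition itN :: "'o \<Rightarrow> 'm \<Rightarrow> 'm" where
  "itN Y f = val (THE h. solves Y (peel Y (lift f)) h)"

lemma src_peel [simp]: "src (peel Y f) = src f"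
  and trg_peel [simp]: "trg (peel Y f) = TOb T (Y \<oplus> SN (Y \<oplus> src f))"
  and valid_peel [simp]: "\<lbrakk>valid f; Y \<in> Ob C; trg f = N (Y \<oplus> src f)\<rbrakk> \<Longrightarrow> valid (peel Y f)"
  by (simp_all add: peel_def)

lemma ex1_solves:
  assumes w: "valid w" "trg w = TOb T (Y \<oplus> SN (Y \<oplus> src w))" and Y: "Y \<in> Ob C"
  shows "\<exists>!h. solves Y w h"
proof -
  define X where "X = src w"
  define D where "D = SN (Y \<oplus> X)"
  \<comment> \<open>This structure runs a resumption and substitutes \<open>w\<close> for a returned
    value in \<open>X\<close>.\<close>
  define c where "c = ext T (Y \<oplus> D) (((eta T (Y \<oplus> D) \<bullet> inl Y D) \<amalg> w) \<amalg> (eta T (Y \<oplus> D) \<bullet> inr Y D)) \<bullet>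
    dest (Y \<oplus> X)"
  have X: "X \<in> Ob C" "src w = X" "trg w = TOb T (Y \<oplus> SN (Y \<oplus> X))"
    using w by (auto simp: X_def)
  have c: "valid c" "src c = N (Y \<oplus> X)" "trg c = TOb T (Y \<oplus> D)"
    using w(1) X Y by (simp_all add: c_def D_def)
  have coalg: "dest Y \<bullet> ext R Y (eta R Y \<amalg> h) =
      tmap T (ident Y \<uplus> smap S (ext R Y (eta R Y \<amalg> h))) \<bullet> c"
    if "solves Y w h" for h
    using that w(1) X Y by (simp add: solves_def c_def D_def dest_simps res_simps)
  obtain k where k: "valid k" "src k = N (Y \<oplus> X)" "trg k = N Y"
      "dest Y \<bullet> k = tmap T (ident Y \<uplus> smap S k) \<bullet> c"
    using dest_final [of c Y] c Y unfolding D_def by metis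
  let ?h = "k \<bullet> eta R (Y \<oplus> X) \<bullet> inr Y X"
  \<comment> \<open>On a value in \<open>Y\<close> the structure \<open>c\<close> returns at
    once.\<close>
  have k_eta: "k \<bullet> eta R (Y \<oplus> X) \<bullet> inl Y X = eta R Y"
    by (rule dest_mono [of Y])
      (use w(1) X Y k(1-3) in \<open>simp_all add: k(4) [THEN comp_reassoc] c_def D_def dest_simps res_simps\<close>)
  have h: "valid ?h" "src ?h = X" "trg ?h = N Y" "dest Y \<bullet> ?h = tmap T (ident Y \<uplus> smap S k) \<bullet> w"
    using w(1) X Y k(1-3) by (simp_all add: k(4) [THEN comp_reassoc] c_def D_def dest_simps res_simps)
  \<comment> \<open>The map \<open>k\<close> and the extension of its own restriction solve the same
    corecursion, so \<open>k\<close> arises from a solution.\<close>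
  have k_ext: "k = ext R Y (eta R Y \<amalg> ?h)"
    by (rule corec_eqI [of Y _ "dest Y \<bullet> (eta R Y \<amalg> ?h)" "dest (Y \<oplus> X)" _ "Y \<oplus> X"])
      (use w(1) X Y k(1-3) h in \<open>simp_all add: k(4) c_def D_def dest_simps res_simps\<close>)
  show ?thesis
  proof (rule ex1I [of _ ?h])
    show "solves Y w ?h"
      unfolding solves_def k_ext [symmetric] using h X by simp
    show "h = ?h" if "solves Y w h" for h
    proof -
      have "ext R Y (eta R Y \<amalg> h) = k"
        by (rule dest_final_unique [OF coalg [OF that] k(4)])
          (use that X Y k(1-3) c in \<open>simp_all add: solves_def D_def\<close>)
      \<comment> \<open>A solution is the restriction of its extension, hence determined by
        \<open>k\<close>.\<close>
      moreover have "h = ext R Y (eta R Y \<amalg> h) \<bullet> eta R (Y \<oplus> X) \<bullet> inr Y X"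
        using that X Y by (simp add: solves_def R.kleisli_simps)
      ultimately show ?thesis
        by simp
    qed
  qed
qed

lemma solves_unique:
  assumes "solves Y w h" "solves Y w k" "valid w" "trg w = TOb T (Y \<oplus> SN (Y \<oplus> src w))" "Y \<in> Ob C"
  shows "h = k"
  using ex1_solves [of w Y] assms by blast

lemma solves_itN:
  assumes "valid f" "Y \<in> Ob C" "trg f = N (Y \<oplus> src f)"
  shows "itN Y (val f) \<in> hom C (src f) (N Y)" "solves Y (peel Y f) (lift (itN Y (val f)))"
proof -
  have "solves Y (peel Y f) (THE h. solves Y (peel Y f) h)"
    by (rule theI' [OF ex1_solves]) (use assms in simp_all)
  moreover from this have "valid (THE h. solves Y (peel Y f) h)" "src (THE h. solves Y (peel Y f) h) = src f"
    "trg (THE h. solves Y (peel Y f) h) = N Y"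
    by (simp_all add: solves_def)
  ultimately show "itN Y (val f) \<in> hom C (src f) (N Y)" "solves Y (peel Y f) (lift (itN Y (val f)))"
    using assms by (simp_all add: itN_def hom_def)
qed

end

sublocale resumption \<subseteq> R: iteration_signature C R itN
proof
  show "itN Y f \<in> hom C X (TOb R Y)"
    if "X \<in> Ob C" "Y \<in> Ob C" "f \<in> hom C X (TOb R (Y \<oplus> X))" for X Y f
    using solves_itN(1) [of "lift f" Y] that by (simp add: hom_def)
qed

section \<open>The axioms for the iteration of resumptions\<close>

context resumption
begin

abbreviation dagger :: "'o \<Rightarrow> ('o, 'm) arrow \<Rightarrow> ('o, 'm) arrow" where
  "dagger \<equiv> iter R itN"

lemma dagger_solves:
  assumes "valid f" "Y \<in> Ob C" "trg f = N (Y \<oplus> src f)"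
  shows "solves Y (peel Y f) (dagger Y f)"
proof -
  have "lift (itN Y (val f)) = dagger Y f"
    using assms by (subst lift_val [symmetric]) (simp_all add: R.val_iter)
  then show ?thesis
    using solves_itN(2) [OF assms] by simp
qed

lemma dest_dagger:
  assumes "valid f" "Y \<in> Ob C" "trg f = N (Y \<oplus> src f)"
  shows "dest Y \<bullet> dagger Y f =
    tmap T (ident Y \<uplus> smap S (ext R Y (eta R Y \<amalg> dagger Y f))) \<bullet> peel Y f"
  using dagger_solves [OF assms] by (simp add: solves_def)

text \<open>The rule by which naturality, codiagonal, uniformity and strength are proved: a
  candidate is recognized by the defining equation over \<open>peel Y f\<close>.\<close>

lemma daggerI:
  assumes "dest Y \<bullet> h = tmap T (ident Y \<uplus> smap S (ext R Y (eta R Y \<amalg> h))) \<bullet> peel Y f"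
    "valid h" "src h = src f" "trg h = N Y" "valid f" "Y \<in> Ob C" "trg f = N (Y \<oplus> src f)"
  shows "h = dagger Y f"
  by (rule solves_unique [of Y "peel Y f"]) (use assms dagger_solves in \<open>simp_all add: solves_def\<close>)

text \<open>After \<open>dest\<close>, the left-hand side factors through
  \<open>tmap T (ident Y \<uplus> smap S k)\<close>, and what remains is one unfolding of
  \<open>peel Y f\<close> in \<open>T\<close>.\<close>

lemma dagger_unfolding:
  assumes "valid f" "Y \<in> Ob C" "trg f = N (Y \<oplus> src f)"
  shows "ext R Y (eta R Y \<amalg> dagger Y f) \<bullet> f = dagger Y f"
proof (rule dest_mono [of Y])
  define X D d where "X = src f" and "D = SN (Y \<oplus> X)" and "d = dagger Y f"
  define k P F where "k = ext R Y (eta R Y \<amalg> d)" and "P = peel Y f"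
    and "F = tmap T (rearr Y X D) \<bullet> dest (Y \<oplus> X) \<bullet> f"
  have X: "X \<in> Ob C" "src f = X" "trg f = N (Y \<oplus> X)"
    using assms by (auto simp: X_def)
  have d: "valid d" "src d = X" "trg d = N Y"
    and k: "valid k" "src k = N (Y \<oplus> X)" "trg k = N Y"
    and P: "valid P" "src P = X" "trg P = TOb T (Y \<oplus> D)"
    using assms X by (simp_all add: d_def k_def P_def D_def)
  have d_eq: "dest Y \<bullet> d = tmap T (ident Y \<uplus> smap S k) \<bullet> P"
    using dest_dagger [OF assms] by (simp add: d_def k_def P_def)
  have dest_k: "dest Y \<bullet> k = ext T (Y \<oplus> SN Y) (((eta T (Y \<oplus> SN Y) \<bullet> inl Y (SN Y)) \<amalg> (dest Y \<bullet> d)) \<amalg>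
      (eta T (Y \<oplus> SN Y) \<bullet> inr Y (SN Y) \<bullet> smap S k)) \<bullet> dest (Y \<oplus> X)"
    using assms X d by (simp add: k_def dest_simps comp_cotuple)
  have P_eq: "ext T (Y \<oplus> D) (eta T (Y \<oplus> D) \<amalg> P) \<bullet> F = P"
    using iter_unfolding [of F "Y \<oplus> D"] assms X by (simp add: P_def F_def D_def peel_def)
  have "dest Y \<bullet> k \<bullet> f = tmap T (ident Y \<uplus> smap S k) \<bullet> ext T (Y \<oplus> D) (eta T (Y \<oplus> D) \<amalg> P) \<bullet> F"
    using assms X d k P d_eq dest_k
    by (simp add: comp_reassoc [of "dest Y" k]) (simp add: res_simps F_def D_def rearr_def)
  also have "\<dots> = dest Y \<bullet> d"
    by (simp add: P_eq d_eq)
  finally show "dest Y \<bullet> ext R Y (eta R Y \<amalg> dagger Y f) \<bullet> f = dest Y \<bullet> dagger Y f"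
    by (simp add: k_def d_def)
qed (use assms in simp_all)

text \<open>By naturality in \<open>T\<close>, substituting \<open>g\<close> commutes with peeling
  (\<open>peel_eq\<close>). Under \<Sigma> it remains to see that solving after the substitution is
  substituting after solving (\<open>l1\<close>, \<open>l2\<close>).\<close>

lemma dagger_naturality:
  assumes "valid f" "valid g" "Y \<in> Ob C" "Z \<in> Ob C" "trg f = N (Y \<oplus> src f)" "src g = Y" "trg g = N Z"
  shows "ext R Z g \<bullet> dagger Y f = dagger Z (ext R (Z \<oplus> src f)
    ((tmap R (inl Z (src f)) \<bullet> g) \<amalg> (eta R (Z \<oplus> src f) \<bullet> inr Z (src f))) \<bullet> f)"
proof (rule daggerI)
  define X d where "X = src f" and "d = dagger Y f"
  define k P where "k = ext R Y (eta R Y \<amalg> d)" and "P = peel Y f"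
  define D where "D = SN (Z \<oplus> X)"
  define G where "G = (tmap R (inl Z X) \<bullet> g) \<amalg> (eta R (Z \<oplus> X) \<bullet> inr Z X)"
  define G' where "G' = ext R (Z \<oplus> X) G"
  \<comment> \<open>The substitution on peeled terms: an output in \<open>Y\<close> is replaced by a
    run of \<open>g\<close>, whose result is embedded along \<open>inl Z X\<close>; under \<Sigma>
    the substitution goes on as \<open>G'\<close>.\<close>
  define q where "q = (tmap T (ident Z \<uplus> smap S (tmap R (inl Z X))) \<bullet> dest Z \<bullet> g) \<amalg>
    (eta T (Z \<oplus> D) \<bullet> inr Z D \<bullet> smap S G')"
  define l where "l = ext R Z (eta R Z \<amalg> (ext R Z g \<bullet> d))"
  have X: "X \<in> Ob C" "src f = X" "trg f = N (Y \<oplus> X)"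
    using assms by (auto simp: X_def)
  have d: "valid d" "src d = X" "trg d = N Y"
    and k: "valid k" "src k = N (Y \<oplus> X)" "trg k = N Y"
    and P: "valid P" "src P = X" "trg P = TOb T (Y \<oplus> SN (Y \<oplus> X))"
    and D: "D \<in> Ob C"
    and G: "valid G" "src G = Y \<oplus> X" "trg G = N (Z \<oplus> X)"
    and l: "valid l" "src l = N (Z \<oplus> X)" "trg l = N Z"
    using assms X by (simp_all add: d_def k_def P_def D_def G_def l_def)
  have G': "valid G'" "src G' = N (Y \<oplus> X)" "trg G' = N (Z \<oplus> X)"
    using assms X G by (simp_all add: G'_def)
  have q: "valid q" "src q = Y \<oplus> SN (Y \<oplus> X)" "trg q = TOb T (Z \<oplus> D)"
    using assms X G' D by (simp_all add: q_def) (simp_all add: D_def)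
  have d_eq: "dest Y \<bullet> d = tmap T (ident Y \<uplus> smap S k) \<bullet> P"
    using dest_dagger [of f Y] assms by (simp add: d_def k_def P_def)
  have peel_eq: "peel Z (G' \<bullet> f) = ext T (Z \<oplus> D) q \<bullet> P"
  proof -
    have "dest (Z \<oplus> X) \<bullet> G' = ext T ((Z \<oplus> X) \<oplus> D)
        ((dest (Z \<oplus> X) \<bullet> G) \<amalg> (eta T ((Z \<oplus> X) \<oplus> D) \<bullet> inr (Z \<oplus> X) D \<bullet> smap S G')) \<bullet> dest (Y \<oplus> X)"
      using G X assms by (simp add: G'_def D_def dest_simps)
    moreover have "dest (Z \<oplus> X) \<bullet> G =
        (tmap T (inl Z X \<uplus> smap S (tmap R (inl Z X))) \<bullet> dest Z \<bullet> g) \<amalg>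
        (eta T ((Z \<oplus> X) \<oplus> D) \<bullet> inl (Z \<oplus> X) D \<bullet> inr Z X)"
      using assms X by (simp add: G_def D_def comp_cotuple dest_tmap [THEN comp_reassoc] dest_simps comp_assoc)
    ultimately have "tmap T (rearr Z X D) \<bullet> dest (Z \<oplus> X) \<bullet> G' \<bullet> f =
      ext T ((Z \<oplus> D) \<oplus> X) ((tmap T (inl (Z \<oplus> D) X) \<bullet> q) \<amalg> (eta T ((Z \<oplus> D) \<oplus> X) \<bullet> inr (Z \<oplus> D) X)) \<bullet>
        tmap T (rearr Y X (SN (Y \<oplus> X))) \<bullet> dest (Y \<oplus> X) \<bullet> f"
      using assms X G' D
      by (simp add: comp_reassoc [of "dest (Z \<oplus> X)" G']) (simp add: rearr_def q_def res_simps D_def [symmetric])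
    then show ?thesis
      using assms X G' q D iter_naturality [of "tmap T (rearr Y X (SN (Y \<oplus> X))) \<bullet> dest (Y \<oplus> X) \<bullet> f" q
          "Y \<oplus> SN (Y \<oplus> X)" "Z \<oplus> D"]
      by (simp add: P_def peel_def D_def [symmetric])
  qed
  \<comment> \<open>Terms that come from \<open>g\<close> contain no recursive calls, so solving
    leaves them alone.\<close>
  have l1: "l \<bullet> tmap R (inl Z X) = ident (N Z)"
    and l2: "l \<bullet> G' = ext R Z g \<bullet> k"
    using assms X d by (simp_all add: l_def G'_def G_def k_def R.kleisli_simps)
  have "dest Z \<bullet> ext R Z g \<bullet> d = tmap T (ident Z \<uplus> smap S l) \<bullet> ext T (Z \<oplus> D) q \<bullet> P"
    using assms X d k P l G' D
    by (simp add: dest_simps d_eq comp_assoc) (simp add: q_def res_simps l1 l2 D_def [symmetric])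
  then show "dest Z \<bullet> ext R Z g \<bullet> dagger Y f =
    tmap T (ident Z \<uplus> smap S (ext R Z (eta R Z \<amalg> (ext R Z g \<bullet> dagger Y f)))) \<bullet>
    peel Z (ext R (Z \<oplus> src f)
      ((tmap R (inl Z (src f)) \<bullet> g) \<amalg> (eta R (Z \<oplus> src f) \<bullet> inr Z (src f))) \<bullet> f)"
    using peel_eq by (simp add: l_def d_def G'_def G_def X_def)
qed (use assms in simp_all)

text \<open>Both peelings come from one iterate \<open>v\<close> in \<open>T\<close> that treats the
  two copies of \<open>X\<close> alike. They differ only under \<Sigma>, where \<open>j\<close>
  merges the copies and \<open>k\<close> solves the inner loop; after \<open>l\<close> has solved
  the outer loop the difference is gone.\<close>

lemma dagger_codiagonal:
  assumes "valid g" "Y \<in> Ob C" "trg g = N ((Y \<oplus> src g) \<oplus> src g)"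
  shows "dagger Y (tmap R (ident (Y \<oplus> src g) \<amalg> inr Y (src g)) \<bullet> g) = dagger Y (dagger (Y \<oplus> src g) g)"
proof (rule daggerI [symmetric])
  define X D E d where "X = src g" and "D = SN ((Y \<oplus> X) \<oplus> X)" and "E = SN (Y \<oplus> X)"
    and "d = dagger (Y \<oplus> X) g"
  define h where "h = dagger Y d"
  define k l where "k = ext R (Y \<oplus> X) (eta R (Y \<oplus> X) \<amalg> d)" and "l = ext R Y (eta R Y \<amalg> h)"
  define j where "j = tmap R (ident (Y \<oplus> X) \<amalg> inr Y X)"
  define P where "P = peel (Y \<oplus> X) g"
  define F where "F = tmap T (rearr (Y \<oplus> X) X D) \<bullet> dest ((Y \<oplus> X) \<oplus> X) \<bullet> g"
  define v where "v = iter T it (Y \<oplus> D) (tmap T (rearr Y X D) \<bullet> tmap T ((ident (Y \<oplus> X) \<amalg> inr Y X) \<uplus> ident D) \<bullet>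
    dest ((Y \<oplus> X) \<oplus> X) \<bullet> g)"
  have X: "X \<in> Ob C" "src g = X" "trg g = N ((Y \<oplus> X) \<oplus> X)"
    using assms by (auto simp: X_def)
  have DE: "D \<in> Ob C" "E \<in> Ob C" "SN ((Y \<oplus> X) \<oplus> X) = D" "SN (Y \<oplus> X) = E"
    using assms X by (simp_all add: D_def E_def)
  have d: "valid d" "src d = X" "trg d = N (Y \<oplus> X)"
    using assms X by (simp_all add: d_def)
  have h: "valid h" "src h = X" "trg h = N Y"
    using assms X d by (simp_all add: h_def)
  have k: "valid k" "src k = N ((Y \<oplus> X) \<oplus> X)" "trg k = N (Y \<oplus> X)"
    and l: "valid l" "src l = N (Y \<oplus> X)" "trg l = N Y"
    and j: "valid j" "src j = N ((Y \<oplus> X) \<oplus> X)" "trg j = N (Y \<oplus> X)"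
    and P: "valid P" "src P = X" "trg P = TOb T ((Y \<oplus> X) \<oplus> D)"
    and F: "valid F" "src F = X" "trg F = TOb T (((Y \<oplus> X) \<oplus> D) \<oplus> X)"
    using assms X d h DE by (simp_all add: k_def l_def j_def P_def F_def)
  have v: "valid v" "src v = X" "trg v = TOb T (Y \<oplus> D)"
    using assms X DE by (simp_all add: v_def)
  have d_eq: "dest (Y \<oplus> X) \<bullet> d = tmap T (ident (Y \<oplus> X) \<uplus> smap S k) \<bullet> P"
    using dest_dagger [of g "Y \<oplus> X"] assms X by (simp add: d_def k_def P_def)
  have h_eq: "dest Y \<bullet> h = tmap T (ident Y \<uplus> smap S l) \<bullet> peel Y d"
    using dest_dagger [of d Y] assms X d by (simp add: h_def l_def)
  have P_eq: "P = iter T it ((Y \<oplus> X) \<oplus> D) F"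
    using X DE by (simp add: P_def F_def peel_def)
  have peel_f: "peel Y (j \<bullet> g) = tmap T (ident Y \<uplus> smap S j) \<bullet> v"
  proof -
    have "dest (Y \<oplus> X) \<bullet> j = tmap T ((ident (Y \<oplus> X) \<amalg> inr Y X) \<uplus> smap S j) \<bullet> dest ((Y \<oplus> X) \<oplus> X)"
      using assms X by (simp add: j_def dest_tmap)
    then have "tmap T (rearr Y X E) \<bullet> dest (Y \<oplus> X) \<bullet> j \<bullet> g = tmap T ((ident Y \<uplus> smap S j) \<uplus> ident X) \<bullet>
       tmap T (rearr Y X D) \<bullet> tmap T ((ident (Y \<oplus> X) \<amalg> inr Y X) \<uplus> ident D) \<bullet> dest ((Y \<oplus> X) \<oplus> X) \<bullet> g"
      using assms X DE j
      by (simp add: comp_reassoc [of "dest (Y \<oplus> X)" j]) (simp add: rearr_def res_simps)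
    then show ?thesis
      using assms X DE j
      by (simp add: v_def iter_tmap peel_def)
  qed
  have peel_d: "peel Y d = tmap T (ident Y \<uplus> smap S k) \<bullet> v"
  proof -
    have "peel Y d = iter T it (Y \<oplus> E) (tmap T ((ident Y \<uplus> smap S k) \<uplus> ident X) \<bullet> tmap T (rearr Y X D) \<bullet> P)"
    proof -
      have "tmap T (rearr Y X E) \<bullet> dest (Y \<oplus> X) \<bullet> d =
        tmap T ((ident Y \<uplus> smap S k) \<uplus> ident X) \<bullet> tmap T (rearr Y X D) \<bullet> P"
        unfolding d_eq using assms X DE d k P by (simp add: rearr_def res_simps)
      then show ?thesis
        using d DE by (simp add: peel_def)
    qed
    also have "\<dots> = tmap T (ident Y \<uplus> smap S k) \<bullet> iter T it (Y \<oplus> D) (tmap T (rearr Y X D) \<bullet> P)"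
      using assms X DE P k by (simp add: iter_tmap)
    also have "tmap T (rearr Y X D) \<bullet> P =
        iter T it ((Y \<oplus> D) \<oplus> X) (tmap T (rearr Y X D \<uplus> ident X) \<bullet> F)"
      using assms X DE F by (simp add: P_eq iter_tmap)
    \<comment> \<open>The inner loop is itself an iterate in \<open>T\<close> by now, so the
      codiagonal law of \<open>T\<close> merges the two loops.\<close>
    also have "iter T it (Y \<oplus> D) \<dots> =
      iter T it (Y \<oplus> D) (tmap T (ident ((Y \<oplus> D) \<oplus> X) \<amalg> inr (Y \<oplus> D) X) \<bullet>
        tmap T (rearr Y X D \<uplus> ident X) \<bullet> F)"
      using assms X DE F iter_codiagonal [of "tmap T (rearr Y X D \<uplus> ident X) \<bullet> F" "Y \<oplus> D"] by simp
    also have "tmap T (ident ((Y \<oplus> D) \<oplus> X) \<amalg> inr (Y \<oplus> D) X) \<bullet> tmap T (rearr Y X D \<uplus> ident X) \<bullet> F =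
      tmap T (rearr Y X D) \<bullet> tmap T ((ident (Y \<oplus> X) \<amalg> inr Y X) \<uplus> ident D) \<bullet> dest ((Y \<oplus> X) \<oplus> X) \<bullet> g"
      using assms X DE by (simp add: F_def rearr_def res_simps)
    finally show ?thesis
      by (simp add: v_def)
  qed
  \<comment> \<open>Unfolding of the outer iterate: calls that the inner loop has already resolved
    to \<open>d\<close> end in \<open>h\<close> as well.\<close>
  have "l \<bullet> d = h"
    using dagger_unfolding [of d Y] assms d by (simp add: l_def h_def)
  then have lk: "l \<bullet> k = l \<bullet> j"
    using assms X d h by (simp add: l_def k_def j_def R.kleisli_simps)
  have "dest Y \<bullet> h = tmap T (ident Y \<uplus> smap S l) \<bullet> peel Y (j \<bullet> g)"
    unfolding h_eq peel_f peel_d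
    using assms X l k j v DE by (simp add: res_simps lk)
  then show "dest Y \<bullet> dagger Y (dagger (Y \<oplus> src g) g) =
    tmap T (ident Y \<uplus> smap S (ext R Y (eta R Y \<amalg> dagger Y (dagger (Y \<oplus> src g) g)))) \<bullet>
    peel Y (tmap R (ident (Y \<oplus> src g) \<amalg> inr Y (src g)) \<bullet> g)"
    by (simp add: h_def l_def j_def d_def X_def)
qed (use assms in simp_all)

text \<open>Uniformity of \<open>T\<close> carries \<open>peel Y g\<close> along \<open>h\<close>,
  up to \<open>j\<close> under \<Sigma> (\<open>peel_h\<close>); and \<open>j\<close> followed by
  solving with \<open>d\<close> is solving with \<open>d \<bullet> h\<close>
  (\<open>kj\<close>).\<close>

lemma dagger_uniformity:
  assumes "valid f" "valid g" "valid h" "Y \<in> Ob C" "trg f = N (Y \<oplus> src f)"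
    "trg g = N (Y \<oplus> src g)" "src h = src g" "trg h = src f" "f \<bullet> h = tmap R (ident Y \<uplus> h) \<bullet> g"
  shows "dagger Y f \<bullet> h = dagger Y g"
proof (rule daggerI)
  define X Z d where "X = src f" and "Z = src g" and "d = dagger Y f"
  define D E where "D = SN (Y \<oplus> Z)" and "E = SN (Y \<oplus> X)"
  define k l j where "k = ext R Y (eta R Y \<amalg> d)" and "l = ext R Y (eta R Y \<amalg> (d \<bullet> h))"
    and "j = tmap R (ident Y \<uplus> h)"
  have X: "X \<in> Ob C" "Z \<in> Ob C" "src f = X" "src g = Z" "src h = Z" "trg h = X"
      "trg f = N (Y \<oplus> X)" "trg g = N (Y \<oplus> Z)"
    using assms by (auto simp: X_def Z_def)
  have DE: "D \<in> Ob C" "E \<in> Ob C" "SN (Y \<oplus> Z) = D" "SN (Y \<oplus> X) = E"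
    using assms X by (simp_all add: D_def E_def)
  have d: "valid d" "src d = X" "trg d = N Y"
    using assms X by (simp_all add: d_def)
  have k: "valid k" "src k = N (Y \<oplus> X)" "trg k = N Y"
    and j: "valid j" "src j = N (Y \<oplus> Z)" "trg j = N (Y \<oplus> X)"
    and l: "valid l" "src l = N (Y \<oplus> Z)" "trg l = N Y"
    using assms(1-4) X d by (simp_all add: k_def j_def l_def)
  have d_eq: "dest Y \<bullet> d = tmap T (ident Y \<uplus> smap S k) \<bullet> peel Y f"
    using dest_dagger [of f Y] assms by (simp add: d_def k_def)
  have peel_h: "peel Y f \<bullet> h = tmap T (ident Y \<uplus> smap S j) \<bullet> peel Y g"
  proof -
    have fh: "f \<bullet> h = j \<bullet> g"
      using assms(9) by (simp add: j_def)
    have "dest (Y \<oplus> X) \<bullet> j = tmap T ((ident Y \<uplus> h) \<uplus> smap S j) \<bullet> dest (Y \<oplus> Z)"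
      using assms(1-4) X by (simp add: j_def dest_tmap)
    then have "(tmap T (rearr Y X E) \<bullet> dest (Y \<oplus> X) \<bullet> f) \<bullet> h = tmap T (ident (Y \<oplus> E) \<uplus> h) \<bullet>
      tmap T ((ident Y \<uplus> smap S j) \<uplus> ident Z) \<bullet> tmap T (rearr Y Z D) \<bullet> dest (Y \<oplus> Z) \<bullet> g"
      using assms(1-4) X DE j
      by (simp add: comp_assoc fh comp_reassoc [of "dest (Y \<oplus> X)" j]) (simp add: rearr_def res_simps)
    then have "peel Y f \<bullet> h = iter T it (Y \<oplus> E) (tmap T ((ident Y \<uplus> smap S j) \<uplus> ident Z) \<bullet>
      tmap T (rearr Y Z D) \<bullet> dest (Y \<oplus> Z) \<bullet> g)"
      unfolding peel_def X DE
      by (rule iter_uniformity) (use assms(1-4) X DE j in simp_all)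
    also have "\<dots> = tmap T (ident Y \<uplus> smap S j) \<bullet> peel Y g"
      using assms(1-4) X DE j by (simp add: peel_def iter_tmap)
    finally show ?thesis .
  qed
  have kj: "k \<bullet> j = l"
    using assms(1-4) X d by (simp add: k_def j_def l_def R.kleisli_simps)
  have "dest Y \<bullet> d \<bullet> h = tmap T (ident Y \<uplus> smap S l) \<bullet> peel Y g"
    using assms(1-4) X DE k j l d
    by (simp add: comp_reassoc [OF d_eq] comp_assoc peel_h) (simp add: res_simps kj)
  then show "dest Y \<bullet> dagger Y f \<bullet> h =
    tmap T (ident Y \<uplus> smap S (ext R Y (eta R Y \<amalg> (dagger Y f \<bullet> h)))) \<bullet> peel Y g"
    by (simp add: d_def l_def)
qed (use assms in simp_all)

lemma rearr_injections:
  assumes "X \<in> Ob C" "Y \<in> Ob C" "D \<in> Ob C"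
  shows "rearr Y X D \<bullet> inl (Y \<oplus> X) D \<bullet> inl Y X = inl (Y \<oplus> D) X \<bullet> inl Y D"
    and "rearr Y X D \<bullet> inl (Y \<oplus> X) D \<bullet> inr Y X = inr (Y \<oplus> D) X"
    and "rearr Y X D \<bullet> inr (Y \<oplus> X) D = inl (Y \<oplus> D) X \<bullet> inr Y D"
  using assms by (simp_all add: rearr_def cotuple_inl cotuple_inr cotuple_inl_assoc)

text \<open>A coherence checked on the three summands \<open>Y\<close>, \<open>X\<close> and
  \<open>D\<close>. It lets the strength of \<open>T\<close> pass the exchange of summands inside
  \<open>peel\<close>.\<close>

lemma rearr_distr:
  assumes "X \<in> Ob C" "Y \<in> Ob C" "Z \<in> Ob C" "D \<in> Ob C"
  shows "(distr Z Y D \<uplus> ident (Z \<otimes> X)) \<bullet> distr Z (Y \<oplus> D) X \<bullet> (ident Z \<odot> rearr Y X D) =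
    rearr (Z \<otimes> Y) (Z \<otimes> X) (Z \<otimes> D) \<bullet> (distr Z Y X \<uplus> ident (Z \<otimes> D)) \<bullet> distr Z (Y \<oplus> X) D"
    (is "?l = ?r")
proof (rule distr_eqI [of _ Z "Y \<oplus> X" D])
  have rearr: "(ident Z \<odot> rearr Y X D) \<bullet> (ident Z \<odot> inl (Y \<oplus> X) D) \<bullet> (ident Z \<odot> inl Y X) =
      (ident Z \<odot> inl (Y \<oplus> D) X) \<bullet> (ident Z \<odot> inl Y D)"
    "(ident Z \<odot> rearr Y X D) \<bullet> (ident Z \<odot> inl (Y \<oplus> X) D) \<bullet> (ident Z \<odot> inr Y X) =
      ident Z \<odot> inr (Y \<oplus> D) X"
    "(ident Z \<odot> rearr Y X D) \<bullet> (ident Z \<odot> inr (Y \<oplus> X) D) =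
      (ident Z \<odot> inl (Y \<oplus> D) X) \<bullet> (ident Z \<odot> inr Y D)"
    using assms by (simp_all add: product_map_comp rearr_injections)
  note distr_simps = distr_inl distr_inr distr_inl [THEN comp_reassoc] distr_inr [THEN comp_reassoc]
    coproduct_map_inl [THEN comp_reassoc] coproduct_map_inr [THEN comp_reassoc]
  show "?l \<bullet> (ident Z \<odot> inl (Y \<oplus> X) D) = ?r \<bullet> (ident Z \<odot> inl (Y \<oplus> X) D)"
    by (rule distr_eqI [of _ Z Y X])
      (use assms in \<open>simp_all add: comp_assoc rearr distr_simps rearr_injections\<close>)
  show "?l \<bullet> (ident Z \<odot> inr (Y \<oplus> X) D) = ?r \<bullet> (ident Z \<odot> inr (Y \<oplus> X) D)"
    using assms by (simp add: comp_assoc rearr distr_simps rearr_injections)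
qed (use assms in simp_all)

text \<open>Both sides factor through the iterate of \<open>G\<close>, the loop body with
  \<open>Z\<close> carried along. The maps under \<Sigma> agree because strength commutes with the
  extension of a solution (\<open>kl\<close>).\<close>

lemma dagger_strength:
  assumes "valid f" "Y \<in> Ob C" "Z \<in> Ob C" "trg f = N (Y \<oplus> src f)"
  shows "str R Z Y \<bullet> (ident Z \<odot> dagger Y f) =
    dagger (Z \<otimes> Y) (tmap R (distr Z Y (src f)) \<bullet> str R Z (Y \<oplus> src f) \<bullet> (ident Z \<odot> f))"
proof (rule daggerI)
  define X d where "X = src f" and "d = dagger Y f"
  define D E V where "D = SN (Y \<oplus> X)" and "E = SN (Z \<otimes> Y \<oplus> Z \<otimes> X)" and "V = Z \<otimes> Y"
  define k where "k = ext R Y (eta R Y \<amalg> d)"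
  define h where "h = str R Z Y \<bullet> (ident Z \<odot> d)"
  define l where "l = ext R V (eta R V \<amalg> h)"
  define P where "P = peel Y f"
  define s where "s = tmap R (distr Z Y X) \<bullet> str R Z (Y \<oplus> X)"
  define G where "G = tmap T (rearr V (Z \<otimes> X) (Z \<otimes> D)) \<bullet> tmap T (distr Z Y X \<uplus> ident (Z \<otimes> D)) \<bullet>
    tmap T (distr Z (Y \<oplus> X) D) \<bullet> str T Z ((Y \<oplus> X) \<oplus> D) \<bullet> (ident Z \<odot> (dest (Y \<oplus> X) \<bullet> f))"
  have X: "X \<in> Ob C" "src f = X" "trg f = N (Y \<oplus> X)"
    using assms by (auto simp: X_def)
  have DE: "D \<in> Ob C" "E \<in> Ob C" "V \<in> Ob C" "SN (Y \<oplus> X) = D" "SN (V \<oplus> Z \<otimes> X) = E" "Z \<otimes> Y = V"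
    using assms X by (simp_all add: D_def E_def V_def)
  have d: "valid d" "src d = X" "trg d = N Y"
    using assms X by (simp_all add: d_def)
  have k: "valid k" "src k = N (Y \<oplus> X)" "trg k = N Y"
    and h: "valid h" "src h = Z \<otimes> X" "trg h = N V"
    and P: "valid P" "src P = X" "trg P = TOb T (Y \<oplus> D)"
    and s: "valid s" "src s = Z \<otimes> N (Y \<oplus> X)" "trg s = N (V \<oplus> Z \<otimes> X)"
    and G: "valid G" "src G = Z \<otimes> X" "trg G = TOb T ((V \<oplus> Z \<otimes> D) \<oplus> Z \<otimes> X)"
    using assms X d DE by (simp_all add: k_def h_def P_def s_def G_def)
  have l: "valid l" "src l = N (V \<oplus> Z \<otimes> X)" "trg l = N V"
    using h DE by (simp_all add: l_def)
  have d_eq: "dest Y \<bullet> d = tmap T (ident Y \<uplus> smap S k) \<bullet> P"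
    using dest_dagger [of f Y] assms by (simp add: d_def k_def P_def)
  \<comment> \<open>The strength axiom of \<open>T\<close> for the loop in \<open>peel Y f\<close>;
    afterwards \<open>rearr\<close> is moved past the distribution.\<close>
  have peel_str: "tmap T (distr Z Y D) \<bullet> str T Z (Y \<oplus> D) \<bullet> (ident Z \<odot> P) = iter T it (V \<oplus> Z \<otimes> D) G"
  proof -
    let ?F = "tmap T (rearr Y X D) \<bullet> dest (Y \<oplus> X) \<bullet> f"
    have "str T Z (Y \<oplus> D) \<bullet> (ident Z \<odot> P) = iter T it (Z \<otimes> (Y \<oplus> D))
        (tmap T (distr Z (Y \<oplus> D) X) \<bullet> str T Z ((Y \<oplus> D) \<oplus> X) \<bullet> (ident Z \<odot> ?F))"
      using assms X DE iter_strength [of ?F "Y \<oplus> D" Z] by (simp add: P_def peel_def)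
    also have "str T Z ((Y \<oplus> D) \<oplus> X) \<bullet> (ident Z \<odot> ?F) =
        tmap T (ident Z \<odot> rearr Y X D) \<bullet> str T Z ((Y \<oplus> X) \<oplus> D) \<bullet> (ident Z \<odot> (dest (Y \<oplus> X) \<bullet> f))"
      using assms X DE str_natural [of "ident Z" "rearr Y X D", THEN comp_reassoc]
      by (simp add: ident_product_comp comp_assoc)
    finally have "tmap T (distr Z Y D) \<bullet> str T Z (Y \<oplus> D) \<bullet> (ident Z \<odot> P) =
      iter T it (V \<oplus> Z \<otimes> D) (tmap T (distr Z Y D \<uplus> ident (Z \<otimes> X)) \<bullet> tmap T (distr Z (Y \<oplus> D) X) \<bullet>
        tmap T (ident Z \<odot> rearr Y X D) \<bullet> str T Z ((Y \<oplus> X) \<oplus> D) \<bullet> (ident Z \<odot> (dest (Y \<oplus> X) \<bullet> f)))"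
      using assms X DE by (simp add: iter_tmap)
    also have "tmap T (distr Z Y D \<uplus> ident (Z \<otimes> X)) \<bullet> tmap T (distr Z (Y \<oplus> D) X) \<bullet>
        tmap T (ident Z \<odot> rearr Y X D) \<bullet> str T Z ((Y \<oplus> X) \<oplus> D) \<bullet> (ident Z \<odot> (dest (Y \<oplus> X) \<bullet> f)) = G"
      using assms X DE rearr_distr [of X Y Z D]
      by (simp add: G_def tmap_comp tmap_comp [THEN comp_reassoc] comp_assoc)
    finally show ?thesis .
  qed
  \<comment> \<open>The loop body is again \<open>G\<close>, up to a renaming under \<Sigma> that
    \<open>iter_tmap\<close> pulls out of the loop.\<close>
  have peel_f: "peel V (s \<bullet> (ident Z \<odot> f)) =
      tmap T (ident V \<uplus> (smap S s \<bullet> sstr S Z (N (Y \<oplus> X)))) \<bullet> iter T it (V \<oplus> Z \<otimes> D) G"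
  proof -
    have "dest (V \<oplus> Z \<otimes> X) \<bullet> s = tmap T (distr Z Y X \<uplus> (smap S s \<bullet> sstr S Z (N (Y \<oplus> X)))) \<bullet>
        tmap T (distr Z (Y \<oplus> X) D) \<bullet> str T Z ((Y \<oplus> X) \<oplus> D) \<bullet> (ident Z \<odot> dest (Y \<oplus> X))"
      using assms X DE by (simp add: s_def dest_tmap [THEN comp_reassoc] dest_str str_step_def comp_assoc
          tmap_comp tmap_comp [THEN comp_reassoc] coproduct_map_comp coproduct_map_comp [THEN comp_reassoc]
          smap_comp smap_comp_assoc)
    then have "tmap T (rearr V (Z \<otimes> X) E) \<bullet> dest (V \<oplus> Z \<otimes> X) \<bullet> s \<bullet> (ident Z \<odot> f) =
      tmap T (rearr V (Z \<otimes> X) E) \<bullet> tmap T (distr Z Y X \<uplus> (smap S s \<bullet> sstr S Z (N (Y \<oplus> X)))) \<bullet>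
        tmap T (distr Z (Y \<oplus> X) D) \<bullet> str T Z ((Y \<oplus> X) \<oplus> D) \<bullet> (ident Z \<odot> (dest (Y \<oplus> X) \<bullet> f))"
      using assms X DE
      by (simp add: comp_reassoc [of "dest (V \<oplus> Z \<otimes> X)" s] comp_assoc product_map_comp)
    also have "\<dots> = tmap T ((ident V \<uplus> (smap S s \<bullet> sstr S Z (N (Y \<oplus> X)))) \<uplus> ident (Z \<otimes> X)) \<bullet> G"
      using assms X DE s by (simp add: G_def rearr_def res_simps)
    finally show ?thesis
      using assms X DE s G by (simp add: peel_def iter_tmap)
  qed
  have dest_h: "dest V \<bullet> h = tmap T (ident V \<uplus> (smap S (str R Z Y \<bullet> (ident Z \<odot> k)) \<bullet> sstr S Z (N (Y \<oplus> X)))) \<bullet>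
      iter T it (V \<oplus> Z \<otimes> D) G"
  proof -
    have "dest V \<bullet> h = tmap T (ident V \<uplus> smap S (str R Z Y)) \<bullet>
      tmap T ((ident V \<uplus> sstr S Z (N Y)) \<bullet> distr Z Y (SN Y)) \<bullet>
      str T Z (Y \<oplus> SN Y) \<bullet> (ident Z \<odot> tmap T (ident Y \<uplus> smap S k)) \<bullet> (ident Z \<odot> P)"
      using assms X d k P d_eq DE(4)
        ident_product_comp [of Z "tmap T (ident Y \<uplus> smap S k)" P] unfolding h_def V_def
      by (simp add: dest_str [THEN comp_reassoc] str_step_def comp_assoc product_map_comp)
    also have "\<dots> = tmap T (ident V \<uplus> smap S (str R Z Y)) \<bullet>
      tmap T ((ident V \<uplus> sstr S Z (N Y)) \<bullet> distr Z Y (SN Y)) \<bullet>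
      tmap T (ident Z \<odot> (ident Y \<uplus> smap S k)) \<bullet> str T Z (Y \<oplus> D) \<bullet> (ident Z \<odot> P)"
      using assms X k DE str_natural [of "ident Z" "ident Y \<uplus> smap S k", THEN comp_reassoc]
      by (simp add: comp_assoc)
    also have "\<dots> = tmap T ((ident V \<uplus> smap S (str R Z Y)) \<bullet> (ident V \<uplus> sstr S Z (N Y)) \<bullet>
      (distr Z Y (SN Y) \<bullet> (ident Z \<odot> (ident Y \<uplus> smap S k)))) \<bullet> str T Z (Y \<oplus> D) \<bullet> (ident Z \<odot> P)"
      using assms X k P DE by (simp add: tmap_comp [THEN comp_reassoc] comp_assoc)
    also have "distr Z Y (SN Y) \<bullet> (ident Z \<odot> (ident Y \<uplus> smap S k)) =
        (ident V \<uplus> (ident Z \<odot> smap S k)) \<bullet> distr Z Y D"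
      using assms X k DE distr_natural [of "ident Z" "ident Y" "smap S k"] by simp
    also have "(ident V \<uplus> smap S (str R Z Y)) \<bullet> (ident V \<uplus> sstr S Z (N Y)) \<bullet> \<dots> =
        (ident V \<uplus> (smap S (str R Z Y \<bullet> (ident Z \<odot> k)) \<bullet> sstr S Z (N (Y \<oplus> X)))) \<bullet> distr Z Y D"
      using assms X k DE sstr_natural [of "ident Z" k]
      by (simp add: coproduct_map_comp coproduct_map_comp [THEN comp_reassoc] smap_comp [symmetric] comp_assoc)
    also have "tmap T \<dots> \<bullet> str T Z (Y \<oplus> D) \<bullet> (ident Z \<odot> P) =
      tmap T (ident V \<uplus> (smap S (str R Z Y \<bullet> (ident Z \<odot> k)) \<bullet> sstr S Z (N (Y \<oplus> X)))) \<bullet>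
      iter T it (V \<oplus> Z \<otimes> D) G"
      unfolding peel_str [symmetric] using assms X k P DE by (simp add: tmap_comp [THEN comp_reassoc])
    finally show ?thesis .
  qed
  have "ident Z \<odot> (eta R Y \<amalg> d) = ((ident Z \<odot> eta R Y) \<amalg> (ident Z \<odot> d)) \<bullet> distr Z Y X"
    using assms d by (simp add: product_map_cotuple)
  then have kl: "str R Z Y \<bullet> (ident Z \<odot> k) = l \<bullet> s"
    using assms X d h DE R.str_ext [of "eta R Y \<amalg> d" Z Y]
    by (simp add: k_def l_def s_def comp_cotuple comp_cotuple [THEN comp_reassoc] R.str_eta h_def [symmetric])
      (simp add: R.kleisli_simps)
  have "dest V \<bullet> h = tmap T (ident V \<uplus> smap S l) \<bullet> peel V (s \<bullet> (ident Z \<odot> f))"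
    unfolding dest_h peel_f kl using assms X l s G DE by (simp add: res_simps)
  then show "dest (Z \<otimes> Y) \<bullet> str R Z Y \<bullet> (ident Z \<odot> dagger Y f) =
    tmap T (ident (Z \<otimes> Y) \<uplus> smap S (ext R (Z \<otimes> Y) (eta R (Z \<otimes> Y) \<amalg>
      (str R Z Y \<bullet> (ident Z \<odot> dagger Y f))))) \<bullet>
    peel (Z \<otimes> Y) (tmap R (distr Z Y (src f)) \<bullet> str R Z (Y \<oplus> src f) \<bullet> (ident Z \<odot> f))"
    by (simp add: h_def l_def d_def s_def V_def X_def comp_assoc)
qed (use assms in simp_all)

end

sublocale resumption \<subseteq> R: uniform_iteration C R itN
proof (unfold_locales, goal_cases)
  case (3 f g h Y)
  then show ?case
    using dagger_uniformity [of f g h Y] by simp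
qed (simp_all add: dagger_unfolding dagger_codiagonal)

context resumption
begin

theorem complete_elgot_monad_itN: "complete_elgot_monad C R itN"
proof (rule R.complete_elgot_monadI, goal_cases)
  case 1
  show ?case
    by (rule R.strong_monad_axioms)
next
  case 2
  then show ?case
    by (simp add: dagger_unfolding)
next
  case 3
  then show ?case
    by (simp add: dagger_naturality)
next
  case (4 Y g h)
  then show ?case
    using R.dinaturality [of g h Y] by simp
next
  case 5
  then show ?case
    by (simp add: dagger_codiagonal)
next
  case (6 Y f g h)
  then show ?case
    using dagger_uniformity [of f g h Y] by simp
next
  case 7
  then show ?case
    by (simp add: dagger_strength)
qed

section \<open>Guarded maps, extension of the iteration, and uniqueness\<close>

text \<open>Unfolding a guarded \<open>f\<close> substitutes \<open>h\<close> only under \<Sigma>,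
  so after \<open>dest\<close> the fixpoint equation is the one that \<open>solves\<close> demands
  for the witness \<open>u\<close>; \<open>dest\<close> is mono, so both are equivalent.\<close>

lemma solves_iff_fixpoint:
  assumes "dest (Y \<oplus> X) \<bullet> f = tmap T (inl Y X \<uplus> ident (SN (Y \<oplus> X))) \<bullet> u"
    "valid f" "valid u" "valid h" "src f = X" "src u = X" "src h = X" "trg f = N (Y \<oplus> X)"
    "trg u = TOb T (Y \<oplus> SN (Y \<oplus> X))" "trg h = N Y" "Y \<in> Ob C" "X \<in> Ob C"
  shows "solves Y u h \<longleftrightarrow> ext R Y (eta R Y \<amalg> h) \<bullet> f = h"
proof -
  define k where "k = ext R Y (eta R Y \<amalg> h)"
  have k: "valid k" "src k = N (Y \<oplus> X)" "trg k = N Y"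
    using assms(2-) by (simp_all add: k_def)
  have "dest Y \<bullet> k = ext T (Y \<oplus> SN Y) (((eta T (Y \<oplus> SN Y) \<bullet> inl Y (SN Y)) \<amalg> (dest Y \<bullet> h)) \<amalg>
      (eta T (Y \<oplus> SN Y) \<bullet> inr Y (SN Y) \<bullet> smap S k)) \<bullet> dest (Y \<oplus> X)"
    using assms(2-) by (simp add: k_def dest_simps comp_cotuple)
  then have "dest Y \<bullet> k \<bullet> f = tmap T (ident Y \<uplus> smap S k) \<bullet> u"
    using assms k by (simp add: comp_reassoc [of "dest Y" k] comp_assoc) (simp add: res_simps)
  moreover have "k \<bullet> f = h \<longleftrightarrow> dest Y \<bullet> k \<bullet> f = dest Y \<bullet> h"
    using dest_mono [of Y "k \<bullet> f" h] assms k by auto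
  ultimately show ?thesis
    using assms by (auto simp: solves_def k_def)
qed

lemma peel_guarded:
  assumes "dest (Y \<oplus> X) \<bullet> f = tmap T (inl Y X \<uplus> ident (SN (Y \<oplus> X))) \<bullet> u"
    "valid f" "valid u" "src f = X" "src u = X" "trg f = N (Y \<oplus> X)"
    "trg u = TOb T (Y \<oplus> SN (Y \<oplus> X))" "Y \<in> Ob C" "X \<in> Ob C"
  shows "peel Y f = u"
proof -
  have "tmap T (rearr Y X (SN (Y \<oplus> X))) \<bullet> dest (Y \<oplus> X) \<bullet> f = tmap T (inl (Y \<oplus> SN (Y \<oplus> X)) (src u)) \<bullet> u"
    using assms by (simp add: res_simps rearr_def)
  then show ?thesis
    using assms iter_tmap_inl [of u "Y \<oplus> SN (Y \<oplus> X)"] by (simp add: peel_def)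
qed

text \<open>Here \<open>f\<close> makes no \<Sigma> step, so peeling is the whole iteration and the
  map applied under \<Sigma> acts on nothing.\<close>

lemma dagger_extends:
  assumes "dest (Y \<oplus> X) \<bullet> f = tmap T (inl (Y \<oplus> X) (SN (Y \<oplus> X))) \<bullet> g"
    "valid f" "valid g" "src f = X" "src g = X" "trg f = N (Y \<oplus> X)" "trg g = TOb T (Y \<oplus> X)"
    "X \<in> Ob C" "Y \<in> Ob C"
  shows "dest Y \<bullet> dagger Y f = tmap T (inl Y (SN Y)) \<bullet> iter T it Y g"
proof -
  let ?D = "SN (Y \<oplus> X)"
  have "tmap T (rearr Y X ?D) \<bullet> dest (Y \<oplus> X) \<bullet> f = tmap T (inl Y ?D \<uplus> ident X) \<bullet> g"
    using assms by (simp add: res_simps rearr_def)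
  then have peel: "peel Y f = tmap T (inl Y ?D) \<bullet> iter T it Y g"
    using assms by (simp add: peel_def iter_tmap)
  show ?thesis
    using assms(2-) dest_dagger [of f Y] by (simp add: peel) (simp add: res_simps)
qed

text \<open>
  Any iteration on \<open>R\<close> extending that of \<open>T\<close> agrees on \<open>f\<close> and on the guarded map \<open>f'\<close> with
  \<open>dest (Y \<oplus> X) \<bullet> f' = tmap T (inl Y X \<uplus> ident _) \<bullet> peel Y f\<close>: codiagonal splits \<open>f\<close> into an
  iteration inherited from \<open>T\<close>, which computes \<open>peel Y f\<close>, and a guarded one.
\<close>

lemma dagger_unique:
  assumes elgot: "complete_elgot_monad C R it'"
    and extends: "\<And>X Y f g. \<lbrakk>valid f; valid g; src f = X; src g = X; trg f = N (Y \<oplus> X);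
        trg g = TOb T (Y \<oplus> X); X \<in> Ob C; Y \<in> Ob C;
        dest (Y \<oplus> X) \<bullet> f = tmap T (inl (Y \<oplus> X) (SN (Y \<oplus> X))) \<bullet> g\<rbrakk> \<Longrightarrow>
      dest Y \<bullet> iter R it' Y f = tmap T (inl Y (SN Y)) \<bullet> iter T it Y g"
    and f: "valid f" "Y \<in> Ob C" "trg f = N (Y \<oplus> src f)"
  shows "iter R it' Y f = dagger Y f"
proof -
  interpret E: complete_elgot_monad C R it'
    by fact
  define X D where "X = src f" and "D = SN (Y \<oplus> X)"
  have X: "X \<in> Ob C" "src f = X" "trg f = N (Y \<oplus> X)" "D \<in> Ob C" "SN (Y \<oplus> X) = D"
    using f by (auto simp: X_def D_def)
  \<comment> \<open>The loop body with \<Sigma>-terms turned into outputs in \<open>D\<close>. As a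
    map into resumptions it makes no \<Sigma> step, which puts it in reach of
    \<open>extends\<close>.\<close>
  obtain w where w: "valid w" "src w = X" "trg w = N ((Y \<oplus> D) \<oplus> X)"
    "dest ((Y \<oplus> D) \<oplus> X) \<bullet> w = tmap T (inl ((Y \<oplus> D) \<oplus> X) (SN ((Y \<oplus> D) \<oplus> X))) \<bullet>
      tmap T (rearr Y X D) \<bullet> dest (Y \<oplus> X) \<bullet> f"
    using dest_ex1 [of "tmap T (inl ((Y \<oplus> D) \<oplus> X) (SN ((Y \<oplus> D) \<oplus> X))) \<bullet>
      tmap T (rearr Y X D) \<bullet> dest (Y \<oplus> X) \<bullet> f" "(Y \<oplus> D) \<oplus> X"] f X by auto
  \<comment> \<open>A \<Sigma>-term performed as one step of a resumption; through \<open>G\<close>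
    this puts back the layers that \<open>w\<close> has turned into outputs.\<close>
  obtain t where t: "valid t" "src t = D" "trg t = N (Y \<oplus> X)"
    "dest (Y \<oplus> X) \<bullet> t = eta T ((Y \<oplus> X) \<oplus> D) \<bullet> inr (Y \<oplus> X) D"
    using dest_ex1 [of "eta T ((Y \<oplus> X) \<oplus> D) \<bullet> inr (Y \<oplus> X) D" "Y \<oplus> X"] f X by auto
  define G where "G = (eta R (Y \<oplus> X) \<bullet> inl Y X) \<amalg> t"
  have G: "valid G" "src G = Y \<oplus> D" "trg G = N (Y \<oplus> X)"
    using f X t by (simp_all add: G_def)
  have dest_G: "dest (Y \<oplus> X) \<bullet> G = (eta T ((Y \<oplus> X) \<oplus> D) \<bullet> inl (Y \<oplus> X) D \<bullet> inl Y X) \<amalg>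
      (eta T ((Y \<oplus> X) \<oplus> D) \<bullet> inr (Y \<oplus> X) D)"
    using f X t by (simp add: G_def comp_cotuple dest_simps comp_assoc)
  define v where "v = iter R it' (Y \<oplus> D) w"
  have v: "valid v" "src v = X" "trg v = N (Y \<oplus> D)"
    using f X w by (simp_all add: v_def)
  \<comment> \<open>At this point \<open>extends\<close> fixes the loop: under any such iteration it
    computes \<open>peel Y f\<close>.\<close>
  have dest_v: "dest (Y \<oplus> D) \<bullet> v = tmap T (inl (Y \<oplus> D) (SN (Y \<oplus> D))) \<bullet> peel Y f"
    using extends [of w "tmap T (rearr Y X D) \<bullet> dest (Y \<oplus> X) \<bullet> f" X "Y \<oplus> D"] f X w
    by (simp add: v_def peel_def)
  define f' where "f' = ext R (Y \<oplus> X) G \<bullet> v"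
  have f': "valid f'" "src f' = X" "trg f' = N (Y \<oplus> X)"
    using f X G v by (simp_all add: f'_def)
  \<comment> \<open>Outputs in \<open>D\<close> have become genuine \<Sigma> layers, so nothing from
    \<open>X\<close> is returned outside \<Sigma>.\<close>
  have guarded: "dest (Y \<oplus> X) \<bullet> f' = tmap T (inl Y X \<uplus> ident (SN (Y \<oplus> X))) \<bullet> peel Y f"
    using f X G v by (simp add: f'_def dest_simps dest_G dest_v) (simp add: res_simps dest_v)
  define Q where "Q = (tmap R (inl (Y \<oplus> X) X) \<bullet> G) \<amalg> (eta R ((Y \<oplus> X) \<oplus> X) \<bullet> inr (Y \<oplus> X) X)"
  have Q: "valid Q" "src Q = (Y \<oplus> D) \<oplus> X" "trg Q = N ((Y \<oplus> X) \<oplus> X)"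
    using f X G by (simp_all add: Q_def)
  \<comment> \<open>Naturality of \<open>it'\<close> moves \<open>G\<close> into the loop.\<close>
  have f'_iter: "f' = iter R it' (Y \<oplus> X) (ext R ((Y \<oplus> X) \<oplus> X) Q \<bullet> w)"
    using E.iter_naturality [of w G "Y \<oplus> D" "Y \<oplus> X"] f X w G by (simp add: f'_def v_def Q_def)
  \<comment> \<open>In the new loop body the inner copy of \<open>X\<close> holds the calls under
    \<Sigma> and the outer copy the others; merging the copies restores \<open>f\<close>.\<close>
  have split: "tmap R (ident (Y \<oplus> X) \<amalg> inr Y X) \<bullet> ext R ((Y \<oplus> X) \<oplus> X) Q \<bullet> w = f"
  proof (rule dest_mono [of "Y \<oplus> X"])
    have "tmap R (ident (Y \<oplus> X) \<amalg> inr Y X) \<bullet> ext R ((Y \<oplus> X) \<oplus> X) Q \<bullet> w =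
        ext R (Y \<oplus> X) (G \<amalg> (eta R (Y \<oplus> X) \<bullet> inr Y X)) \<bullet> w"
      using f X G w by (simp add: Q_def R.kleisli_simps)
    then show "dest (Y \<oplus> X) \<bullet> tmap R (ident (Y \<oplus> X) \<amalg> inr Y X) \<bullet> ext R ((Y \<oplus> X) \<oplus> X) Q \<bullet> w =
        dest (Y \<oplus> X) \<bullet> f"
      using f X G w
      by (simp add: dest_simps comp_cotuple dest_G comp_assoc) (simp add: res_simps rearr_def)
  qed (use f X Q w in simp_all)
  have "iter R it' Y f = iter R it' Y f'"
    using E.iter_codiagonal [of "ext R ((Y \<oplus> X) \<oplus> X) Q \<bullet> w" Y] f X Q w
    by (simp add: split f'_iter)
  \<comment> \<open>Unfolding of \<open>it'\<close> makes this a fixpoint of \<open>f'\<close>, and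
    fixpoints of a guarded map are the solutions for its witness.\<close>
  moreover have "solves Y (peel Y f) (iter R it' Y f')"
    using E.iter_unfolding [of f' Y] solves_iff_fixpoint [OF guarded] f X f' by simp
  ultimately show ?thesis
    using solves_unique [of Y "peel Y f" "iter R it' Y f'" "dagger Y f"] dagger_solves f by simp
qed

end

section \<open>Transfer to raw morphisms\<close>

theorem theorem5p1:
  fixes C :: "('o, 'm) bicat" (structure)
    and T :: "('o, 'm) monad_data"
    and it :: "'o \<Rightarrow> 'm \<Rightarrow> 'm"
    and S :: "('o, 'm) functor_data"
    and N :: "'o \<Rightarrow> 'o"
    and out :: "'o \<Rightarrow> 'm"
  assumes "distributive_category C"
    and "complete_elgot_monad C T it"
    and "strong_functor C S"
    and "\<And>X. X \<in> Ob C \<Longrightarrow> final_coalgebra C (resOb C T S X) (resMap C T S X) (N X) (out X)"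
  defines "TS \<equiv> resumption_monad C T S N out"
  shows "\<exists>itN.
    (complete_elgot_monad C TS itN \<and> extends_iteration C T it S N out itN) \<and>
    (\<forall>itN'. complete_elgot_monad C TS itN' \<and> extends_iteration C T it S N out itN' \<longrightarrow>
       (\<forall>X\<in>Ob C. \<forall>Y\<in>Ob C. \<forall>f\<in>hom C X (TOb TS (Y \<oplus> X)). itN' Y f = itN Y f)) \<and>
    (\<forall>X\<in>Ob C. \<forall>Y\<in>Ob C. \<forall>f. guarded C T S N out X Y X f \<longrightarrow>
       itN Y f \<in> hom C X (TOb TS Y) \<and>
       Ext TS Y (Eta TS Y \<nabla> itN Y f) \<cdot> f = itN Y f \<and>
       (\<forall>h\<in>hom C X (TOb TS Y). Ext TS Y (Eta TS Y \<nabla> h) \<cdot> f = h \<longrightarrow> h = itN Y f))"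
proof -
  interpret resumption C T it S N out
    by (intro resumption.intro resumption_axioms.intro assms)
  show ?thesis
    unfolding TS_def
  \<comment> \<open>Cases 1 and 2 provide the operator, case 3 its uniqueness on typed morphisms,
    and cases 4 to 6 deal with guarded maps.\<close>
  proof (intro exI [of _ itN] conjI allI ballI impI, goal_cases)
    case 1
    show ?case
      by (rule complete_elgot_monad_itN)
  next
    case 2
    show ?case
      unfolding extends_iteration_def
    proof (intro ballI impI)
      fix X Y f g
      assume "X \<in> Ob C" "Y \<in> Ob C" "f \<in> hom C X (N (Y \<oplus> X))" "g \<in> hom C X (TOb T (Y \<oplus> X))"
        and eq: "out (Y \<oplus> X) \<cdot> f = TMap C T (Inl C (Y \<oplus> X) (SN (Y \<oplus> X))) \<cdot> g"
      then have fg: "X \<in> Ob C" "Y \<in> Ob C" "f \<in> Mor C" "Dom C f = X" "Cod C f = N (Y \<oplus> X)"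
        "g \<in> Mor C" "Dom C g = X" "Cod C g = TOb T (Y \<oplus> X)"
        by (simp_all add: hom_def)
      have "dest (Y \<oplus> X) \<bullet> lift f = tmap T (inl (Y \<oplus> X) (SN (Y \<oplus> X))) \<bullet> lift g"
        using fg eq by (intro arrow_eqI) (simp_all add: val_res_simps)
      from dagger_extends [OF this]
      have "dest Y \<bullet> dagger Y (lift f) = tmap T (inl Y (SN Y)) \<bullet> iter T it Y (lift g)"
        using fg by simp
      from arg_cong [OF this, of val]
      show "out Y \<cdot> itN Y f = TMap C T (Inl C Y (SN Y)) \<cdot> it Y g"
        using fg by (simp add: val_res_simps val_iter R.val_iter)
    qed
  next
    case (3 it' X Y f)
    then have elgot: "complete_elgot_monad C R it'" and ext: "extends_iteration C T it S N out it'"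
      by auto
    interpret E: complete_elgot_monad C R it'
      by (rule elgot)
    have "iter R it' Y (lift f) = dagger Y (lift f)"
    proof (rule dagger_unique [OF elgot])
      fix X Y f g
      assume fg: "valid f" "valid g" "src f = X" "src g = X" "trg f = N (Y \<oplus> X)" "trg g = TOb T (Y \<oplus> X)"
        "X \<in> Ob C" "Y \<in> Ob C"
        and eq: "dest (Y \<oplus> X) \<bullet> f = tmap T (inl (Y \<oplus> X) (SN (Y \<oplus> X))) \<bullet> g"
      have "out (Y \<oplus> X) \<cdot> val f = TMap C T (Inl C (Y \<oplus> X) (SN (Y \<oplus> X))) \<cdot> val g"
        using arg_cong [OF eq, of val] fg by (simp add: val_res_simps)
      then have "out Y \<cdot> it' Y (val f) = TMap C T (Inl C Y (SN Y)) \<cdot> it Y (val g)"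
        using ext fg valid_val_hom [of f] valid_val_hom [of g] by (auto simp: extends_iteration_def)
      then show "dest Y \<bullet> iter R it' Y f = tmap T (inl Y (SN Y)) \<bullet> iter T it Y g"
        using fg by (intro arrow_eqI) (simp_all add: val_res_simps val_iter E.val_iter)
    qed (use 3 in \<open>simp_all add: hom_def\<close>)
    from arg_cong [OF this, of val] show ?case
      using 3 by (simp add: E.val_iter R.val_iter hom_def)
  next
    case (4 X Y f)
    then show ?case
      using solves_itN(1) [of "lift f" Y] by (simp add: guarded_def hom_def)
  next
    case (5 X Y f)
    then show ?case
      using dagger_unfolding [of "lift f" Y, THEN arg_cong [where f = val]]
      by (simp add: guarded_def hom_def val_res_simps R.val_monad_simps R.val_iter)
  next
    case (6 X Y f h)
    then obtain u where "u \<in> hom C X (TOb T (Y \<oplus> SN (Y \<oplus> X)))"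
      and u: "out (Y \<oplus> X) \<cdot> f = TMap C T (Inl C Y X \<boxplus> Id C (SN (Y \<oplus> X))) \<cdot> u"
      by (auto simp: guarded_def)
    with 6 have fuh: "X \<in> Ob C" "Y \<in> Ob C" "f \<in> Mor C" "Dom C f = X" "Cod C f = N (Y \<oplus> X)"
      "u \<in> Mor C" "Dom C u = X" "Cod C u = TOb T (Y \<oplus> SN (Y \<oplus> X))"
      "h \<in> Mor C" "Dom C h = X" "Cod C h = N Y"
      by (simp_all add: guarded_def hom_def)
    have eq: "dest (Y \<oplus> X) \<bullet> lift f = tmap T (inl Y X \<uplus> ident (SN (Y \<oplus> X))) \<bullet> lift u"
      using fuh u by (intro arrow_eqI) (simp_all add: val_res_simps)
    \<comment> \<open>The witness of guardedness is the peeled map, so every fixpoint solves the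
      equation that determines the iterate.\<close>
    have peel: "peel Y (lift f) = lift u"
      using peel_guarded [OF eq] fuh by simp
    have "ext R Y (eta R Y \<amalg> lift h) \<bullet> lift f = lift h"
      using fuh 6 by (intro arrow_eqI) (simp_all add: R.val_monad_simps)
    then have "solves Y (lift u) (lift h)"
      using solves_iff_fixpoint [OF eq, of "lift h"] fuh by simp
    then have "lift h = dagger Y (lift f)"
      using solves_unique [of Y "lift u" "lift h" "dagger Y (lift f)"] dagger_solves [of "lift f" Y] peel fuh
      by simp
    from arg_cong [OF this, of val] show ?case
      using fuh by (simp add: R.val_iter)
  qed
qed

end
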